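(* The following assertions are equivalent: (i) $S$ is Cohen–Macaulay; (ii) $\mathbf d_{d,0},\ldots,\mathbf d_{d,d-2}$ is an $S$-regular sequence.
   Context: Let $q=p^s$ be a power of a prime $p$, $\mathbb F_q$ the field with $q$ elements, $V$ a $d$-dimensional $\mathbb F_q$-vector space, and $G$ a subgroup of $GL(V)$. Let $R=\mathbb F_q[V]=\operatorname{Sym}_{\mathbb F_q}(V^* )$, graded with $V^*$ in degree $1$, with the natural action of $G$, and let $S=R^G$. Then $S$ contains the Dickson algebra $D^*(d)=R^{GL(V)}$, which is the polynomial ring $\mathbb F_q[\mathbf d_{d,0},\ldots,\mathbf d_{d,d-1}]$, where $\mathbf d_{d,i}$ ($0\le i\le d-1$) is the Dickson polynomial of degree $q^d-q^i$, given by $\prod_{v\in V^*}(X+v)=X^{q^d}+\sum_{i=0}^{d-1}(-1)^{d-i}\mathbf d_{d,i}X^{q^i}$. *)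

theory Defs
  imports
    "HOL-Algebra.Ring_Divisibility"
    "HOL-Computational_Algebra.Polynomial"
    "HOL-Library.Poly_Mapping"
    "HOL-Library.Extended_Nat"
begin

section \<open>Regular sequences and Cohen--Macaulay rings\<close>

text \<open>
  The first conjunct after membership says that the class of \<open>xs ! i\<close> is not a zero divisor on
  the quotient of \<open>A\<close> by the ideal generated by the preceding entries; the last one, that the
  quotient by the whole sequence is nonzero.
\<close>

definition regular_sequence :: "('a, 'm) ring_scheme \<Rightarrow> 'a list \<Rightarrow> bool" where
  "regular_sequence A xs \<longleftrightarrow>
     set xs \<subseteq> carrier A \<and>
     (\<forall>i < length xs. \<forall>a \<in> carrier A.
        xs ! i \<otimes>\<^bsub>A\<^esub> a \<in> genideal A (set (take i xs)) \<longrightarrow> a \<in> genideal A (set (take i xs))) \<and>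
     genideal A (set xs) \<noteq> carrier A"

definition ideal_depth :: "('a, 'm) ring_scheme \<Rightarrow> 'a set \<Rightarrow> enat" where
  "ideal_depth A I = (SUP xs \<in> {xs. regular_sequence A xs \<and> set xs \<subseteq> I}. enat (length xs))"

definition prime_height :: "('a, 'm) ring_scheme \<Rightarrow> 'a set \<Rightarrow> enat" where
  "prime_height A P =
     (SUP n \<in> {n. \<exists>Q :: nat \<Rightarrow> 'a set.
        (\<forall>i \<le> n. primeideal (Q i) A) \<and> (\<forall>i < n. Q i \<subset> Q (Suc i)) \<and> Q n = P}. enat n)"

text \<open>
  The definition of Eisenbud's book (Section 18.2): a Noetherian ring in which
  depth and height (codimension) agree for every maximal ideal. No grading enters.
\<close>

definition cohen_macaulay :: "('a, 'm) ring_scheme \<Rightarrow> bool" where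
  "cohen_macaulay A \<longleftrightarrow>
     cring A \<and> noetherian_ring A \<and>
     (\<forall>P. maximalideal P A \<longrightarrow> ideal_depth A P = prime_height A P)"


section \<open>Vector spaces and general linear groups\<close>

text \<open>The vector space \<open>V\<close> is the whole type \<open>'v\<close>, with scalar multiplication \<open>scale\<close>.\<close>

definition ordered_basis ::
    "('k::field \<Rightarrow> 'v::ab_group_add \<Rightarrow> 'v) \<Rightarrow> nat \<Rightarrow> (nat \<Rightarrow> 'v) \<Rightarrow> bool" where
  "ordered_basis scale d e \<longleftrightarrow>
     inj_on e {..<d} \<and>
     \<not> module.dependent scale (e ` {..<d}) \<and>
     module.span scale (e ` {..<d}) = UNIV"

definition GL :: "('k::field \<Rightarrow> 'v::ab_group_add \<Rightarrow> 'v) \<Rightarrow> ('v \<Rightarrow> 'v) monoid" where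
  "GL scale = \<lparr>carrier = {g. Vector_Spaces.linear scale scale g \<and> bij g},
               monoid.mult = (\<lambda>g h. g \<circ> h), one = id\<rparr>"

definition dual_space :: "('k::field \<Rightarrow> 'v::ab_group_add \<Rightarrow> 'v) \<Rightarrow> ('v \<Rightarrow> 'k) set" where
  "dual_space scale = {\<phi>. Vector_Spaces.linear scale (*) \<phi>}"


section \<open>The symmetric algebra of the dual space and its invariants\<close>

text \<open>
  With respect to a basis \<open>e 0, \<dots>, e (d - 1)\<close> of \<open>V\<close>, the symmetric algebra of the
  dual space is the polynomial ring in the dual basis, whose \<open>i\<close>-th member is the \<open>i\<close>-th variable.
  Polynomials are finitely supported maps from exponent vectors to coefficients,
  with the multiplication of \<^theory>\<open>HOL-Library.Poly_Mapping\<close>.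
\<close>

type_synonym 'k mpolynomial = "(nat \<Rightarrow>\<^sub>0 nat) \<Rightarrow>\<^sub>0 'k"

definition poly_ring :: "nat \<Rightarrow> 'k::comm_ring_1 mpolynomial ring" where
  "poly_ring d =
     \<lparr>carrier = {f. \<forall>m \<in> Poly_Mapping.keys f. Poly_Mapping.keys m \<subseteq> {..<d}},
      monoid.mult = (*), one = 1, zero = 0, add = (+)\<rparr>"

text \<open>The functional \<open>\<phi>\<close> as the homogeneous polynomial
  \<open>\<phi> (e 0) x\<^sub>0 + \<dots> + \<phi> (e (d - 1)) x\<^bsub>d - 1\<^esub>\<close>.\<close>

definition linear_form :: "nat \<Rightarrow> (nat \<Rightarrow> 'v) \<Rightarrow> ('v \<Rightarrow> 'k) \<Rightarrow> 'k::comm_ring_1 mpolynomial" where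
  "linear_form d e \<phi> = (\<Sum>j<d. Poly_Mapping.single (Poly_Mapping.single j 1) (\<phi> (e j)))"

definition coordinate ::
    "('k::field \<Rightarrow> 'v::ab_group_add \<Rightarrow> 'v) \<Rightarrow> nat \<Rightarrow> (nat \<Rightarrow> 'v) \<Rightarrow> nat \<Rightarrow> 'v \<Rightarrow> 'k" where
  "coordinate scale d e i v = module.representation scale (e ` {..<d}) v (e i)"

text \<open>The algebra endomorphism extending the contragredient action
  \<open>\<phi> \<mapsto> \<phi> \<circ> g\<inverse>\<close> on the dual space.\<close>

definition act ::
    "('k::field \<Rightarrow> 'v::ab_group_add \<Rightarrow> 'v) \<Rightarrow> nat \<Rightarrow> (nat \<Rightarrow> 'v) \<Rightarrow> ('v \<Rightarrow> 'v)
      \<Rightarrow> 'k mpolynomial \<Rightarrow> 'k mpolynomial" where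
  "act scale d e g f =
     (\<Sum>m \<in> Poly_Mapping.keys f.
        Poly_Mapping.single 0 (Poly_Mapping.lookup f m) *
        (\<Prod>i \<in> Poly_Mapping.keys m.
           linear_form d e (coordinate scale d e i \<circ> inv_into UNIV g) ^ Poly_Mapping.lookup m i))"

definition invariant_ring ::
    "('k::field \<Rightarrow> 'v::ab_group_add \<Rightarrow> 'v) \<Rightarrow> nat \<Rightarrow> (nat \<Rightarrow> 'v) \<Rightarrow> ('v \<Rightarrow> 'v) set
      \<Rightarrow> 'k mpolynomial ring" where
  "invariant_ring scale d e G =
     (poly_ring d) \<lparr>carrier := {f \<in> carrier (poly_ring d). \<forall>g \<in> G. act scale d e g f = f}\<rparr>"


section \<open>Dickson polynomials\<close>

text \<open>
  With \<open>q\<close> the cardinality of the base field, the product over the dual space equals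
  \<open>X ^ (q ^ d) + (\<Sum>i<d. (-1) ^ (d - i) * dickson i * X ^ (q ^ i))\<close>, so the Dickson polynomial
  is its coefficient at \<open>X ^ (q ^ i)\<close> up to that sign. The product is finite, since \<open>V\<close> is.
\<close>

definition dickson ::
    "('k::{field,finite} \<Rightarrow> 'v::ab_group_add \<Rightarrow> 'v) \<Rightarrow> nat \<Rightarrow> (nat \<Rightarrow> 'v) \<Rightarrow> nat
      \<Rightarrow> 'k mpolynomial" where
  "dickson scale d e i =
     (-1) ^ (d - i) *
     Polynomial.coeff (\<Prod>\<phi> \<in> dual_space scale. [:linear_form d e \<phi>, 1:]) (card (UNIV :: 'k set) ^ i)"

end

theory Submission
  imports Defs "HOL-Computational_Algebra.Computational_Algebra" "HOL-Number_Theory.Residues"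
begin

text \<open>
  Write \<open>S\<close> for the ring of invariants and \<open>c 0, \<dots>, c (d - 1)\<close> for the Dickson polynomials. They are
  homogeneous of positive degree, and \<open>S\<close> is finite over the algebra that they generate. The proof
  shows that both properties in question say that the full sequence \<open>c 0, \<dots>, c (d - 1)\<close> is regular
  on \<open>S\<close>.

  If \<open>S\<close> is Cohen--Macaulay, the maximal ideal of polynomials without constant term, which has height
  at least \<open>d\<close>, contains some regular sequence of length \<open>d\<close>. Powers of its members lie in the ideal of
  the \<open>c i\<close>, and depth sensitivity of Koszul homology together with the grading makes the \<open>c i\<close>
  themselves regular (\<open>relations_skew_up_to_power\<close>, \<open>regular_of_top_forms\<close>). Conversely, let
  the \<open>c i\<close> be regular. No chain of primes in \<open>S\<close> is longer than \<open>d\<close>, by a count of residue classes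
  (\<open>prime_chain_length_le\<close>), while every maximal ideal \<open>P\<close> has a finite residue field
  (\<open>finite_residue_field\<close>). So \<open>P\<close> contains elements \<open>c i ^ (N + 1) - c i\<close> with \<open>N > 0\<close>. Their top
  forms are powers of the \<open>c i\<close>, hence they form a regular sequence of length \<open>d\<close> in \<open>P\<close>.

  It remains to see why regularity of \<open>c 0, \<dots>, c (d - 2)\<close> alone forces that of the full sequence
  (\<open>dickson_regular\<close>). At a nonzero vector \<open>v\<close> these polynomials vanish while \<open>c (d - 1)\<close> does
  not, and \<open>c (d - 1) - c (d - 1)(v)\<close> is a non-zero-divisor modulo any homogeneous ideal. So \<open>S\<close> has
  depth \<open>d\<close> at the image of \<open>v\<close>. Let \<open>H\<close> be the stabilizer of \<open>v\<close>. The extension of \<open>S\<close> by the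
  invariants \<open>B\<close> of \<open>H\<close> is free near \<open>v\<close>, thus \<open>B\<close> has depth \<open>d\<close> at \<open>v\<close>
  (\<open>regular_near_point\<close>). Translation by \<open>v\<close> commutes with \<open>H\<close>, so that \<open>B\<close> also has depth \<open>d\<close> at
  the origin, and the \<open>c i\<close> are regular on \<open>B\<close>. Finally, since the number of nonzero vectors is prime
  to the characteristic, \<open>v\<close> can be chosen with an orbit of length prime to the characteristic; then
  averaging over the orbit makes \<open>S\<close> a direct summand of \<open>B\<close>, and the \<open>c i\<close> are regular on \<open>S\<close>.

  Rings are subsets \<open>B\<close> of a type of commutative rings, and a residue class ring \<open>B / N\<close> is handled by
  statements modulo \<open>N\<close>; \<open>ring_on\<close> connects this with records of rings.
\<close>

section \<open>Subrings and their modules\<close>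

locale sub_comm_ring =
  fixes B :: "'a::comm_ring_1 set"
  assumes one_mem [simp]: "1 \<in> B"
    and diff_mem [simp]: "x \<in> B \<Longrightarrow> y \<in> B \<Longrightarrow> x - y \<in> B"
    and mult_mem [simp]: "x \<in> B \<Longrightarrow> y \<in> B \<Longrightarrow> x * y \<in> B"
begin

lemma zero_mem [simp]: "0 \<in> B"
  using diff_mem[OF one_mem one_mem] by simp

lemma uminus_mem [simp]: "x \<in> B \<Longrightarrow> - x \<in> B"
  using diff_mem[OF zero_mem] by fastforce

lemma add_mem [simp]: "x \<in> B \<Longrightarrow> y \<in> B \<Longrightarrow> x + y \<in> B"
  using diff_mem[of x "- y"] by simp

lemma power_mem [simp]: "x \<in> B \<Longrightarrow> x ^ n \<in> B"
  by (induction n) auto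

lemma sum_mem: "(\<And>i. i \<in> I \<Longrightarrow> f i \<in> B) \<Longrightarrow> sum f I \<in> B"
  by (induction I rule: infinite_finite_induct) auto

lemma prod_mem: "(\<And>i. i \<in> I \<Longrightarrow> f i \<in> B) \<Longrightarrow> prod f I \<in> B"
  by (induction I rule: infinite_finite_induct) auto

end

definition submod :: "'a::comm_ring_1 set \<Rightarrow> 'a set \<Rightarrow> bool" where
  "submod A N \<longleftrightarrow> 0 \<in> N \<and> (\<forall>x\<in>N. \<forall>y\<in>N. x + y \<in> N) \<and> (\<forall>a\<in>A. \<forall>x\<in>N. a * x \<in> N)"

lemma submodD:
  assumes "submod A N"
  shows "0 \<in> N" "x \<in> N \<Longrightarrow> y \<in> N \<Longrightarrow> x + y \<in> N" "a \<in> A \<Longrightarrow> x \<in> N \<Longrightarrow> a * x \<in> N"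
  using assms by (auto simp: submod_def)

lemma submod_sum:
  assumes "submod A N" "\<And>i. i \<in> I \<Longrightarrow> f i \<in> N"
  shows "sum f I \<in> N"
  using assms(2) by (induction I rule: infinite_finite_induct) (auto simp: submodD[OF assms(1)])

lemma (in sub_comm_ring) submod_uminus:
  assumes "submod B N" "x \<in> N"
  shows "- x \<in> N"
  using submodD(3)[OF assms(1) uminus_mem[OF one_mem] assms(2)] by simp

lemma (in sub_comm_ring) submod_diff:
  assumes "submod B N" "x \<in> N" "y \<in> N"
  shows "x - y \<in> N"
  using submodD(2)[OF assms(1) assms(2) submod_uminus[OF assms(1,3)]] by simp

lemma (in sub_comm_ring) submod_self: "submod B B"
  by (auto simp: submod_def)

lemma (in sub_comm_ring) submod_adjoin:
  assumes "submod B N"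
  shows "submod B {w + b * x | w b. w \<in> N \<and> b \<in> B}" (is "submod B ?X")
  unfolding submod_def
proof (intro conjI ballI)
  show "0 \<in> ?X"
    using submodD(1)[OF assms] by (intro CollectI exI[of _ 0]) auto
  fix u v assume "u \<in> ?X" "v \<in> ?X"
  then obtain w b w' b' where *: "u = w + b * x" "v = w' + b' * x" "w \<in> N" "w' \<in> N" "b \<in> B" "b' \<in> B"
    by auto
  have "u + v = (w + w') + (b + b') * x"
    by (simp add: * algebra_simps)
  then show "u + v \<in> ?X"
    using submodD(2)[OF assms *(3,4)] add_mem[OF *(5,6)] by blast
next
  fix a u assume a: "a \<in> B" and "u \<in> ?X"
  then obtain w b where *: "u = w + b * x" "w \<in> N" "b \<in> B"
    by auto
  have "a * u = a * w + (a * b) * x"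
    by (simp add: * algebra_simps)
  then show "a * u \<in> ?X"
    using submodD(3)[OF assms a *(2)] mult_mem[OF a *(3)] by blast
qed

lemma increasing_union_absorbs:
  fixes M :: "nat \<Rightarrow> 'a set"
  assumes "\<And>i j. i \<le> j \<Longrightarrow> M i \<subseteq> M j" "finite X" "X \<subseteq> (\<Union>n. M n)"
  shows "\<exists>n. X \<subseteq> M n"
  using assms(2,3)
proof (induction X rule: finite_induct)
  case (insert x X)
  then obtain i j where "X \<subseteq> M i" "x \<in> M j"
    by auto
  then have "insert x X \<subseteq> M (max i j)"
    using assms(1)[of i "max i j"] assms(1)[of j "max i j"] by auto
  then show ?case by blast
qed auto

lemma submod_increasing_union:
  assumes sub: "\<And>n. submod A (M n)" and mono: "\<And>i j. i \<le> (j :: nat) \<Longrightarrow> M i \<subseteq> M j"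
  shows "submod A (\<Union>n. M n)"
  unfolding submod_def
proof (intro conjI ballI)
  show "0 \<in> (\<Union>n. M n)"
    using submodD(1)[OF sub] by blast
  fix u w assume "u \<in> (\<Union>n. M n)" "w \<in> (\<Union>n. M n)"
  then have "\<exists>n. {u, w} \<subseteq> M n"
    by (intro increasing_union_absorbs mono) auto
  then show "u + w \<in> (\<Union>n. M n)"
    using submodD(2)[OF sub] by blast
next
  fix a u assume "a \<in> A" "u \<in> (\<Union>n. M n)"
  then show "a * u \<in> (\<Union>n. M n)"
    using submodD(3)[OF sub] by blast
qed

inductive_set aspan :: "'a::comm_ring_1 set \<Rightarrow> 'a set \<Rightarrow> 'a set" for A X where
  aspan_zero: "0 \<in> aspan A X"
| aspan_step: "a \<in> A \<Longrightarrow> x \<in> X \<Longrightarrow> r \<in> aspan A X \<Longrightarrow> a * x + r \<in> aspan A X"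

lemma aspan_least:
  assumes "submod A N" "X \<subseteq> N"
  shows "aspan A X \<subseteq> N"
proof
  fix u assume "u \<in> aspan A X"
  then show "u \<in> N"
    using assms by induction (auto simp: submod_def)
qed

lemma (in sub_comm_ring) submod_aspan: "submod B (aspan B X)"
proof -
  have "u + w \<in> aspan B X" if "u \<in> aspan B X" "w \<in> aspan B X" for u w
    using that by (induction u) (auto simp: add.assoc intro: aspan_step)
  moreover have "b * u \<in> aspan B X" if "b \<in> B" "u \<in> aspan B X" for b u
    using that(2,1)
  proof (induction u)
    case (aspan_step a x r)
    then have "(b * a) * x + b * r \<in> aspan B X"
      by (intro aspan.aspan_step) auto
    then show ?case by (simp add: algebra_simps)
  qed (auto intro: aspan_zero)
  ultimately show ?thesis
    by (auto simp: submod_def intro: aspan_zero)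
qed

lemma (in sub_comm_ring) aspan_superset: "X \<subseteq> aspan B X"
  using aspan_step[OF one_mem _ aspan_zero] by fastforce

text \<open>Regularity depends on the order of the generators, which are therefore indexed. The index bound
  lets one sequence serve for all of its initial segments.\<close>

definition lincombs :: "'a::comm_ring_1 set \<Rightarrow> (nat \<Rightarrow> 'a) \<Rightarrow> nat \<Rightarrow> 'a set" where
  "lincombs B y k = {u. \<exists>b. (\<forall>i<k. b i \<in> B) \<and> u = (\<Sum>i<k. b i * y i)}"

lemma lincombsI: "(\<And>i. i < k \<Longrightarrow> b i \<in> B) \<Longrightarrow> (\<Sum>i<k. b i * y i) \<in> lincombs B y k"
  by (auto simp: lincombs_def)

lemma lincombs_0 [simp]: "lincombs B y 0 = {0}"
  by (auto simp: lincombs_def)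

lemma lincombs_Suc: "lincombs B y (Suc k) = {u + b * y k | u b. u \<in> lincombs B y k \<and> b \<in> B}" (is "?L = ?R")
proof
  show "?L \<subseteq> ?R"
  proof
    fix w assume "w \<in> ?L"
    then obtain b where b: "\<forall>i<Suc k. b i \<in> B" "w = (\<Sum>i<k. b i * y i) + b k * y k"
      by (auto simp: lincombs_def)
    have "(\<Sum>i<k. b i * y i) \<in> lincombs B y k"
      using b by (intro lincombsI) auto
    then show "w \<in> ?R"
      using b by auto
  qed
  show "?R \<subseteq> ?L"
  proof
    fix w assume "w \<in> ?R"
    then obtain b c where *: "\<forall>i<k. b i \<in> B" "c \<in> B" "w = (\<Sum>i<k. b i * y i) + c * y k"
      by (auto simp: lincombs_def)
    have "w = (\<Sum>i<Suc k. (b(k := c)) i * y i)"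
      using * by simp
    moreover have "\<forall>i<Suc k. (b(k := c)) i \<in> B"
      using * by (auto simp: less_Suc_eq)
    ultimately show "w \<in> ?L"
      unfolding lincombs_def by blast
  qed
qed

lemma lincombs_cong: "(\<And>i. i < k \<Longrightarrow> y i = z i) \<Longrightarrow> lincombs B y k = lincombs B z k"
  by (simp add: lincombs_def)

lemma (in sub_comm_ring) aspan_eq_lc: "aspan B (y ` {..<k}) = lincombs B y k"
proof
  have "submod B (lincombs B y k)"
    unfolding submod_def
  proof (intro conjI ballI)
    show "0 \<in> lincombs B y k"
      using lincombsI[of k "\<lambda>_. 0" B y] by simp
    fix u w assume "u \<in> lincombs B y k" "w \<in> lincombs B y k"
    then obtain a b where "\<forall>i<k. a i \<in> B" "u = (\<Sum>i<k. a i * y i)"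
       "\<forall>i<k. b i \<in> B" "w = (\<Sum>i<k. b i * y i)"
      by (auto simp: lincombs_def)
    then show "u + w \<in> lincombs B y k"
      using lincombsI[of k "\<lambda>i. a i + b i" B y] by (simp add: sum.distrib algebra_simps)
  next
    fix c u assume "c \<in> B" "u \<in> lincombs B y k"
    then obtain a where "\<forall>i<k. a i \<in> B" "u = (\<Sum>i<k. a i * y i)"
      by (auto simp: lincombs_def)
    then show "c * u \<in> lincombs B y k"
      using lincombsI[of k "\<lambda>i. c * a i" B y] \<open>c \<in> B\<close> by (simp add: sum_distrib_left algebra_simps)
  qed
  moreover have "y i \<in> lincombs B y k" if "i < k" for i
    using lincombsI[of k "\<lambda>j. if j = i then 1 else 0" B y] that
    by (simp add: if_distrib[of "\<lambda>t. t * _"] cong: if_cong)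
  ultimately show "aspan B (y ` {..<k}) \<subseteq> lincombs B y k"
    by (intro aspan_least) auto
next
  show "lincombs B y k \<subseteq> aspan B (y ` {..<k})"
  proof
    fix u assume "u \<in> lincombs B y k"
    then obtain a where "\<forall>i<k. a i \<in> B" "u = (\<Sum>i<k. a i * y i)"
      by (auto simp: lincombs_def)
    then show "u \<in> aspan B (y ` {..<k})"
      using aspan_superset[of "y ` {..<k}"]
      by (auto intro!: submod_sum[OF submod_aspan] submodD(3)[OF submod_aspan])
  qed
qed

lemma (in sub_comm_ring) submod_lc: "submod B (lincombs B y k)"
  using submod_aspan[of "y ` {..<k}"] by (simp add: aspan_eq_lc)

lemma (in sub_comm_ring) lincombs_subset:
  assumes "\<And>i. i < k \<Longrightarrow> y i \<in> B"
  shows "lincombs B y k \<subseteq> B"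
  using aspan_least[OF submod_self, of "y ` {..<k}"] assms by (auto simp: aspan_eq_lc)

lemma (in sub_comm_ring) lincombs_mem:
  assumes "i < k"
  shows "y i \<in> lincombs B y k"
  using aspan_superset[of "y ` {..<k}"] assms by (auto simp: aspan_eq_lc)

lemma (in sub_comm_ring) lincombs_mono:
  assumes "i \<le> k"
  shows "lincombs B y i \<subseteq> lincombs B y k"
  using aspan_least[OF submod_aspan[of "y ` {..<k}"], of "y ` {..<i}"] assms
    aspan_superset[of "y ` {..<k}"]
  by (fastforce simp: aspan_eq_lc)

text \<open>With \<open>\<delta> = 1\<close> this is regularity up to properness of the ideal. A general \<open>\<delta>\<close> replaces
  localization: for a maximal ideal that does not contain \<open>\<delta>\<close>, its members become
  non-zero-divisors modulo their predecessors in the local ring there.\<close>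

definition almost_regular :: "'a::comm_ring_1 set \<Rightarrow> 'a \<Rightarrow> (nat \<Rightarrow> 'a) \<Rightarrow> nat \<Rightarrow> bool" where
  "almost_regular B \<delta> y n \<longleftrightarrow>
     (\<forall>k<n. \<forall>a\<in>B. y k * a \<in> lincombs B y k \<longrightarrow> \<delta> * a \<in> lincombs B y k)"

subsection \<open>Subrings as ring records\<close>

definition ring_on :: "'a::comm_ring_1 set \<Rightarrow> 'a ring" where
  "ring_on B = \<lparr>carrier = B, monoid.mult = (*), one = 1, zero = 0, add = (+)\<rparr>"

lemma ring_on_simps [simp]:
  "carrier (ring_on B) = B" "x \<otimes>\<^bsub>ring_on B\<^esub> y = x * y" "\<one>\<^bsub>ring_on B\<^esub> = 1"
  "\<zero>\<^bsub>ring_on B\<^esub> = 0" "x \<oplus>\<^bsub>ring_on B\<^esub> y = x + y"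
  by (simp_all add: ring_on_def)

context sub_comm_ring
begin

lemma cring_ring_on: "cring (ring_on B)"
proof (rule cringI)
  show "abelian_group (ring_on B)"
  proof (rule abelian_groupI)
    fix x assume "x \<in> carrier (ring_on B)"
    then show "\<exists>y\<in>carrier (ring_on B). y \<oplus>\<^bsub>ring_on B\<^esub> x = \<zero>\<^bsub>ring_on B\<^esub>"
      by (intro bexI[of _ "- x"]) auto
  qed (auto simp: algebra_simps)
  show "Group.comm_monoid (ring_on B)"
    by (rule comm_monoidI) (auto simp: algebra_simps)
qed (auto simp: algebra_simps)

lemma a_inv_ring_on: "x \<in> B \<Longrightarrow> \<ominus>\<^bsub>ring_on B\<^esub> x = - x"
proof -
  interpret cring "ring_on B" by (rule cring_ring_on)
  assume "x \<in> B"
  then have "- x \<oplus>\<^bsub>ring_on B\<^esub> x = \<zero>\<^bsub>ring_on B\<^esub>" "x \<in> carrier (ring_on B)" "- x \<in> carrier (ring_on B)"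
    by auto
  then show ?thesis
    using minus_equality by blast
qed

lemma ideal_ring_on_iff: "ideal I (ring_on B) \<longleftrightarrow> I \<subseteq> B \<and> submod B I"
proof
  assume "ideal I (ring_on B)"
  then interpret ideal I "ring_on B" .
  show "I \<subseteq> B \<and> submod B I"
    using a_subset I_l_closed additive_subgroup.a_closed[OF additive_subgroup_axioms]
      additive_subgroup.zero_closed[OF additive_subgroup_axioms]
    by (auto simp: submod_def)
next
  assume *: "I \<subseteq> B \<and> submod B I"
  interpret R: cring "ring_on B" by (rule cring_ring_on)
  show "ideal I (ring_on B)"
  proof (rule idealI)
    show "ring (ring_on B)" by (rule R.ring_axioms)
    show "subgroup I (add_monoid (ring_on B))"
    proof (rule subgroup.intro)
      fix x assume "x \<in> I"
      then have "inv\<^bsub>add_monoid (ring_on B)\<^esub> x = - x"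
        using * a_inv_ring_on[of x] by (auto simp: a_inv_def)
      then show "inv\<^bsub>add_monoid (ring_on B)\<^esub> x \<in> I"
        using * \<open>x \<in> I\<close> by (auto simp: submod_uminus)
    qed (use * in \<open>auto simp: submod_def\<close>)
    fix a x assume "a \<in> I" "x \<in> carrier (ring_on B)"
    then show "x \<otimes>\<^bsub>ring_on B\<^esub> a \<in> I" "a \<otimes>\<^bsub>ring_on B\<^esub> x \<in> I"
      using * submodD(3)[of B I x a] by (auto simp: mult.commute)
  qed
qed

lemma genideal_ring_on:
  assumes "X \<subseteq> B"
  shows "genideal (ring_on B) X = aspan B X"
proof
  have "aspan B X \<subseteq> B"
    by (rule aspan_least[OF submod_self assms])
  then show "genideal (ring_on B) X \<subseteq> aspan B X"
    unfolding genideal_def using aspan_superset submod_aspan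
    by (auto simp: ideal_ring_on_iff)
  show "aspan B X \<subseteq> genideal (ring_on B) X"
    unfolding genideal_def using aspan_least by (auto simp: ideal_ring_on_iff)
qed

lemma set_take_nth: "k \<le> length xs \<Longrightarrow> set (take k xs) = (\<lambda>i. xs ! i) ` {..<k}"
  by (auto simp: set_conv_nth image_def) (metis min.absorb2 nth_take)

lemma regular_sequence_ring_on_iff:
  "regular_sequence (ring_on B) xs \<longleftrightarrow>
     (\<forall>i<length xs. xs ! i \<in> B) \<and> almost_regular B 1 (\<lambda>i. xs ! i) (length xs) \<and>
     lincombs B (\<lambda>i. xs ! i) (length xs) \<noteq> B"
proof (cases "set xs \<subseteq> B")
  case True
  have "genideal (ring_on B) (set (take i xs)) = lincombs B (\<lambda>i. xs ! i) i" if "i \<le> length xs" for i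
    by (metis True aspan_eq_lc genideal_ring_on set_take_nth set_take_subset subset_trans that)
  from this this[of "length xs"] show ?thesis
    using True by (auto simp: regular_sequence_def almost_regular_def)
next
  case False
  then show ?thesis
    by (auto simp: regular_sequence_def in_set_conv_nth subset_iff)
qed

end

section \<open>The Koszul complex\<close>

text \<open>The summand of the Koszul complex of \<open>cs\<close> that belongs to a set of positions is indexed by
  the characteristic list of that set. As the complex of \<open>c # cs\<close> is the mapping cone of \<open>c\<close> on
  the complex of \<open>cs\<close>, differential and contractions are defined by recursion on \<open>cs\<close>,
  which takes care of all signs.\<close>

fun kdiff :: "'a::comm_ring_1 list \<Rightarrow> (bool list \<Rightarrow> 'a) \<Rightarrow> bool list \<Rightarrow> 'a" where
  "kdiff (c # cs) f (b # bs) =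
     (if b then - kdiff cs (\<lambda>x. f (True # x)) bs
      else kdiff cs (\<lambda>x. f (False # x)) bs + c * f (True # bs))"
| "kdiff _ _ _ = 0"

fun kcontr :: "nat \<Rightarrow> (bool list \<Rightarrow> 'a::comm_ring_1) \<Rightarrow> bool list \<Rightarrow> 'a" where
  "kcontr 0 f (b # bs) = (if b then f (False # bs) else 0)"
| "kcontr (Suc j) f (b # bs) =
     (if b then - kcontr j (\<lambda>x. f (True # x)) bs else kcontr j (\<lambda>x. f (False # x)) bs)"
| "kcontr _ _ [] = 0"

definition kdeg :: "nat \<Rightarrow> nat \<Rightarrow> bool list set" where
  "kdeg n i = {bs. length bs = n \<and> count_list bs True = i}"

lemma kdiff_linear:
  "kdiff cs (\<lambda>x. a * f x + b * g x) bs = a * kdiff cs f bs + b * kdiff cs g bs"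
proof (induction cs f bs arbitrary: g rule: kdiff.induct)
  case (1 c cs f b' bs)
  show ?case
    using 1(1)[of "\<lambda>x. g (True # x)"] 1(2)[of "\<lambda>x. g (False # x)"]
    by (cases b') (simp_all only: kdiff.simps if_True if_False simp_thms, simp_all add: algebra_simps)
qed auto

lemma kdiff_zero: "kdiff cs (\<lambda>x. 0) bs = 0"
  using kdiff_linear[of cs 0 "\<lambda>x. 0" 0 "\<lambda>x. 0" bs] by simp

lemma kdiff_uminus: "kdiff cs (\<lambda>x. - f x) bs = - kdiff cs f bs"
  using kdiff_linear[of cs "-1" f 0 "\<lambda>x. 0" bs] by (simp add: kdiff_zero)

lemma kdiff_scale: "kdiff cs (\<lambda>x. a * f x) bs = a * kdiff cs f bs"
  using kdiff_linear[of cs a f 0 "\<lambda>x. 0" bs] by simp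

lemma kdiff_add: "kdiff cs (\<lambda>x. f x + g x) bs = kdiff cs f bs + kdiff cs g bs"
  using kdiff_linear[of cs 1 f 1 g bs] by simp

lemma kdiff_sum: "kdiff cs (\<lambda>x. \<Sum>i\<in>I. f i x) bs = (\<Sum>i\<in>I. kdiff cs (f i) bs)"
  by (induction I rule: infinite_finite_induct) (auto simp: kdiff_zero kdiff_add)

lemma kcontr_linear:
  "kcontr j (\<lambda>x. a * f x + b * g x) bs = a * kcontr j f bs + b * kcontr j g bs"
proof (induction j f bs arbitrary: g rule: kcontr.induct)
  case (2 j f b' bs)
  then show ?case
    by (cases b') simp_all
qed auto

lemma kcontr_uminus: "kcontr j (\<lambda>x. - f x) bs = - kcontr j f bs"
  using kcontr_linear[of j "-1" f 0 "\<lambda>x. 0" bs] by simp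

lemma kdiff_kdiff: "kdiff cs (kdiff cs f) bs = 0"
proof (induction cs f bs rule: kdiff.induct)
  case (1 c cs f b bs)
  then show ?case
    by (auto simp: kdiff_uminus kdiff_add kdiff_scale)
qed auto

text \<open>This is why every element of the ideal of \<open>cs\<close> annihilates the homology.\<close>

lemma kcontr_homotopy:
  assumes "length bs = length cs" "j < length cs"
  shows "kdiff cs (kcontr j f) bs + kcontr j (kdiff cs f) bs = cs ! j * f bs"
  using assms
proof (induction cs arbitrary: j f bs)
  case (Cons c cs)
  then obtain b bs' where bs: "bs = b # bs'" "length bs' = length cs"
    by (cases bs) auto
  show ?case
  proof (cases j)
    case 0
    then show ?thesis
      using bs by (auto simp: kdiff_zero)
  next
    case (Suc i)
    then have IH: "kdiff cs (kcontr i g) bs' + kcontr i (kdiff cs g) bs' = cs ! i * g bs'" for g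
      using Cons bs by auto
    have "kcontr i (\<lambda>x. kdiff cs g x + c * k x) bs' = kcontr i (kdiff cs g) bs' + c * kcontr i k bs'" for g k
      using kcontr_linear[of i 1 "kdiff cs g" c k bs'] by simp
    then show ?thesis
      using bs Suc IH[of "\<lambda>x. f (True # x)"] IH[of "\<lambda>x. f (False # x)"]
      by (auto simp: kdiff_uminus kcontr_uminus algebra_simps)
  qed
qed auto

context sub_comm_ring
begin

lemma kdiff_mem:
  assumes "submod B M" "set cs \<subseteq> B" "length bs = length cs"
    and "\<And>x. x \<in> kdeg (length cs) (Suc (count_list bs True)) \<Longrightarrow> f x \<in> M"
  shows "kdiff cs f bs \<in> M"
  using assms(2-)
proof (induction cs f bs rule: kdiff.induct)
  case (1 c cs f b bs)
  have *: "kdiff cs (\<lambda>x. f (b # x)) bs \<in> M"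
    using 1 by (cases b) (auto simp: kdeg_def)
  show ?case
  proof (cases b)
    case False
    then have "c * f (True # bs) \<in> M"
      using 1(3-) by (intro submodD(3)[OF assms(1)]) (auto simp: kdeg_def)
    with * False show ?thesis
      by (auto intro: submodD(2)[OF assms(1)])
  qed (use * in \<open>auto intro: submod_uminus[OF assms(1)]\<close>)
qed (auto simp: submodD(1)[OF assms(1)])

lemma kcontr_mem:
  assumes "submod B M"
    and "\<And>x. length x = length bs \<Longrightarrow> Suc (count_list x True) = count_list bs True \<Longrightarrow> f x \<in> M"
  shows "kcontr j f bs \<in> M"
  using assms(2)
proof (induction j f bs rule: kcontr.induct)
  case (2 j f b bs)
  then show ?case
    by (cases b) (auto intro: submod_uminus[OF assms(1)])
qed (auto simp: submodD(1)[OF assms(1)])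

text \<open>Vanishing of the \<open>i\<close>-th Koszul homology of \<open>B / N\<close> up to powers of \<open>\<delta>\<close>. Cochains are lifted
  to \<open>B\<close>, and the conditions are read modulo \<open>N\<close>.\<close>

definition kacyclic :: "'a set \<Rightarrow> 'a \<Rightarrow> 'a list \<Rightarrow> nat \<Rightarrow> bool" where
  "kacyclic N \<delta> cs i \<longleftrightarrow>
     (\<forall>f. (\<forall>x\<in>kdeg (length cs) i. f x \<in> B) \<longrightarrow>
          (\<forall>x. length x = length cs \<longrightarrow> Suc (count_list x True) = i \<longrightarrow> kdiff cs f x \<in> N) \<longrightarrow>
          (\<exists>m g. (\<forall>x\<in>kdeg (length cs) (Suc i). g x \<in> B) \<and>
                 (\<forall>x\<in>kdeg (length cs) i. \<delta> ^ m * f x - kdiff cs g x \<in> N)))"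

text \<open>The long exact sequence of multiplication by \<open>y\<close> on \<open>B / N\<close>: if the homology of
  \<open>B / (N + y B)\<close> vanishes in degree \<open>i + 1\<close>, then \<open>y\<close> is injective on the homology of \<open>B / N\<close>
  in degree \<open>i\<close>; but a power of \<open>y\<close> in the ideal of \<open>cs\<close> is homotopic to zero.\<close>

lemma kacyclic_step:
  assumes N: "submod B N" "N \<subseteq> B" and cs: "set cs \<subseteq> B" and y: "y \<in> B" and \<delta>: "\<delta> \<in> B"
    and pow: "y ^ a \<in> lincombs B (\<lambda>j. cs ! j) (length cs)"
    and reg: "\<And>u. u \<in> B \<Longrightarrow> y * u \<in> N \<Longrightarrow> \<delta> * u \<in> N"
    and acyc: "kacyclic {y * b + w | b w. b \<in> B \<and> w \<in> N} \<delta> cs (Suc i)"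
  shows "kacyclic N \<delta> cs i"
proof -
  let ?n = "length cs"
  let ?N' = "{y * b + w | b w. b \<in> B \<and> w \<in> N}"
  note N_sub = submod_diff[OF N(1)] and N_add = submodD(2)[OF N(1)] and N_mult = submodD(3)[OF N(1)]
  \<comment> \<open>From the vanishing modulo \<open>N + y B\<close>, a cochain \<open>g\<close> whose differential is divisible by \<open>y\<close> modulo \<open>N\<close>
    is, up to boundaries and a power of \<open>\<delta>\<close>, itself divisible by \<open>y\<close>.\<close>
  have cancel_y: "\<exists>m w. (\<forall>x\<in>kdeg ?n (Suc i). w x \<in> B) \<and> (\<forall>x\<in>kdeg ?n i. \<delta> ^ m * f x - kdiff cs w x \<in> N)"
    if f: "\<forall>x\<in>kdeg ?n i. f x \<in> B" and g: "\<forall>x\<in>kdeg ?n (Suc i). g x \<in> B"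
      and fg: "\<forall>x\<in>kdeg ?n i. y * f x - kdiff cs g x \<in> N" for f g
  proof -
    have cyc: "kdiff cs g x \<in> ?N'" if "x \<in> kdeg ?n i" for x
    proof -
      have "kdiff cs g x = y * f x + - (y * f x - kdiff cs g x)"
        by simp
      then show ?thesis
        using f fg that submod_uminus[OF N(1)] by blast
    qed
    obtain m g' where g': "\<forall>x\<in>kdeg ?n (Suc (Suc i)). g' x \<in> B"
      and *: "\<forall>x\<in>kdeg ?n (Suc i). \<delta> ^ m * g x - kdiff cs g' x \<in> ?N'"
      using acyc[unfolded kacyclic_def, rule_format, of g] g cyc by (force simp: kdeg_def)
    have "\<forall>x\<in>kdeg ?n (Suc i). \<exists>b. b \<in> B \<and> (\<delta> ^ m * g x - kdiff cs g' x) - y * b \<in> N"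
      using * by fastforce
    then obtain w where w: "\<forall>x\<in>kdeg ?n (Suc i). w x \<in> B \<and> (\<delta> ^ m * g x - kdiff cs g' x) - y * w x \<in> N"
      by metis
    have "\<delta> ^ Suc m * f x - kdiff cs (\<lambda>t. \<delta> * w t) x \<in> N" if x: "x \<in> kdeg ?n i" for x
    proof -
      have len: "length x = ?n" and cnt: "count_list x True = i"
        using x by (auto simp: kdeg_def)
      have "kdiff cs (\<lambda>t. (\<delta> ^ m * g t - kdiff cs g' t) - y * w t) x \<in> N"
        using w len cnt by (intro kdiff_mem[OF N(1) cs]) auto
      moreover have "kdiff cs (\<lambda>t. (\<delta> ^ m * g t - kdiff cs g' t) - y * w t) x =
          \<delta> ^ m * kdiff cs g x - y * kdiff cs w x"
        using kdiff_linear[of cs 1 "\<lambda>t. \<delta> ^ m * g t - kdiff cs g' t" "- y" w x]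
          kdiff_linear[of cs "\<delta> ^ m" g "- 1" "kdiff cs g'" x]
        by (simp add: kdiff_kdiff)
      moreover have "\<delta> ^ m * (y * f x - kdiff cs g x) \<in> N"
        using fg x \<delta> by (intro N_mult) auto
      ultimately have "(\<delta> ^ m * kdiff cs g x - y * kdiff cs w x) + \<delta> ^ m * (y * f x - kdiff cs g x) \<in> N"
        by (intro N_add) auto
      then have "y * (\<delta> ^ m * f x - kdiff cs w x) \<in> N"
        by (simp add: algebra_simps)
      moreover have "kdiff cs w x \<in> B"
        using w len cnt by (intro kdiff_mem[OF submod_self cs]) auto
      ultimately have "\<delta> * (\<delta> ^ m * f x - kdiff cs w x) \<in> N"
        using f x \<delta> by (intro reg) auto
      then show ?thesis
        by (simp add: kdiff_scale algebra_simps)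
    qed
    moreover have "\<forall>x\<in>kdeg ?n (Suc i). \<delta> * w x \<in> B"
      using w \<delta> by auto
    ultimately show ?thesis
      by (intro exI[of _ "Suc m"] exI[of _ "\<lambda>t. \<delta> * w t"]) auto
  qed
  have cancel_pow: "\<exists>m w. (\<forall>x\<in>kdeg ?n (Suc i). w x \<in> B) \<and> (\<forall>x\<in>kdeg ?n i. \<delta> ^ m * f x - kdiff cs w x \<in> N)"
    if "\<forall>x\<in>kdeg ?n i. f x \<in> B" "\<forall>x\<in>kdeg ?n (Suc i). g x \<in> B"
      "\<forall>x\<in>kdeg ?n i. y ^ e * f x - kdiff cs g x \<in> N" for e f g
    using that
  proof (induction e arbitrary: f g)
    case 0
    then show ?case
      by (intro exI[of _ 0] exI[of _ g]) auto
  next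
    case (Suc e)
    then obtain m w where w: "\<forall>x\<in>kdeg ?n (Suc i). w x \<in> B"
      and *: "\<forall>x\<in>kdeg ?n i. \<delta> ^ m * (y ^ e * f x) - kdiff cs w x \<in> N"
      using cancel_y[of "\<lambda>x. y ^ e * f x" g] y by (auto simp: mult.assoc)
    obtain m' w' where "\<forall>x\<in>kdeg ?n (Suc i). w' x \<in> B"
       "\<forall>x\<in>kdeg ?n i. \<delta> ^ m' * (\<delta> ^ m * f x) - kdiff cs w' x \<in> N"
      using Suc.IH[of "\<lambda>x. \<delta> ^ m * f x" w] w * Suc.prems(1) \<delta> by (auto simp: mult.left_commute)
    then show ?case
      by (intro exI[of _ "m' + m"] exI[of _ w']) (auto simp: power_add mult.assoc)
  qed
  show ?thesis
    unfolding kacyclic_def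
  proof (intro allI impI)
    fix f
    assume f: "\<forall>x\<in>kdeg ?n i. f x \<in> B"
      and cyc: "\<forall>x. length x = ?n \<longrightarrow> Suc (count_list x True) = i \<longrightarrow> kdiff cs f x \<in> N"
    obtain b where b: "\<forall>j<?n. b j \<in> B" "y ^ a = (\<Sum>j<?n. b j * cs ! j)"
      using pow by (auto simp: lincombs_def)
    define h where "h x = (\<Sum>j<?n. b j * kcontr j f x)" for x
    have h: "\<forall>x\<in>kdeg ?n (Suc i). h x \<in> B"
      using f b(1) unfolding h_def
      by (auto intro!: sum_mem mult_mem kcontr_mem[OF submod_self] simp: kdeg_def)
    have "y ^ a * f x - kdiff cs h x \<in> N" if x: "x \<in> kdeg ?n i" for x
    proof -
      have "y ^ a * f x = (\<Sum>j<?n. b j * (cs ! j * f x))"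
        by (simp add: b(2) sum_distrib_right mult.assoc)
      also have "\<dots> = (\<Sum>j<?n. b j * (kdiff cs (kcontr j f) x + kcontr j (kdiff cs f) x))"
        using kcontr_homotopy[of x cs _ f] x by (intro sum.cong refl) (auto simp: kdeg_def)
      also have "\<dots> = kdiff cs h x + (\<Sum>j<?n. b j * kcontr j (kdiff cs f) x)"
        by (simp add: h_def[abs_def] kdiff_sum kdiff_scale sum.distrib algebra_simps)
      finally have "y ^ a * f x - kdiff cs h x = (\<Sum>j<?n. b j * kcontr j (kdiff cs f) x)"
        by simp
      also have "\<dots> \<in> N"
        using x cyc b(1)
        by (intro submod_sum[OF N(1)] N_mult kcontr_mem[OF N(1)]) (auto simp: kdeg_def)
      finally show ?thesis .
    qed
    then show "\<exists>m g. (\<forall>x\<in>kdeg ?n (Suc i). g x \<in> B) \<and> (\<forall>x\<in>kdeg ?n i. \<delta> ^ m * f x - kdiff cs g x \<in> N)"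
      using cancel_pow[OF f h] by blast
  qed
qed

text \<open>The vanishing diagonal is an extra condition in characteristic \<open>2\<close>. Multiplying \<open>c\<close> by such a
  matrix gives the relations of \<open>c\<close> that hold in every commutative ring.\<close>

definition skew :: "nat \<Rightarrow> (nat \<Rightarrow> nat \<Rightarrow> 'a) \<Rightarrow> bool" where
  "skew n s \<longleftrightarrow> (\<forall>i<n. s i i = 0 \<and> (\<forall>j<n. s i j \<in> B \<and> s i j = - s j i))"

text \<open>The index of the \<open>j\<close>-th basis element in degree one of the Koszul complex.\<close>

definition unit_list :: "nat \<Rightarrow> nat \<Rightarrow> bool list" where
  "unit_list n j = map (\<lambda>i. i = j) [0..<n]"

lemma unit_list_Suc:
  "unit_list (Suc n) 0 = True # replicate n False"
  "unit_list (Suc n) (Suc j) = False # unit_list n j"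
  by (simp_all add: unit_list_def upt_conv_Cons map_Suc_upt[symmetric] del: upt_Suc)
     (auto simp: list_eq_iff_nth_eq)

lemma count_replicate_False [simp]: "count_list (replicate n False) True = 0"
  by (induction n) auto

lemma unit_list_kdeg: "j < n \<Longrightarrow> unit_list n j \<in> kdeg n 1"
proof (induction n arbitrary: j)
  case (Suc n)
  then show ?case
    by (cases j) (auto simp: unit_list_Suc kdeg_def)
qed auto

lemma kdiff_degree_one: "kdiff cs f (replicate (length cs) False) = (\<Sum>j<length cs. cs ! j * f (unit_list (length cs) j))"
proof (induction cs arbitrary: f)
  case (Cons c cs)
  then show ?case
    by (simp add: sum.lessThan_Suc_shift unit_list_Suc del: sum.lessThan_Suc)
qed auto

text \<open>The entry \<open>s i j\<close> is, up to sign, the value of \<open>g\<close> at the basis element of degree two that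
  belongs to \<open>i\<close> and \<open>j\<close>.\<close>

lemma kdiff_degree_two:
  assumes "\<forall>x\<in>kdeg (length cs) 2. g x \<in> B"
  shows "\<exists>s. skew (length cs) s \<and>
           (\<forall>i<length cs. kdiff cs g (unit_list (length cs) i) = (\<Sum>j<length cs. s i j * cs ! j))"
  using assms
proof (induction cs arbitrary: g)
  case (Cons c cs)
  let ?n = "length cs"
  have "\<forall>x\<in>kdeg ?n 2. g (False # x) \<in> B"
    using Cons.prems by (auto simp: kdeg_def)
  then obtain s where s: "skew ?n s"
    "\<forall>i<?n. kdiff cs (\<lambda>x. g (False # x)) (unit_list ?n i) = (\<Sum>j<?n. s i j * cs ! j)"
    using Cons.IH[of "\<lambda>x. g (False # x)"] by auto
  have sk: "s i i = 0" "s i j \<in> B" "s i j = - s j i" if "i < ?n" "j < ?n" for i j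
    using s(1) that unfolding skew_def by blast+
  define t where "t j = g (True # unit_list ?n j)" for j
  have t: "t j \<in> B" if "j < ?n" for j
    using Cons.prems unit_list_kdeg[OF that] by (auto simp: kdeg_def t_def)
  define s' where "s' i j = (case i of 0 \<Rightarrow> (case j of 0 \<Rightarrow> 0 | Suc j \<Rightarrow> - t j)
                                 | Suc i \<Rightarrow> (case j of 0 \<Rightarrow> t i | Suc j \<Rightarrow> s i j))" for i j
  have "skew (Suc ?n) s'"
    unfolding skew_def
  proof (intro allI impI conjI)
    fix i j assume "i < Suc ?n" "j < Suc ?n"
    then show "s' i j \<in> B" "s' i j = - s' j i"
      using sk(2)[of "i - 1" "j - 1"] sk(3)[of "i - 1" "j - 1"] t
      by (auto simp: s'_def split: nat.splits)
  next
    fix i assume "i < Suc ?n"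
    then show "s' i i = 0"
      using sk(1)[of "i - 1" "i - 1"] by (auto simp: s'_def split: nat.splits)
  qed
  moreover have "kdiff (c # cs) g (unit_list (Suc ?n) i) = (\<Sum>j<Suc ?n. s' i j * (c # cs) ! j)"
    if "i < Suc ?n" for i
    using that s(2)
    by (cases i) (auto simp: sum.lessThan_Suc_shift unit_list_Suc s'_def kdiff_degree_one t_def
         sum_negf mult.commute simp del: sum.lessThan_Suc)
  ultimately show ?case
    by auto
qed (auto simp: skew_def)

text \<open>Depth sensitivity of Koszul homology. The homology of \<open>c\<close> with coefficients modulo
  \<open>y 0, \<dots>, y (k - 1)\<close> vanishes in degree \<open>k + 1\<close>, by descending induction on \<open>k\<close>; for \<open>k = 0\<close> this
  concerns the relations of \<open>c\<close>.\<close>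

theorem relations_skew_up_to_power:
  assumes c: "\<And>j. j < n \<Longrightarrow> c j \<in> B" and y: "\<And>j. j < n \<Longrightarrow> y j \<in> B"
    and pow: "\<And>j. j < n \<Longrightarrow> \<exists>a. y j ^ a \<in> lincombs B c n"
    and \<delta>: "\<delta> \<in> B" and reg: "almost_regular B \<delta> y n"
    and a: "\<And>j. j < n \<Longrightarrow> a j \<in> B" "(\<Sum>j<n. a j * c j) = 0"
  shows "\<exists>m s. skew n s \<and> (\<forall>i<n. \<delta> ^ m * a i = (\<Sum>j<n. s i j * c j))"
proof -
  define cs where "cs = map c [0..<n]"
  have cs: "set cs \<subseteq> B" "length cs = n" "\<And>j. j < n \<Longrightarrow> cs ! j = c j"
    using c by (auto simp: cs_def)
  have lincombs_cs: "lincombs B (\<lambda>j. cs ! j) n = lincombs B c n"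
    using cs(3) by (intro lincombs_cong)
  have "kacyclic (lincombs B y k) \<delta> cs (Suc k)" if "k \<le> n" for k
    using that
  proof (induction k rule: inc_induct)
    case base
    \<comment> \<open>There is nothing in degrees above \<open>n\<close>.\<close>
    have "kdeg n i = {}" if "i > n" for i
    proof -
      have "count_list x True \<le> length x" for x
        by (rule count_le_length)
      then show ?thesis
        using that by (force simp: kdeg_def not_le[symmetric])
    qed
    then show ?case
      by (auto simp: kacyclic_def cs(2))
  next
    case (step k)
    obtain e where e: "y k ^ e \<in> lincombs B c n"
      using pow step by blast
    have "{y k * b + w |b w. b \<in> B \<and> w \<in> lincombs B y k} = lincombs B y (Suc k)"
      by (auto simp: lincombs_Suc algebra_simps)
    moreover have "lincombs B y k \<subseteq> B"
      using y step by (intro lincombs_subset) auto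
    ultimately show ?case
      using step reg y e
      by (intro kacyclic_step[OF submod_lc, of y k cs "y k" \<delta> e])
         (auto simp: cs lincombs_cs \<delta> almost_regular_def)
  qed
  from this[of 0] have "kacyclic {0} \<delta> cs 1"
    by simp
  define f where "f x = (\<Sum>j<n. if x = unit_list n j then a j else 0)" for x
  have unit_inj: "unit_list n i = unit_list n j \<longleftrightarrow> i = j" if "i < n" "j < n" for i j
    using that by (auto simp: unit_list_def)
  have f_unit: "f (unit_list n j) = a j" if "j < n" for j
  proof -
    have "f (unit_list n j) = (\<Sum>i<n. if i = j then a i else 0)"
      unfolding f_def using unit_inj that by (intro sum.cong) auto
    then show ?thesis
      using that by simp
  qed
  have f_B: "f x \<in> B" for x
    unfolding f_def using a(1) by (intro sum_mem) auto
  have "kdiff cs f x = 0" if "length x = n" "count_list x True = 0" for x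
  proof -
    have "x = replicate n False"
      using that by (induction x arbitrary: n) (auto split: if_splits)
    then show ?thesis
      using kdiff_degree_one[of cs f] a(2) by (simp add: cs f_unit mult.commute)
  qed
  then obtain m g where g: "\<forall>x\<in>kdeg n 2. g x \<in> B" "\<forall>x\<in>kdeg n 1. \<delta> ^ m * f x - kdiff cs g x = 0"
    using \<open>kacyclic {0} \<delta> cs 1\<close>[unfolded kacyclic_def, rule_format, of f] f_B
    by (auto simp: cs numeral_2_eq_2)
  obtain s where "skew n s" "\<forall>i<n. kdiff cs g (unit_list n i) = (\<Sum>j<n. s i j * c j)"
    using kdiff_degree_two[of cs g] g(1) cs by auto
  then show ?thesis
    using g(2) unit_list_kdeg f_unit by (intro exI[of _ m] exI[of _ s]) fastforce
qed

end

section \<open>Graded rings and filtered deformations of regular sequences\<close>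

text \<open>A grading by the natural numbers, encoded as the ring homomorphism that multiplies the
  component of degree \<open>n\<close> by \<open>T ^ n\<close>.\<close>

locale grading =
  fixes gr :: "'a::idom \<Rightarrow> 'a poly"
  assumes gr_add: "gr (x + y) = gr x + gr y"
    and gr_mult: "gr (x * y) = gr x * gr y"
    and gr_1: "gr 1 = 1"
    and gr_total: "poly (gr x) 1 = x"
    and gr_component: "gr (coeff (gr x) n) = monom (coeff (gr x) n) n"
begin

lemma gr_0: "gr 0 = 0"
  using gr_add[of 0 0] by (metis add.right_neutral add_left_cancel)

lemma gr_uminus: "gr (- x) = - gr x"
  using gr_add[of x "- x"] by (simp add: gr_0 eq_neg_iff_add_eq_0 add.commute)

lemma gr_diff: "gr (x - y) = gr x - gr y"
  using gr_add[of x "- y"] by (simp add: gr_uminus)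

lemma gr_sum: "gr (sum f I) = (\<Sum>i\<in>I. gr (f i))"
  by (induction I rule: infinite_finite_induct) (auto simp: gr_0 gr_add)

lemma gr_power: "gr (x ^ n) = gr x ^ n"
  by (induction n) (auto simp: gr_1 gr_mult)

lemma gr_eq_0_iff: "gr x = 0 \<longleftrightarrow> x = 0"
  using gr_total[of x] by (auto simp: gr_0)

end

lemma coeff_mult_monom_1:
  fixes p :: "'a::comm_ring_1 poly"
  shows "coeff (p * monom 1 e) t = (if e \<le> t then coeff p (t - e) else 0)"
  by (simp add: coeff_monom_mult mult.commute[of p] not_le)

lemma coeff_mult_top:
  fixes p q :: "'a::comm_ring_1 poly"
  assumes "degree p \<le> m" "degree q \<le> n"
  shows "coeff (p * q) (m + n) = coeff p m * coeff q n"
proof -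
  have "coeff (p * q) (m + n) = (\<Sum>i\<le>m + n. coeff p i * coeff q (m + n - i))"
    by (simp add: coeff_mult)
  also have "\<dots> = (\<Sum>i\<in>{m}. coeff p i * coeff q (m + n - i))"
  proof (rule sum.mono_neutral_right)
    show "\<forall>i\<in>{..m + n} - {m}. coeff p i * coeff q (m + n - i) = 0"
    proof
      fix i assume "i \<in> {..m + n} - {m}"
      then have "i > m \<or> m + n - i > n" by auto
      then show "coeff p i * coeff q (m + n - i) = 0"
        using assms coeff_eq_0[of p i] coeff_eq_0[of q "m + n - i"] by auto
    qed
  qed auto
  finally show ?thesis by simp
qed

locale graded_subring = grading gr + sub_comm_ring B
  for gr :: "'a::idom \<Rightarrow> 'a poly" and B :: "'a set" +
  assumes component_mem: "x \<in> B \<Longrightarrow> coeff (gr x) n \<in> B"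
begin

text \<open>Vanishing of the first Koszul homology of the first \<open>k\<close> members of \<open>c\<close>, which have degrees
  \<open>e\<close>, in its graded form. The equations with \<open>monom\<close> say that \<open>a j\<close> is homogeneous of
  degree \<open>t - e j\<close>, and zero if that is negative.\<close>

definition homogeneous_relations_skew :: "(nat \<Rightarrow> 'a) \<Rightarrow> (nat \<Rightarrow> nat) \<Rightarrow> nat \<Rightarrow> bool" where
  "homogeneous_relations_skew c e k \<longleftrightarrow>
     (\<forall>t a. (\<forall>j<k. a j \<in> B \<and> gr (a j) * monom 1 (e j) = monom (a j) t) \<longrightarrow>
            (\<Sum>j<k. a j * c j) = 0 \<longrightarrow>
            (\<exists>s. skew k s \<and> (\<forall>i<k. a i = (\<Sum>j<k. s i j * c j)) \<and>
                 (\<forall>i<k. \<forall>j<k. gr (s i j) * monom 1 (e i + e j) = monom (s i j) t)))"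

lemma shifted_component:
  assumes "x \<in> B" and u_def: "u = coeff (gr x * monom 1 e) t"
  shows "u \<in> B" "gr u * monom 1 e = monom u t"
proof -
  have "u \<in> B \<and> gr u * monom 1 e = monom u t"
  proof (cases "e \<le> t")
    case True
    then have "u = coeff (gr x) (t - e)"
      by (simp add: u_def coeff_mult_monom_1)
    then show ?thesis
      using component_mem[OF assms(1)] gr_component[of x "t - e"] True by (simp add: mult_monom)
  qed (simp add: u_def coeff_mult_monom_1 gr_0)
  then show "u \<in> B" "gr u * monom 1 e = monom u t"
    by auto
qed

text \<open>On homogeneous elements \<open>\<delta>\<close> can be cancelled by comparing components: it is \<open>1\<close> plus
  terms of positive degree.\<close>

lemma homogeneous_relations_skew_full:
  assumes c: "\<And>j. j < n \<Longrightarrow> c j \<in> B" "\<And>j. j < n \<Longrightarrow> gr (c j) = monom (c j) (e j)"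
    and y: "\<And>j. j < n \<Longrightarrow> y j \<in> B" "\<And>j. j < n \<Longrightarrow> \<exists>a. y j ^ a \<in> lincombs B c n"
    and \<delta>: "\<delta> \<in> B" "coeff (gr \<delta>) 0 = 1" and reg: "almost_regular B \<delta> y n"
  shows "homogeneous_relations_skew c e n"
  unfolding homogeneous_relations_skew_def
proof (intro allI impI)
  fix t a
  assume a: "\<forall>j<n. a j \<in> B \<and> gr (a j) * monom 1 (e j) = monom (a j) t"
    and rel: "(\<Sum>j<n. a j * c j) = 0"
  obtain m s where s: "skew n s" and eq: "\<And>i. i < n \<Longrightarrow> \<delta> ^ m * a i = (\<Sum>j<n. s i j * c j)"
    using relations_skew_up_to_power[of n c y \<delta> a] c(1) y \<delta>(1) reg a rel by blast
  have sk: "s i i = 0" "s i j \<in> B" "s i j = - s j i" if "i < n" "j < n" for i j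
    using s that unfolding skew_def by blast+
  define s' where "s' i j = coeff (gr (s i j) * monom 1 (e i + e j)) t" for i j
  have s': "s' i j \<in> B" "gr (s' i j) * monom 1 (e i + e j) = monom (s' i j) t" if "i < n" "j < n" for i j
    using shifted_component[OF sk(2)[OF that] s'_def] by auto
  have "skew n s'"
    unfolding skew_def
  proof (intro allI impI conjI)
    fix i j assume "i < n" "j < n"
    then show "s' i j \<in> B"
      by (rule s')
    show "s' i j = - s' j i"
      using sk(3)[of i j] \<open>i < n\<close> \<open>j < n\<close> by (simp add: s'_def gr_uminus add.commute)
  next
    fix i assume "i < n"
    then show "s' i i = 0"
      using sk(1)[of i i] by (auto simp: s'_def gr_0)
  qed
  moreover have "a i = (\<Sum>j<n. s' i j * c j)" if i: "i < n" for i
  proof -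
    have "gr (\<delta> ^ m * a i) * monom 1 (e i) = monom (a i) t * gr \<delta> ^ m"
      using a i by (simp add: gr_mult gr_power mult_ac)
    then have "coeff (gr (\<delta> ^ m * a i) * monom 1 (e i)) t = a i"
      by (simp add: coeff_monom_mult coeff_0_power \<delta>(2))
    moreover have "gr (\<delta> ^ m * a i) * monom 1 (e i) = (\<Sum>j<n. smult (c j) (gr (s i j) * monom 1 (e i + e j)))"
    proof -
      have "gr (\<delta> ^ m * a i) * monom 1 (e i) = (\<Sum>j<n. gr (s i j) * (monom (c j) (e j) * monom 1 (e i)))"
        using c(2) by (simp add: eq[OF i] gr_sum gr_mult sum_distrib_right mult.assoc)
      also have "\<dots> = (\<Sum>j<n. smult (c j) (gr (s i j) * monom 1 (e i + e j)))"
          by (intro sum.cong refl) (simp add: mult_monom smult_monom add.commute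
               flip: mult_smult_right)
      finally show ?thesis .
    qed
    ultimately show ?thesis
      by (simp add: coeff_sum s'_def mult.commute)
  qed
  ultimately show "\<exists>s. skew n s \<and> (\<forall>i<n. a i = (\<Sum>j<n. s i j * c j)) \<and>
      (\<forall>i<n. \<forall>j<n. gr (s i j) * monom 1 (e i + e j) = monom (s i j) t)"
    using s'(2) by blast
qed

text \<open>Graded Nakayama: a relation of the first \<open>k\<close> members is a relation of the first \<open>k + 1\<close>,
  and the last row of its matrix is a relation of the first \<open>k\<close> of smaller degree.\<close>

lemma homogeneous_relations_skew_prefix:
  assumes c: "c k \<in> B" "gr (c k) = monom (c k) (e k)" and e: "e k > 0"
    and full: "homogeneous_relations_skew c e (Suc k)"
  shows "homogeneous_relations_skew c e k"
proof -
  have "\<exists>s. skew k s \<and> (\<forall>i<k. a i = (\<Sum>j<k. s i j * c j)) \<and>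
             (\<forall>i<k. \<forall>j<k. gr (s i j) * monom 1 (e i + e j) = monom (s i j) t)"
    if a: "\<forall>j<k. a j \<in> B \<and> gr (a j) * monom 1 (e j) = monom (a j) t"
      and rel: "(\<Sum>j<k. a j * c j) = 0" for t a
    using that
  proof (induction t arbitrary: a rule: less_induct)
    case (less t)
    define a' where "a' = a(k := 0)"
    have "\<forall>j<Suc k. a' j \<in> B \<and> gr (a' j) * monom 1 (e j) = monom (a' j) t"
      using less.prems(1) by (auto simp: a'_def less_Suc_eq gr_0)
    moreover have "(\<Sum>j<Suc k. a' j * c j) = 0"
      using less.prems(2) by (simp add: a'_def)
    ultimately obtain s where s: "skew (Suc k) s"
      and eq: "\<And>i. i < Suc k \<Longrightarrow> a' i = (\<Sum>j<Suc k. s i j * c j)"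
      and deg: "\<And>i j. i < Suc k \<Longrightarrow> j < Suc k \<Longrightarrow> gr (s i j) * monom 1 (e i + e j) = monom (s i j) t"
      using full[unfolded homogeneous_relations_skew_def, rule_format, of a' t] by auto
    have sk: "s i i = 0" "s i j \<in> B" "s i j = - s j i" if "i < Suc k" "j < Suc k" for i j
      using s that unfolding skew_def by blast+
    have last_rel: "(\<Sum>j<k. s k j * c j) = 0"
      using eq[of k] sk(1)[of k k] by (simp add: a'_def)
    have "\<exists>b. skew k b \<and> (\<forall>i<k. s k i = (\<Sum>j<k. b i j * c j)) \<and>
             (\<forall>i<k. \<forall>j<k. gr (b i j * c k) * monom 1 (e i + e j) = monom (b i j * c k) t)"
    proof (cases "e k \<le> t")
      case True
      have "gr (s k j) * monom 1 (e j) = monom (s k j) (t - e k)" if "j < k" for j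
      proof -
        have "monom 1 (e k) * (gr (s k j) * monom 1 (e j)) = monom 1 (e k) * monom (s k j) (t - e k)"
        proof -
          have "monom 1 (e k) * (gr (s k j) * monom 1 (e j)) = gr (s k j) * monom 1 (e k + e j)"
            by (simp add: mult.left_commute mult_monom)
          then show ?thesis
            using deg[of k j] that True by (simp add: mult_monom)
        qed
        then show ?thesis
          by simp
      qed
      then obtain b where b: "skew k b" "\<forall>i<k. s k i = (\<Sum>j<k. b i j * c j)"
        "\<forall>i<k. \<forall>j<k. gr (b i j) * monom 1 (e i + e j) = monom (b i j) (t - e k)"
        using less.IH[of "t - e k" "s k"] sk(2) last_rel e True by auto
      have "gr (b i j * c k) * monom 1 (e i + e j) = monom (b i j * c k) t" if "i < k" "j < k" for i j
      proof -
        have "gr (b i j * c k) * monom 1 (e i + e j) = (gr (b i j) * monom 1 (e i + e j)) * gr (c k)"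
          by (simp only: gr_mult mult_ac)
        also have "\<dots> = monom (b i j) (t - e k) * monom (c k) (e k)"
          using b(3) that c(2) by simp
        finally have "gr (b i j * c k) * monom 1 (e i + e j) = monom (b i j) (t - e k) * monom (c k) (e k)" .
        then show ?thesis
          using True by (simp add: mult_monom)
      qed
      with b show ?thesis by blast
    next
      case False
      have "s k j = 0" if "j < k" for j
      proof -
        have "coeff (gr (s k j) * monom 1 (e k + e j)) t = s k j"
          using deg[of k j] that by simp
        then show ?thesis
          using False by (simp add: coeff_mult_monom_1)
      qed
      then show ?thesis
        by (intro exI[of _ "\<lambda>_ _. 0"]) (auto simp: skew_def gr_0)
    qed
    then obtain b where b: "skew k b" "\<And>i. i < k \<Longrightarrow> s k i = (\<Sum>j<k. b i j * c j)"
       "\<And>i j. i < k \<Longrightarrow> j < k \<Longrightarrow> gr (b i j * c k) * monom 1 (e i + e j) = monom (b i j * c k) t"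
      by blast
    have bk: "b i i = 0" "b i j \<in> B" "b i j = - b j i" if "i < k" "j < k" for i j
      using b(1) that unfolding skew_def by blast+
    define r where "r i j = s i j - b i j * c k" for i j
    have "skew k r"
      unfolding skew_def
    proof (intro allI impI conjI)
      fix i j assume "i < k" "j < k"
      then show "r i j \<in> B"
        using sk(2)[of i j] bk(2)[of i j] c(1) by (simp add: r_def)
      show "r i j = - r j i"
        using sk(3)[of i j] bk(3)[of i j] \<open>i < k\<close> \<open>j < k\<close> by (simp add: r_def)
    next
      fix i assume "i < k"
      then show "r i i = 0"
        using sk(1)[of i i] bk(1)[of i i] by (simp add: r_def)
    qed
    moreover have "a i = (\<Sum>j<k. r i j * c j)" if i: "i < k" for i
    proof -
      have "a i = (\<Sum>j<k. s i j * c j) + s i k * c k"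
        using eq[of i] i by (simp add: a'_def)
      also have "s i k = - (\<Sum>j<k. b i j * c j)"
        using sk(3)[of i k] b(2)[of i] i by simp
      finally show ?thesis
        by (simp add: r_def sum_subtractf sum_distrib_right left_diff_distrib mult.assoc mult.left_commute
            mult.commute[of "c k"])
    qed
    moreover have "gr (r i j) * monom 1 (e i + e j) = monom (r i j) t" if "i < k" "j < k" for i j
      using that deg[of i j] b(3)[of i j] by (simp add: r_def gr_diff left_diff_distrib diff_monom[symmetric])
    ultimately show ?case by blast
  qed
  then show ?thesis
    unfolding homogeneous_relations_skew_def by blast
qed

text \<open>Relations lift from top forms to elements with these top forms: subtracting the lift of
  the relation of the top forms lowers the degree.\<close>

lemma relations_skew_of_top_forms:
  assumes f: "\<And>i. i < k \<Longrightarrow> f i \<in> B" "\<And>i. i < k \<Longrightarrow> degree (gr (f i)) \<le> e i"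
    and top: "\<And>i. i < k \<Longrightarrow> coeff (gr (f i)) (e i) = c i"
    and hrel: "homogeneous_relations_skew c e k"
    and a: "\<And>j. j < k \<Longrightarrow> a j \<in> B" "(\<Sum>j<k. a j * f j) = 0"
  shows "\<exists>s. skew k s \<and> (\<forall>i<k. a i = (\<Sum>j<k. s i j * f j))"
proof -
  have "\<exists>s. skew k s \<and> (\<forall>i<k. a i = (\<Sum>j<k. s i j * f j))"
    if "\<forall>j<k. a j \<in> B" "(\<Sum>j<k. a j * f j) = 0"
      "\<forall>j<k. \<forall>n. t \<le> n + e j \<longrightarrow> coeff (gr (a j)) n = 0" for t
    using that
  proof (induction t arbitrary: a)
    case 0
    then have "\<forall>j<k. a j = 0"
      using gr_eq_0_iff by (auto simp: poly_eq_iff)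
    then show ?case
      by (intro exI[of _ "\<lambda>_ _. 0"]) (auto simp: skew_def)
  next
    case (Suc t)
    define A where "A j = coeff (gr (a j) * monom 1 (e j)) t" for j
    have A: "A j \<in> B" "gr (A j) * monom 1 (e j) = monom (A j) t" if "j < k" for j
      using shifted_component[of "a j" "A j" "e j" t] Suc.prems(1) that by (auto simp: A_def)
    have prod_top: "coeff (gr (a j * f j)) t = A j * c j" if j: "j < k" for j
    proof (cases "e j \<le> t")
      case True
      then have "degree (gr (a j)) \<le> t - e j"
        using Suc.prems(3) j by (intro degree_le) auto
      from coeff_mult_top[OF this f(2)[OF j]] True show ?thesis
        by (simp add: gr_mult A_def coeff_mult_monom_1 top j)
    next
      case False
      then have "gr (a j) = 0"
        using Suc.prems(3) j by (auto simp: poly_eq_iff)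
      then show ?thesis
        by (simp add: gr_mult A_def)
    qed
    have "(\<Sum>j<k. A j * c j) = coeff (gr (\<Sum>j<k. a j * f j)) t"
      by (simp add: gr_sum coeff_sum prod_top)
    then have "(\<Sum>j<k. A j * c j) = 0"
      by (simp add: Suc.prems(2) gr_0)
    then obtain s where s: "skew k s" "\<And>i. i < k \<Longrightarrow> A i = (\<Sum>j<k. s i j * c j)"
      and deg: "\<And>i j. i < k \<Longrightarrow> j < k \<Longrightarrow> gr (s i j) * monom 1 (e i + e j) = monom (s i j) t"
      using hrel[unfolded homogeneous_relations_skew_def, rule_format, of A t] A by auto
    have sk: "s i i = 0" "s i j \<in> B" "s i j = - s j i" if "i < k" "j < k" for i j
      using s(1) that unfolding skew_def by blast+
    define a' where "a' i = a i - (\<Sum>j<k. s i j * f j)" for i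
    have "\<forall>j<k. a' j \<in> B"
      using Suc.prems(1) sk(2) f(1) by (auto simp: a'_def intro!: diff_mem sum_mem)
    moreover have "(\<Sum>j<k. a' j * f j) = 0"
    proof -
      let ?S = "\<Sum>i<k. \<Sum>j<k. s i j * f j * f i"
      have "?S = 0"
      proof -
        have "(\<Sum>i<m. \<Sum>j<m. s i j * f j * f i) = 0" if "m \<le> k" for m
          using that
        proof (induction m)
          case (Suc m)
          have "(\<Sum>i<m. s i m * f m * f i) = - (\<Sum>j<m. s m j * f j * f m)"
            unfolding sum_negf[symmetric] using Suc.prems
            by (intro sum.cong refl) (auto simp: sk(3)[of _ m] mult_ac)
          then show ?case
            using Suc sk(1)[of m m] by (simp add: sum.distrib)
        qed simp
        then show ?thesis by blast
      qed
      then show ?thesis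
        using Suc.prems(2) by (simp add: a'_def left_diff_distrib sum_subtractf sum_distrib_right)
    qed
    moreover have "coeff (gr (a' i)) n = 0" if i: "i < k" and n: "t \<le> n + e i" for i n
    proof -
      have s_deg: "coeff (gr (s i j)) l = (if l + (e i + e j) = t then s i j else 0)" if j: "j < k" for j l
        using arg_cong[OF deg[OF i j], of "\<lambda>p. coeff p (l + (e i + e j))"]
        by (auto simp: coeff_mult_monom_1)
      have *: "coeff (gr (s i j * f j)) n = (if n + e i = t then s i j * c j else 0)" if j: "j < k" for j
      proof (cases "e i + e j \<le> t")
        case True
        have "degree (gr (s i j)) \<le> t - (e i + e j)"
          using s_deg[OF j] by (intro degree_le) auto
        moreover have "coeff (gr (s i j)) (t - (e i + e j)) = s i j"
          using s_deg[OF j] True by simp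
        moreover have "degree (gr (s i j * f j)) \<le> t - e i"
          unfolding gr_mult using degree_mult_le[of "gr (s i j)" "gr (f j)"] calculation f(2)[OF j] True
          by linarith
        ultimately show ?thesis
          using coeff_mult_top[of "gr (s i j)" "t - (e i + e j)" "gr (f j)" "e j"] f(2)[OF j] top[OF j] True n
          by (cases "n + e i = t") (auto simp: gr_mult coeff_eq_0)
      next
        case False
        then have "s i j = 0"
          using arg_cong[OF deg[OF i j], of "\<lambda>p. coeff p t"] by (simp add: coeff_mult_monom_1)
        then show ?thesis by (simp add: gr_0)
      qed
      have "coeff (gr (a' i)) n = coeff (gr (a i)) n - (\<Sum>j<k. if n + e i = t then s i j * c j else 0)"
        by (simp add: a'_def gr_diff gr_sum coeff_sum *)
      also have "\<dots> = 0"
      proof (cases "n + e i = t")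
        case True
        then show ?thesis
          using s(2)[OF i] by (auto simp: A_def coeff_mult_monom_1)
      next
        case False
        then show ?thesis
          using Suc.prems(3) i n by simp
      qed
      finally show ?thesis .
    qed
    ultimately obtain s2 where s2: "skew k s2" "\<And>i. i < k \<Longrightarrow> a' i = (\<Sum>j<k. s2 i j * f j)"
      using Suc.IH[of a'] by blast
    have sk2: "s2 i i = 0" "s2 i j \<in> B" "s2 i j = - s2 j i" if "i < k" "j < k" for i j
      using s2(1) that unfolding skew_def by blast+
    have "skew k (\<lambda>i j. s i j + s2 i j)"
      unfolding skew_def
    proof (intro allI impI conjI)
      fix i j assume "i < k" "j < k"
      then show "s i j + s2 i j \<in> B"
        by (intro add_mem sk sk2)
      show "s i j + s2 i j = - (s j i + s2 j i)"
        using sk(3)[of i j] sk2(3)[of i j] \<open>i < k\<close> \<open>j < k\<close> by simp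
    next
      fix i assume "i < k"
      then show "s i i + s2 i i = 0"
        using sk(1)[of i i] sk2(1)[of i i] by simp
    qed
    moreover have "a i = (\<Sum>j<k. (s i j + s2 i j) * f j)" if "i < k" for i
      using s2(2)[OF that] by (simp add: a'_def distrib_right sum.distrib algebra_simps)
    ultimately show ?case
      by (intro exI[of _ "\<lambda>i j. s i j + s2 i j"]) auto
  qed
  moreover obtain t where "\<forall>j<k. \<forall>n. t \<le> n + e j \<longrightarrow> coeff (gr (a j)) n = 0"
  proof
    show "\<forall>j<k. \<forall>n. Suc (\<Sum>j<k. degree (gr (a j)) + e j) \<le> n + e j \<longrightarrow> coeff (gr (a j)) n = 0"
    proof (intro allI impI)
      fix j n assume "j < k" "Suc (\<Sum>j<k. degree (gr (a j)) + e j) \<le> n + e j"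
      moreover have "degree (gr (a j)) + e j \<le> (\<Sum>j<k. degree (gr (a j)) + e j)"
        using \<open>j < k\<close> by (intro member_le_sum) auto
      ultimately show "coeff (gr (a j)) n = 0"
        by (intro coeff_eq_0) linarith
    qed
  qed
  ultimately show ?thesis
    using a by blast
qed

text \<open>The sequence \<open>y\<close>, regular near the origin, controls the relations of the top forms \<open>c\<close> and of all
  initial segments of \<open>c\<close>, hence those of \<open>f\<close>. A zero divisor modulo an initial segment of \<open>f\<close> is
  the last coefficient of such a relation, and the last row of a skew matrix has no diagonal
  entry. The theorem is applied to homogeneous \<open>f\<close>, with \<open>f = c\<close>, and to inhomogeneous \<open>f\<close>, with
  \<open>y\<close> the sequence whose powers are the top forms.\<close>

theorem regular_of_top_forms:
  assumes c: "\<And>j. j < n \<Longrightarrow> c j \<in> B" "\<And>j. j < n \<Longrightarrow> gr (c j) = monom (c j) (e j)"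
    and e: "\<And>j. j < n \<Longrightarrow> e j > 0"
    and y: "\<And>j. j < n \<Longrightarrow> y j \<in> B" "\<And>j. j < n \<Longrightarrow> \<exists>a. y j ^ a \<in> lincombs B c n"
    and \<delta>: "\<delta> \<in> B" "coeff (gr \<delta>) 0 = 1" and reg: "almost_regular B \<delta> y n"
    and f: "\<And>i. i < n \<Longrightarrow> f i \<in> B" "\<And>i. i < n \<Longrightarrow> degree (gr (f i)) \<le> e i"
    and top: "\<And>i. i < n \<Longrightarrow> coeff (gr (f i)) (e i) = c i"
  shows "almost_regular B 1 f n"
proof -
  have hrel: "homogeneous_relations_skew c e k" if "k \<le> n" for k
    using that
  proof (induction k rule: inc_induct)
    case base
    show ?case
      by (rule homogeneous_relations_skew_full[OF c y \<delta> reg])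
  next
    case (step k)
    show ?case
      by (rule homogeneous_relations_skew_prefix[OF c(1) c(2) e step.IH]) (rule step.hyps(2))+
  qed
  show ?thesis
    unfolding almost_regular_def
  proof (intro allI impI ballI)
    fix k a assume k: "k < n" and a: "a \<in> B" and "f k * a \<in> lincombs B f k"
    then obtain b where b: "\<forall>i<k. b i \<in> B" "f k * a = (\<Sum>i<k. b i * f i)"
      by (auto simp: lincombs_def)
    define g where "g = (\<lambda>i. - b i)(k := a)"
    have "\<And>j. j < Suc k \<Longrightarrow> g j \<in> B"
      using a b(1) by (auto simp: g_def less_Suc_eq)
    moreover have "(\<Sum>j<Suc k. g j * f j) = 0"
      using b(2) by (simp add: g_def sum_negf mult.commute)
    ultimately obtain s where s: "skew (Suc k) s" "\<And>i. i < Suc k \<Longrightarrow> g i = (\<Sum>j<Suc k. s i j * f j)"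
      using relations_skew_of_top_forms[of "Suc k" f e c g] f top hrel[of "Suc k"] k by auto
    have "s k k = 0" "\<And>j. j < k \<Longrightarrow> s k j \<in> B"
      using s(1) unfolding skew_def by (blast intro: less_SucI lessI)+
    then have "a = (\<Sum>j<k. s k j * f j)"
      using s(2)[of k] by (simp add: g_def)
    then show "1 * a \<in> lincombs B f k"
      using lincombsI[of k "s k" B f] \<open>\<And>j. j < k \<Longrightarrow> s k j \<in> B\<close> by simp
  qed
qed

end

lemma (in graded_subring) lincombs_component:
  assumes c: "\<And>j. j < n \<Longrightarrow> gr (c j) = monom (c j) (e j)" and u: "u \<in> lincombs B c n"
  shows "coeff (gr u) m \<in> lincombs B c n"
proof -
  obtain a where a: "\<forall>i<n. a i \<in> B" "u = (\<Sum>i<n. a i * c i)"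
    using u by (auto simp: lincombs_def)
  have "gr u = (\<Sum>i<n. smult (c i) (gr (a i) * monom 1 (e i)))"
    unfolding a(2) gr_sum gr_mult
    by (intro sum.cong refl) (simp add: c smult_monom flip: mult_smult_right)
  then have "coeff (gr u) m = (\<Sum>i<n. coeff (gr (a i) * monom 1 (e i)) m * c i)"
    by (simp add: coeff_sum mult.commute)
  also have "\<dots> \<in> lincombs B c n"
    using a(1) by (intro lincombsI) (auto simp: coeff_mult_monom_1 component_mem)
  finally show ?thesis .
qed

text \<open>If \<open>(x - \<gamma>) a\<close> lies in a homogeneous ideal, then each component of \<open>\<gamma> a\<close> is, modulo that ideal,
  the multiple by \<open>x\<close> of a component of \<open>a\<close> of lower degree. By induction on the degree all
  components of \<open>a\<close> lie in the ideal.\<close>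

lemma (in graded_subring) almost_regular_shifted:
  assumes c: "\<And>j. j < k \<Longrightarrow> gr (c j) = monom (c j) (e j)" and reg: "almost_regular B 1 c k"
    and x: "gr x = monom x m" "m > 0" "x \<in> B"
    and \<gamma>: "gr \<gamma> = [:\<gamma>:]" "\<gamma> \<in> B" "\<gamma>' \<in> B" "\<gamma>' * \<gamma> = 1"
  shows "almost_regular B 1 (c(k := x - \<gamma>)) (Suc k)"
proof -
  have lincombs_eq: "lincombs B (c(k := x - \<gamma>)) j = lincombs B c j" if "j \<le> k" for j
    using that by (intro lincombs_cong) auto
  have "a \<in> lincombs B c k" if a: "a \<in> B" and rel: "(x - \<gamma>) * a \<in> lincombs B c k" for a
  proof -
    let ?J = "lincombs B c k"
    have comp: "coeff (gr a) n \<in> ?J" for n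
    proof (induction n rule: less_induct)
      case (less n)
      have "gr ((x - \<gamma>) * a) = monom x m * gr a - smult \<gamma> (gr a)"
        by (simp add: gr_mult gr_diff x \<gamma> left_diff_distrib)
      then have eq: "coeff (gr ((x - \<gamma>) * a)) n = (if n < m then 0 else x * coeff (gr a) (n - m)) - \<gamma> * coeff (gr a) n"
        by (simp add: coeff_monom_mult)
      have 1: "coeff (gr ((x - \<gamma>) * a)) n \<in> ?J"
        by (rule lincombs_component[OF c rel])
      have 2: "(if n < m then 0 else x * coeff (gr a) (n - m)) \<in> ?J"
        using less.IH[of "n - m"] x submodD(1)[OF submod_lc[of c k]] submodD(3)[OF submod_lc[of c k] x(3)]
        by auto
      have "(if n < m then 0 else x * coeff (gr a) (n - m)) - coeff (gr ((x - \<gamma>) * a)) n \<in> ?J"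
        by (rule submod_diff[OF submod_lc 2 1])
      then have "\<gamma> * coeff (gr a) n \<in> ?J"
        unfolding eq by simp
      then have "\<gamma>' * (\<gamma> * coeff (gr a) n) \<in> ?J"
        by (rule submodD(3)[OF submod_lc \<gamma>(3)])
      then show ?case
        by (simp add: \<gamma>(4) mult.assoc[symmetric])
    qed
    have "a = (\<Sum>n\<le>degree (gr a). coeff (gr a) n)"
      using gr_total[of a] by (simp add: poly_altdef)
    also have "\<dots> \<in> ?J"
      using comp by (intro submod_sum[OF submod_lc]) auto
    finally show ?thesis .
  qed
  then show ?thesis
    using reg by (auto simp: almost_regular_def less_Suc_eq lincombs_eq)
qed

section \<open>Noetherian modules and ring extensions\<close>

definition noeth :: "'a::comm_ring_1 set \<Rightarrow> 'a set \<Rightarrow> bool" where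
  "noeth A M \<longleftrightarrow> (\<forall>N. submod A N \<longrightarrow> N \<subseteq> M \<longrightarrow> (\<exists>X. finite X \<and> X \<subseteq> N \<and> N \<subseteq> aspan A X))"

definition adjoin :: "'a::comm_ring_1 set \<Rightarrow> 'a \<Rightarrow> 'a set" where
  "adjoin A y = {poly p y | p. \<forall>i. coeff p i \<in> A}"

primrec adjoins :: "'a::comm_ring_1 set \<Rightarrow> (nat \<Rightarrow> 'a) \<Rightarrow> nat \<Rightarrow> 'a set" where
  "adjoins A y 0 = A"
| "adjoins A y (Suc m) = adjoin (adjoins A y m) (y m)"

lemma aspan_mono: "A \<subseteq> A' \<Longrightarrow> X \<subseteq> X' \<Longrightarrow> aspan A X \<subseteq> aspan A' X'"
proof
  fix u assume "A \<subseteq> A'" "X \<subseteq> X'" "u \<in> aspan A X"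
  from this(3,1,2) show "u \<in> aspan A' X'"
    by induction (auto intro: aspan.intros)
qed

lemma noethD: "noeth A M \<Longrightarrow> submod A N \<Longrightarrow> N \<subseteq> M \<Longrightarrow> \<exists>X. finite X \<and> X \<subseteq> N \<and> N \<subseteq> aspan A X"
  by (auto simp: noeth_def)

lemma noeth_subset: "noeth A M \<Longrightarrow> M' \<subseteq> M \<Longrightarrow> noeth A M'"
  by (auto simp: noeth_def dest: subset_trans)

context sub_comm_ring
begin

lemma sub_comm_ring_adj: "sub_comm_ring (adjoin B y)"
proof
  show "1 \<in> adjoin B y"
    by (auto simp: adjoin_def intro!: exI[of _ 1])
next
  fix u w assume "u \<in> adjoin B y" "w \<in> adjoin B y"
  then obtain p q where "\<forall>i. coeff p i \<in> B" "u = poly p y" "\<forall>i. coeff q i \<in> B" "w = poly q y"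
    by (auto simp: adjoin_def)
  then show "u - w \<in> adjoin B y"
    by (auto simp: adjoin_def intro!: exI[of _ "p - q"])
  have "\<forall>i. coeff (p * q) i \<in> B"
    using \<open>\<forall>i. coeff p i \<in> B\<close> \<open>\<forall>i. coeff q i \<in> B\<close> by (auto simp: coeff_mult intro!: sum_mem)
  then show "u * w \<in> adjoin B y"
    using \<open>u = poly p y\<close> \<open>w = poly q y\<close> by (auto simp: adjoin_def intro!: exI[of _ "p * q"])
qed

lemma subset_adj: "B \<subseteq> adjoin B y"
  by (force simp: adjoin_def coeff_pCons split: nat.splits intro: exI[of _ "[:_:]"])

lemma mem_adj: "y \<in> adjoin B y"
  unfolding adjoin_def
  by (auto simp: coeff_pCons split: nat.splits intro!: exI[of _ "[:0, 1:]"])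

lemma adj_least:
  assumes "A \<subseteq> B" "y \<in> B"
  shows "adjoin A y \<subseteq> B"
  using assms by (auto simp: adjoin_def poly_altdef intro!: sum_mem mult_mem power_mem)

lemma sub_comm_ring_adjs: "sub_comm_ring (adjoins B y m)"
  by (induction m) (auto simp: sub_comm_ring_axioms intro: sub_comm_ring.sub_comm_ring_adj)

lemma adjs_least:
  assumes "A \<subseteq> B" "\<And>i. i < m \<Longrightarrow> y i \<in> B"
  shows "adjoins A y m \<subseteq> B"
  using assms(2) by (induction m) (auto simp: assms(1) adj_least)

lemma adjs_mono: "i \<le> m \<Longrightarrow> adjoins B y i \<subseteq> adjoins B y m"
proof (induction rule: inc_induct)
  case (step n)
  have "adjoins B y n \<subseteq> adjoins B y (Suc n)"
    using sub_comm_ring.subset_adj[OF sub_comm_ring_adjs] by simp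
  then show ?case
    using step by blast
qed simp

lemma mem_adjs:
  assumes "i < m"
  shows "y i \<in> adjoins B y m"
  using sub_comm_ring.mem_adj[OF sub_comm_ring_adjs, of "y i" y i] adjs_mono[of "Suc i" m y] assms
  by auto

text \<open>Hilbert's basis theorem, by leading coefficients. There is a finite set of elements of \<open>N\<close> that
  accounts for the coefficients at \<open>y ^ n\<close> for all \<open>n\<close>, since these form an increasing chain of
  ideals of \<open>B\<close>. As \<open>y\<close> need not be transcendental, one works with all polynomials that have
  values in \<open>N\<close>.\<close>

theorem noeth_adj:
  assumes "noeth B B"
  shows "noeth (adjoin B y) (adjoin B y)"
  unfolding noeth_def
proof (intro allI impI)
  fix N assume N: "submod (adjoin B y) N" "N \<subseteq> adjoin B y"
  let ?C = "adjoin B y"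
  interpret C: sub_comm_ring ?C
    by (rule sub_comm_ring_adj)
  have constC: "b \<in> ?C" if "b \<in> B" for b
    using subset_adj that by blast
  define lead where "lead M n = {coeff p n | p. (\<forall>i. coeff p i \<in> B) \<and> degree p \<le> n \<and> poly p y \<in> M}" for M n
  have lead_submod: "submod B (lead M n)" if M: "submod ?C M" for M n
    unfolding submod_def
  proof (intro conjI ballI)
    show "0 \<in> lead M n"
      using submodD(1)[OF M] by (auto simp: lead_def intro!: exI[of _ 0])
    fix u w assume "u \<in> lead M n" "w \<in> lead M n"
    then obtain p q where "\<forall>i. coeff p i \<in> B" "degree p \<le> n" "poly p y \<in> M" "u = coeff p n"
      "\<forall>i. coeff q i \<in> B" "degree q \<le> n" "poly q y \<in> M" "w = coeff q n"
      by (auto simp: lead_def)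
    then show "u + w \<in> lead M n"
      using submodD(2)[OF M] by (auto simp: lead_def degree_add_le intro!: exI[of _ "p + q"])
  next
    fix b u assume "b \<in> B" "u \<in> lead M n"
    then obtain p where "\<forall>i. coeff p i \<in> B" "degree p \<le> n" "poly p y \<in> M" "u = coeff p n"
      by (auto simp: lead_def)
    then show "b * u \<in> lead M n"
      using submodD(3)[OF M constC[OF \<open>b \<in> B\<close>]] \<open>b \<in> B\<close> order_trans[OF degree_smult_le]
      by (auto simp: lead_def intro!: exI[of _ "smult b p"])
  qed
  have lead_mono: "lead M i \<subseteq> lead M n" if M: "submod ?C M" and "i \<le> n" for M i n
  proof
    fix u assume "u \<in> lead M i"
    then obtain p where p: "\<forall>j. coeff p j \<in> B" "degree p \<le> i" "poly p y \<in> M" "u = coeff p i"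
      by (auto simp: lead_def)
    have "poly (monom 1 (n - i) * p) y = y ^ (n - i) * poly p y"
      by (simp add: poly_monom)
    also have "\<dots> \<in> M"
      using p(3) mem_adj by (intro submodD(3)[OF M]) auto
    finally have "poly (monom 1 (n - i) * p) y \<in> M" .
    moreover have "degree (monom 1 (n - i) * p) \<le> n"
      using degree_mult_le[of "monom (1::'a) (n - i)" p] degree_monom_le[of "1::'a" "n - i"] p(2) that(2)
      by arith
    ultimately show "u \<in> lead M n"
      using p that(2)
      by (auto simp: lead_def coeff_monom_mult intro!: exI[of _ "monom 1 (n - i) * p"])
  qed
  have lead_B: "lead N n \<subseteq> B" for n
    by (auto simp: lead_def)
  define L where "L = (\<Union>n. lead N n)"
  have "submod B L"
    unfolding L_def using lead_submod[OF N(1)] lead_mono[OF N(1)] by (rule submod_increasing_union)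
  moreover have "L \<subseteq> B"
    using lead_B by (auto simp: L_def)
  ultimately obtain X where X: "finite X" "X \<subseteq> L" "L \<subseteq> aspan B X"
    using noethD[OF assms] by metis
  have "\<exists>m. X \<subseteq> lead N m"
    using lead_mono[OF N(1)] X(1) X(2)[unfolded L_def] by (rule increasing_union_absorbs)
  then obtain m where m: "L \<subseteq> lead N m"
    using X(3) aspan_least[OF lead_submod[OF N(1)]] by blast
  have "\<forall>n. \<exists>Y. finite Y \<and> Y \<subseteq> lead N n \<and> lead N n \<subseteq> aspan B Y"
    using noethD[OF assms lead_submod[OF N(1)] lead_B] by blast
  then obtain Y where Y: "\<And>n. finite (Y n)" "\<And>n. Y n \<subseteq> lead N n" "\<And>n. lead N n \<subseteq> aspan B (Y n)"
    by metis
  have "\<forall>n. \<forall>x\<in>Y n. \<exists>p. (\<forall>i. coeff p i \<in> B) \<and> degree p \<le> n \<and> poly p y \<in> N \<and> coeff p n = x"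
    using Y(2) by (force simp: lead_def)
  then obtain P where P: "\<And>n x. x \<in> Y n \<Longrightarrow>
      (\<forall>i. coeff (P n x) i \<in> B) \<and> degree (P n x) \<le> n \<and> poly (P n x) y \<in> N \<and> coeff (P n x) n = x"
    by metis
  define G where "G = (\<Union>n\<le>m. (\<lambda>x. poly (P n x) y) ` Y n)"
  have G: "finite G" "G \<subseteq> N"
    using Y(1) P by (auto simp: G_def)
  define M where "M = aspan ?C G"
  have M: "submod ?C M" "G \<subseteq> M"
    unfolding M_def by (auto simp: C.submod_aspan intro: C.aspan_superset[THEN subsetD])
  have leads: "lead N n \<subseteq> lead M n" for n
  proof -
    have "Y n \<subseteq> lead M n" if "n \<le> m" for n
    proof
      fix x assume "x \<in> Y n"
      then show "x \<in> lead M n"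
        using P[of x n] M(2) that by (auto simp: lead_def G_def intro!: exI[of _ "P n x"])
    qed
    then have *: "lead N n \<subseteq> lead M n" if "n \<le> m" for n
      using aspan_least[OF lead_submod[OF M(1)]] Y(3) that by blast
    show ?thesis
    proof (cases "n \<le> m")
      case False
      have "lead N n \<subseteq> lead N m"
        using m by (auto simp: L_def)
      also have "\<dots> \<subseteq> lead M n"
        using *[of m] lead_mono[OF M(1), of m n] False by auto
      finally show ?thesis .
    qed (use * in auto)
  qed
  have "poly p y \<in> M" if "\<forall>i. coeff p i \<in> B" "\<forall>i\<ge>d. coeff p i = 0" "poly p y \<in> N" for p d
    using that
  proof (induction d arbitrary: p)
    case 0
    then have "p = 0"
      by (simp add: poly_eq_iff)
    then show ?case
      using submodD(1)[OF M(1)] by simp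
  next
    case (Suc d)
    then have "coeff p d \<in> lead N d"
      by (auto simp: lead_def intro!: exI[of _ p] degree_le)
    then have "coeff p d \<in> lead M d"
      using leads by blast
    then obtain q where q: "\<forall>i. coeff q i \<in> B" "degree q \<le> d" "poly q y \<in> M" "coeff q d = coeff p d"
      by (auto simp: lead_def)
    have "M \<subseteq> N"
      unfolding M_def by (rule aspan_least[OF N(1) G(2)])
    have "poly (p - q) y \<in> M"
    proof (rule Suc.IH)
      show "\<forall>i. coeff (p - q) i \<in> B"
        using Suc.prems(1) q(1) by simp
      show "\<forall>i\<ge>d. coeff (p - q) i = 0"
      proof (intro allI impI)
        fix i assume "d \<le> i"
        then show "coeff (p - q) i = 0"
          using Suc.prems(2) q(2,4) by (cases "i = d") (auto simp: coeff_eq_0)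
      qed
      show "poly (p - q) y \<in> N"
        using Suc.prems(3) q(3) \<open>M \<subseteq> N\<close> C.submod_diff[OF N(1)] by auto
    qed
    then show ?case
      using submodD(2)[OF M(1) _ q(3)] by fastforce
  qed
  then have "poly p y \<in> M" if "\<forall>i. coeff p i \<in> B" "poly p y \<in> N" for p
    using that coeff_eq_0 by (metis Suc_le_lessD)
  then have "N \<subseteq> M"
    using N(2) by (auto simp: adjoin_def)
  then show "\<exists>X. finite X \<and> X \<subseteq> N \<and> N \<subseteq> aspan ?C X"
    using G by (auto simp: M_def)
qed

lemma noeth_adjs: "noeth B B \<Longrightarrow> noeth (adjoins B y m) (adjoins B y m)"
  by (induction m) (auto intro: sub_comm_ring.noeth_adj sub_comm_ring_adjs)

text \<open>Generators of \<open>N \<inter> M\<close>, and lifts of generators of the image of \<open>N\<close> in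
  \<open>(M + M') / M\<close>.\<close>

lemma noeth_sum:
  assumes M: "submod B M" "noeth B M" and M': "submod B M'" "noeth B M'"
  shows "noeth B {u + w | u w. u \<in> M \<and> w \<in> M'}"
  unfolding noeth_def
proof (intro allI impI)
  fix N assume N: "submod B N" and sub: "N \<subseteq> {u + w | u w. u \<in> M \<and> w \<in> M'}"
  have "submod B (N \<inter> M)"
    using N M(1) by (auto simp: submod_def)
  then obtain X where X: "finite X" "X \<subseteq> N \<inter> M" "N \<inter> M \<subseteq> aspan B X"
    using noethD[OF M(2)] by (metis inf_le2)
  define Q where "Q = {w \<in> M'. \<exists>u\<in>M. u + w \<in> N}"
  have "submod B Q"
    unfolding submod_def
  proof (intro conjI ballI)
    show "0 \<in> Q"
      using submodD(1)[OF N] submodD(1)[OF M(1)] submodD(1)[OF M'(1)] by (auto simp: Q_def intro!: bexI[of _ 0])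
    fix w w' assume "w \<in> Q" "w' \<in> Q"
    then obtain u u' where *: "w \<in> M'" "w' \<in> M'" "u \<in> M" "u' \<in> M" "u + w \<in> N" "u' + w' \<in> N"
      by (auto simp: Q_def)
    then have "(u + u') + (w + w') \<in> N"
      using submodD(2)[OF N, of "u + w" "u' + w'"] by (simp add: algebra_simps)
    then show "w + w' \<in> Q"
      using * submodD(2)[OF M(1)] submodD(2)[OF M'(1)] by (auto simp: Q_def)
  next
    fix a w assume a: "a \<in> B" "w \<in> Q"
    then obtain u where *: "w \<in> M'" "u \<in> M" "u + w \<in> N"
      by (auto simp: Q_def)
    then have "a * u + a * w \<in> N"
      using submodD(3)[OF N a(1) *(3)] by (simp add: algebra_simps)
    then show "a * w \<in> Q"
      using * a submodD(3)[OF M(1)] submodD(3)[OF M'(1)] by (auto simp: Q_def)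
  qed
  then obtain Y where Y: "finite Y" "Y \<subseteq> Q" "Q \<subseteq> aspan B Y"
    using noethD[OF M'(2), of Q] by (auto simp: Q_def)
  have "\<forall>w\<in>Y. \<exists>u\<in>M. u + w \<in> N"
    using Y(2) by (auto simp: Q_def)
  then obtain h where h: "\<And>w. w \<in> Y \<Longrightarrow> h w \<in> M" "\<And>w. w \<in> Y \<Longrightarrow> h w + w \<in> N"
    by metis
  define Z where "Z = X \<union> (\<lambda>w. h w + w) ` Y"
  have Z: "finite Z" "Z \<subseteq> N"
    using X Y h by (auto simp: Z_def)
  have lift: "\<exists>u\<in>M. u + w \<in> aspan B Z" if "w \<in> aspan B Y" for w
    using that
  proof induction
    case aspan_zero
    then show ?case
      using submodD(1)[OF M(1)] by (auto intro!: bexI[of _ 0] aspan.intros)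
  next
    case (aspan_step a x r)
    then obtain u where u: "u \<in> M" "u + r \<in> aspan B Z"
      by blast
    have "a * (h x + x) + (u + r) \<in> aspan B Z"
      using aspan_step u by (intro aspan.aspan_step) (auto simp: Z_def)
    then have "(a * h x + u) + (a * x + r) \<in> aspan B Z"
      by (simp add: algebra_simps)
    moreover have "a * h x + u \<in> M"
      using aspan_step h u by (intro submodD(2)[OF M(1)] submodD(3)[OF M(1)]) auto
    ultimately show ?case by blast
  qed
  have "N \<subseteq> aspan B Z"
  proof
    fix v assume v: "v \<in> N"
    then obtain u w where uw: "v = u + w" "u \<in> M" "w \<in> M'"
      using sub by blast
    then have "w \<in> aspan B Y"
      using v Y(3) by (auto simp: Q_def)
    then obtain u' where u': "u' \<in> M" "u' + w \<in> aspan B Z"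
      using lift by blast
    have "aspan B Z \<subseteq> N"
      by (rule aspan_least[OF N Z(2)])
    then have "v - (u' + w) \<in> N"
      using v u' submod_diff[OF N] by blast
    moreover have "v - (u' + w) \<in> M"
      using submod_diff[OF M(1) uw(2) u'(1)] by (simp add: uw(1))
    ultimately have "v - (u' + w) \<in> aspan B Z"
      using X(3) aspan_mono[of B B X Z] by (auto simp: Z_def)
    then show "v \<in> aspan B Z"
      using submodD(2)[OF submod_aspan _ u'(2)] by fastforce
  qed
  then show "\<exists>X. finite X \<and> X \<subseteq> N \<and> N \<subseteq> aspan B X"
    using Z by blast
qed

lemma noeth_scale:
  assumes "submod B M" "noeth B M"
  shows "noeth B ((\<lambda>u. u * b) ` M)"
  unfolding noeth_def
proof (intro allI impI)
  fix N assume N: "submod B N" "N \<subseteq> (\<lambda>u. u * b) ` M"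
  define Q where "Q = {u \<in> M. u * b \<in> N}"
  have "submod B Q"
    using assms(1) N(1) by (auto simp: submod_def Q_def distrib_right mult.assoc)
  then obtain X where X: "finite X" "X \<subseteq> Q" "Q \<subseteq> aspan B X"
    using noethD[OF assms(2), of Q] by (auto simp: Q_def)
  have "u * b \<in> aspan B ((\<lambda>u. u * b) ` X)" if "u \<in> aspan B X" for u
    using that by induction (auto simp: distrib_right mult.assoc intro: aspan.intros)
  then have "N \<subseteq> aspan B ((\<lambda>u. u * b) ` X)"
    using N(2) X(3) by (fastforce simp: Q_def)
  then show "\<exists>X. finite X \<and> X \<subseteq> N \<and> N \<subseteq> aspan B X"
    using X(1,2) by (intro exI[of _ "(\<lambda>u. u * b) ` X"]) (auto simp: Q_def)
qed

lemma noeth_lc: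
  assumes "sub_comm_ring C" "B \<subseteq> C" "noeth B C"
  shows "noeth B (lincombs C y k)"
proof (induction k)
  case 0
  then show ?case
    by (auto simp: noeth_def submod_def intro!: exI[of _ "{}"] aspan.intros)
next
  case (Suc k)
  interpret C: sub_comm_ring C by fact
  have "submod B (lincombs C y k)"
    using C.submod_lc[of y k] assms(2) by (auto simp: submod_def)
  moreover have *: "submod B C"
    using assms(2) by (auto simp: submod_def)
  moreover have "submod B ((\<lambda>u. u * y k) ` C)"
    unfolding submod_def
  proof (intro conjI ballI)
    show "0 \<in> (\<lambda>u. u * y k) ` C"
      by (intro image_eqI[of _ _ 0]) auto
    fix u w assume "u \<in> (\<lambda>u. u * y k) ` C" "w \<in> (\<lambda>u. u * y k) ` C"
    then show "u + w \<in> (\<lambda>u. u * y k) ` C"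
      by (auto simp flip: distrib_right)
  next
    fix a u assume "a \<in> B" "u \<in> (\<lambda>u. u * y k) ` C"
    then show "a * u \<in> (\<lambda>u. u * y k) ` C"
      using assms(2) by (auto simp flip: mult.assoc)
  qed
  moreover have "lincombs C y (Suc k) = {u + w | u w. u \<in> lincombs C y k \<and> w \<in> (\<lambda>u. u * y k) ` C}"
    by (auto simp: lincombs_Suc)
  ultimately show ?case
    using noeth_sum[OF _ Suc, of "(\<lambda>u. u * y k) ` C"] noeth_scale[OF * assms(3)] by simp
qed

text \<open>The right-hand side is a \<open>B\<close>-module, and by the monic equation for \<open>y\<close> modulo \<open>P\<close> it is stable
  under multiplication by \<open>y\<close>.\<close>

lemma adj_subset_monic:
  assumes P: "submod (adjoin B y) P"
    and mon: "y ^ n \<in> {u + w | u w. u \<in> lincombs B (\<lambda>j. y ^ j) n \<and> w \<in> P}" (is "_ \<in> ?T")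
  shows "adjoin B y \<subseteq> {u + w | u w. u \<in> lincombs B (\<lambda>j. y ^ j) n \<and> w \<in> P}"
proof -
  have P_B: "submod B P"
    using P subset_adj[of y] by (auto simp: submod_def)
  have T: "submod B ?T"
    unfolding submod_def
  proof (intro conjI ballI)
    show "0 \<in> ?T"
      using submodD(1)[OF submod_lc] submodD(1)[OF P] by force
    fix u w assume "u \<in> ?T" "w \<in> ?T"
    then obtain a b c d where "u = a + b" "w = c + d" "a \<in> lincombs B (\<lambda>j. y ^ j) n"
       "c \<in> lincombs B (\<lambda>j. y ^ j) n" "b \<in> P" "d \<in> P"
      by blast
    moreover from this have "u + w = (a + c) + (b + d)"
      by simp
    ultimately show "u + w \<in> ?T"
      using submodD(2)[OF submod_lc] submodD(2)[OF P] by blast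
  next
    fix a u assume "a \<in> B" "u \<in> ?T"
    then show "a * u \<in> ?T"
      using submodD(3)[OF submod_lc] submodD(3)[OF P_B] by (force simp: distrib_left)
  qed
  have lincombs_T: "lincombs B (\<lambda>j. y ^ j) n \<subseteq> ?T" and P_T: "P \<subseteq> ?T"
    using submodD(1)[OF submod_lc] submodD(1)[OF P] by force+
  have pow_T: "y ^ Suc j \<in> ?T" if "j < n" for j
  proof (cases "Suc j = n")
    case False
    then show ?thesis
      using lincombs_mem[of "Suc j" n "\<lambda>j. y ^ j"] lincombs_T that by (metis (no_types, lifting) Suc_lessI subsetD)
  qed (use mon in simp)
  have y_T: "y * u \<in> ?T" if u: "u \<in> ?T" for u
  proof -
    obtain b w where b: "\<forall>j<n. b j \<in> B" "w \<in> P" "u = (\<Sum>j<n. b j * y ^ j) + w"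
      using u unfolding lincombs_def by blast
    have "y * u = (\<Sum>j<n. b j * y ^ Suc j) + y * w"
      by (simp add: b(3) distrib_left sum_distrib_left mult.left_commute)
    moreover have *: "(\<Sum>j<n. b j * y ^ Suc j) \<in> ?T"
      using b(1) pow_T by (intro submod_sum[OF T] submodD(3)[OF T]) auto
    moreover have "y * w \<in> ?T"
      using P_T submodD(3)[OF P mem_adj b(2)] by blast
    from submodD(2)[OF T * this] have "(\<Sum>j<n. b j * y ^ Suc j) + y * w \<in> ?T" .
    ultimately show ?thesis
      by (simp only:)
  qed
  have "y ^ i \<in> ?T" for i
  proof (induction i)
    case 0
    show ?case
    proof (cases n)
      case (Suc m)
      then show ?thesis
        by (intro subsetD[OF lincombs_T]) (use lincombs_mem[of 0 n "\<lambda>j. y ^ j"] Suc in simp)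
    qed (use mon in simp)
  next
    case (Suc i)
    from y_T[OF this] show ?case
      by (simp only: power_Suc)
  qed
  then have "poly p y \<in> ?T" if "\<forall>i. coeff p i \<in> B" for p
    unfolding poly_altdef using that by (intro submod_sum[OF T] submodD(3)[OF T]) auto
  then show ?thesis
    unfolding adjoin_def by blast
qed

text \<open>Iterating this from \<open>B\<close> upwards shows that adjoining finitely many integral elements
  leaves a Noetherian \<open>B\<close>-module.\<close>

lemma noeth_adj_integral:
  assumes C: "sub_comm_ring C" "B \<subseteq> C" "noeth B C" and mon: "y ^ n \<in> lincombs C (\<lambda>j. y ^ j) n"
  shows "noeth B (adjoin C y)"
proof -
  have "adjoin C y \<subseteq> {u + w | u w. u \<in> lincombs C (\<lambda>j. y ^ j) n \<and> w \<in> {0}}"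
    using mon by (intro sub_comm_ring.adj_subset_monic[OF C(1)]) (auto simp: submod_def)
  also have "\<dots> \<subseteq> lincombs C (\<lambda>j. y ^ j) n"
    by auto
  finally show ?thesis
    by (rule noeth_subset[OF noeth_lc[OF C]])
qed

lemma noeth_field:
  assumes "\<And>x. x \<in> B \<Longrightarrow> x \<noteq> 0 \<Longrightarrow> \<exists>y\<in>B. y * x = 1"
  shows "noeth B B"
  unfolding noeth_def
proof (intro allI impI)
  fix N assume N: "submod B N" "N \<subseteq> B"
  show "\<exists>X. finite X \<and> X \<subseteq> N \<and> N \<subseteq> aspan B X"
  proof (cases "N \<subseteq> {0}")
    case True
    then show ?thesis
      by (intro exI[of _ "{}"]) (auto intro: aspan.intros)
  next
    case False
    then obtain x y where x: "x \<in> N" "y \<in> B" "y * x = 1"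
      using N(2) assms by blast
    then have "1 \<in> N"
      using submodD(3)[OF N(1)] by metis
    moreover have "B \<subseteq> aspan B {1}"
      using aspan_step[of _ B 1 "{1}" 0] by (auto intro: aspan.intros)
    ultimately show ?thesis
      using N(2) by (intro exI[of _ "{1}"]) auto
  qed
qed

lemma noeth_finite_generation:
  assumes "noeth B C" "submod B C"
  obtains X where "finite X" "X \<subseteq> C" "C \<subseteq> aspan B X"
  using noethD[OF assms order_refl] by blast

lemma noetherian_ring_on:
  assumes A: "A \<subseteq> B" "noeth A B"
  shows "noetherian_ring (ring_on B)"
proof -
  interpret R: cring "ring_on B" by (rule cring_ring_on)
  show ?thesis
  proof
    fix I assume "ideal I (ring_on B)"
    then have I: "I \<subseteq> B" "submod B I"
      by (auto simp: ideal_ring_on_iff)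
    then have "submod A I"
      using A(1) by (auto simp: submod_def)
    then obtain X where X: "finite X" "X \<subseteq> I" "I \<subseteq> aspan A X"
      using noethD[OF A(2) _ I(1)] by blast
    have "I = aspan B X"
      using aspan_least[OF I(2) X(2)] X(3) aspan_mono[OF A(1) order_refl, of X] by blast
    then show "\<exists>A\<subseteq>carrier (ring_on B). finite A \<and> I = Idl\<^bsub>ring_on B\<^esub> A"
      using X I(1) genideal_ring_on[of X] by (intro exI[of _ X]) auto
  qed
qed

end

text \<open>In a graded ring that is finite over the subalgebra generated by homogeneous elements \<open>c\<close>,
  only finitely many degrees survive modulo \<open>c\<close>, so that elements without constant term are
  nilpotent there.\<close>

lemma (in graded_subring) power_mem_lc:
  assumes K: "sub_comm_ring K" "K \<subseteq> B" "\<And>x. x \<in> K \<Longrightarrow> gr x = [:x:]"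
    and c: "\<And>j. j < n \<Longrightarrow> c j \<in> B" "\<And>j. j < n \<Longrightarrow> gr (c j) = monom (c j) (e j)"
    and X: "finite X" "X \<subseteq> B" "B \<subseteq> aspan (adjoins K c n) X"
    and y: "y \<in> B" "coeff (gr y) 0 = 0"
  shows "\<exists>N. y ^ N \<in> lincombs B c n"
proof -
  interpret K: sub_comm_ring K by fact
  let ?J = "lincombs B c n"
  define E where "E = Max (insert 0 ((\<lambda>x. degree (gr x)) ` X))"
  have E: "degree (gr x) \<le> E" if "x \<in> X" for x
    using that X(1) by (auto simp: E_def)
  define D where "D = {\<kappa> + u | \<kappa> u. \<kappa> \<in> K \<and> u \<in> ?J}"
  have J_B: "?J \<subseteq> B"
    using c(1) by (rule lincombs_subset)
  note J = submodD[OF submod_lc[of c n]] submod_diff[OF submod_lc[of c n]]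
  interpret D: sub_comm_ring D
  proof
    show "1 \<in> D"
      using J(1) by (force simp: D_def)
    fix u w assume "u \<in> D" "w \<in> D"
    then obtain k k' r r' where *: "u = k + r" "w = k' + r'" "k \<in> K" "k' \<in> K" "r \<in> ?J" "r' \<in> ?J"
      by (auto simp: D_def)
    have "u - w = (k - k') + (r - r')" "u * w = k * k' + (k * r' + k' * r + r * r')"
      using * by (auto simp: algebra_simps)
    moreover have "k * r' + k' * r + r * r' \<in> ?J"
      using * K(2) J_B by (intro J(2,3)) auto
    ultimately show "u - w \<in> D" "u * w \<in> D"
      unfolding D_def using K.diff_mem[OF *(3,4)] K.mult_mem[OF *(3,4)] J(4)[OF *(5,6)] by blast+
  qed
  have "adjoins K c n \<subseteq> D"
  proof (rule D.adjs_least)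
    show "K \<subseteq> D"
      using J(1) by (force simp: D_def)
    show "c i \<in> D" if "i < n" for i
      using lincombs_mem[OF that, of c] K.zero_mem by (force simp: D_def)
  qed
  define T where "T = {b + u | b u. b \<in> B \<and> degree (gr b) \<le> E \<and> u \<in> ?J}"
  have "submod D T"
    unfolding submod_def
  proof (intro conjI ballI)
    show "0 \<in> T"
      using J(1) by (force simp: T_def gr_0)
    fix u w assume "u \<in> T" "w \<in> T"
    then obtain b b' r r' where *: "u = b + r" "w = b' + r'" "b \<in> B" "b' \<in> B" "r \<in> ?J" "r' \<in> ?J"
      "degree (gr b) \<le> E" "degree (gr b') \<le> E"
      by (auto simp: T_def)
    have "u + w = (b + b') + (r + r')"
      using * by simp
    moreover have "degree (gr (b + b')) \<le> E"
      using * by (auto simp: gr_add degree_add_le)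
    ultimately show "u + w \<in> T"
      unfolding T_def using add_mem[OF *(3,4)] J(2)[OF *(5,6)] by blast
  next
    fix a u assume "a \<in> D" "u \<in> T"
    then obtain k r b r' where *: "a = k + r" "u = b + r'" "k \<in> K" "b \<in> B" "r \<in> ?J" "r' \<in> ?J"
      "degree (gr b) \<le> E"
      by (auto simp: T_def D_def)
    have "a * u = k * b + (k * r' + b * r + r * r')"
      using * by (auto simp: algebra_simps)
    moreover have "k * r' + b * r + r * r' \<in> ?J"
      using * K(2) J_B by (intro J(2,3)) auto
    moreover have "degree (gr (k * b)) \<le> E"
      using * K(3)[of k] order_trans[OF degree_smult_le] by (simp add: gr_mult)
    moreover have "k * b \<in> B"
      using * K(2) by auto
    ultimately show "a * u \<in> T"
      unfolding T_def by blast
  qed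
  then have "submod (adjoins K c n) T"
    using \<open>adjoins K c n \<subseteq> D\<close> by (auto simp: submod_def)
  moreover have "X \<subseteq> T"
    using X(2) E J(1) by (force simp: T_def)
  ultimately have "B \<subseteq> T"
    using aspan_least X(3) by blast
  have high: "coeff (gr b) m \<in> ?J" if b: "b \<in> B" and m: "m > E" for b m
  proof -
    obtain b' u where *: "b = b' + u" "degree (gr b') \<le> E" "u \<in> ?J"
      using b \<open>B \<subseteq> T\<close> by (auto simp: T_def)
    have "coeff (gr b) m = coeff (gr u) m"
      using * m by (simp add: gr_add coeff_eq_0)
    also have "\<dots> \<in> ?J"
      using c(2) *(3) by (rule lincombs_component)
    finally show ?thesis .
  qed
  have "monom 1 1 dvd gr y"
    using y(2) by (simp add: monom_1_dvd_iff')
  then have "monom 1 1 ^ Suc E dvd gr y ^ Suc E"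
    by (rule dvd_power_same)
  then have "monom 1 (Suc E) dvd gr (y ^ Suc E)"
    unfolding gr_power by (simp add: monom_power del: power_Suc)
  then have low: "coeff (gr (y ^ Suc E)) m = 0" if "m \<le> E" for m
    using that unfolding monom_1_dvd_iff' by simp
  have "y ^ Suc E = poly (gr (y ^ Suc E)) 1"
    by (rule gr_total[symmetric])
  also have "\<dots> = (\<Sum>m\<le>degree (gr (y ^ Suc E)). coeff (gr (y ^ Suc E)) m)"
    by (simp add: poly_altdef)
  also have "\<dots> \<in> ?J"
  proof (rule submod_sum[OF submod_lc])
    fix m
    show "coeff (gr (y ^ Suc E)) m \<in> ?J"
      using low[of m] high[of "y ^ Suc E" m] y(1) J(1) by (cases "m \<le> E") auto
  qed
  finally show ?thesis ..
qed

section \<open>Prime ideals and chains of them\<close>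

context sub_comm_ring
begin

definition prime_in :: "'a set \<Rightarrow> bool" where
  "prime_in P \<longleftrightarrow> submod B P \<and> P \<subseteq> B \<and> 1 \<notin> P \<and> (\<forall>x\<in>B. \<forall>y\<in>B. x * y \<in> P \<longrightarrow> x \<in> P \<or> y \<in> P)"

lemma prime_inD:
  assumes "prime_in P"
  shows "submod B P" "P \<subseteq> B" "1 \<notin> P" "x \<in> B \<Longrightarrow> y \<in> B \<Longrightarrow> x * y \<in> P \<Longrightarrow> x \<in> P \<or> y \<in> P"
  using assms by (auto simp: prime_in_def)

lemma proper_iff_one: "submod B I \<Longrightarrow> I \<subseteq> B \<Longrightarrow> I \<noteq> B \<longleftrightarrow> 1 \<notin> I"
  using submodD(3)[of B I _ 1] by fastforce

lemma primeideal_ring_on_iff: "primeideal P (ring_on B) \<longleftrightarrow> prime_in P"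
proof
  assume P: "primeideal P (ring_on B)"
  then have "ideal P (ring_on B)"
    by (rule primeideal.axioms)
  then have "P \<subseteq> B" "submod B P"
    by (auto simp: ideal_ring_on_iff)
  moreover have "1 \<notin> P"
    using primeideal.I_notcarr[OF P] proper_iff_one calculation by auto
  ultimately show "prime_in P"
    using primeideal.I_prime[OF P] by (auto simp: prime_in_def)
next
  assume P: "prime_in P"
  show "primeideal P (ring_on B)"
  proof (rule primeidealI)
    show "ideal P (ring_on B)"
      using prime_inD[OF P] by (simp add: ideal_ring_on_iff)
    show "cring (ring_on B)"
      by (rule cring_ring_on)
    show "carrier (ring_on B) \<noteq> P"
      using prime_inD(3)[OF P] one_mem by auto
  qed (use prime_inD[OF P] in auto)
qed

text \<open>Zorn's lemma gives an ideal that is maximal among those that contain \<open>J\<close> and avoid \<open>M\<close>. It is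
  prime: two elements outside it enlarge it to ideals that meet \<open>M\<close>, and then so does the
  ideal enlarged by their product.\<close>

lemma prime_disjoint:
  assumes J: "submod B J" "J \<subseteq> B" and M: "M \<subseteq> B" "1 \<in> M" "\<And>x y. x \<in> M \<Longrightarrow> y \<in> M \<Longrightarrow> x * y \<in> M"
    and disj: "J \<inter> M = {}"
  shows "\<exists>Q. prime_in Q \<and> J \<subseteq> Q \<and> Q \<inter> M = {}"
proof -
  define \<A> where "\<A> = {I. submod B I \<and> I \<subseteq> B \<and> J \<subseteq> I \<and> I \<inter> M = {}}"
  have "\<exists>Q\<in>\<A>. \<forall>X\<in>\<A>. Q \<subseteq> X \<longrightarrow> X = Q"
  proof (rule subset_Zorn_nonempty)
    show "\<A> \<noteq> {}"
      using J disj by (auto simp: \<A>_def)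
    fix \<C> assume \<C>: "\<C> \<noteq> {}" "subset.chain \<A> \<C>"
    then have mem: "\<And>I. I \<in> \<C> \<Longrightarrow> I \<in> \<A>" and lin: "\<And>I I'. I \<in> \<C> \<Longrightarrow> I' \<in> \<C> \<Longrightarrow> I \<subseteq> I' \<or> I' \<subseteq> I"
      by (auto simp: subset_chain_def)
    have sub: "\<And>I. I \<in> \<C> \<Longrightarrow> submod B I"
      using mem by (auto simp: \<A>_def)
    have "submod B (\<Union>\<C>)"
      unfolding submod_def
    proof (intro conjI ballI)
      show "0 \<in> \<Union>\<C>"
        using \<C>(1) submodD(1)[OF sub] by blast
      fix x y assume "x \<in> \<Union>\<C>" "y \<in> \<Union>\<C>"
      then obtain I I' where "x \<in> I" "y \<in> I'" "I \<in> \<C>" "I' \<in> \<C>"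
        by blast
      then show "x + y \<in> \<Union>\<C>"
        using lin[of I I'] submodD(2)[OF sub] by blast
    next
      fix a x assume "a \<in> B" "x \<in> \<Union>\<C>"
      then show "a * x \<in> \<Union>\<C>"
        using submodD(3)[OF sub] by blast
    qed
    then show "\<Union>\<C> \<in> \<A>"
      using \<C>(1) mem by (auto simp: \<A>_def)
  qed
  then obtain Q where "Q \<in> \<A>" and Q_max: "\<And>X. X \<in> \<A> \<Longrightarrow> Q \<subseteq> X \<Longrightarrow> X = Q"
    by blast
  then have Q: "submod B Q" "Q \<subseteq> B" "J \<subseteq> Q" "Q \<inter> M = {}"
    by (auto simp: \<A>_def)
  have max: "X = Q" if "submod B X" "X \<subseteq> B" "Q \<subseteq> X" "X \<inter> M = {}" for X
    using Q_max[of X] Q(3) that unfolding \<A>_def by blast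
  have enlarge: "\<exists>b\<in>B. \<exists>w\<in>Q. w + b * x \<in> M" if x: "x \<in> B" "x \<notin> Q" for x
  proof (rule ccontr)
    assume *: "\<not> (\<exists>b\<in>B. \<exists>w\<in>Q. w + b * x \<in> M)"
    define X where "X = {w + b * x | w b. w \<in> Q \<and> b \<in> B}"
    have "submod B X"
      unfolding X_def by (rule submod_adjoin[OF Q(1)])
    moreover have "X \<subseteq> B"
      using Q(2) x(1) by (auto simp: X_def)
    moreover have "Q \<subseteq> X"
      unfolding X_def
    proof
      fix w assume "w \<in> Q"
      then show "w \<in> {w + b * x | w b. w \<in> Q \<and> b \<in> B}"
        by (intro CollectI exI[of _ w] exI[of _ 0]) auto
    qed
    moreover have "X \<inter> M = {}"
      using * by (auto simp: X_def)
    ultimately have "X = Q"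
      by (rule max)
    moreover have "x \<in> X"
      unfolding X_def using submodD(1)[OF Q(1)] by (intro CollectI exI[of _ 0] exI[of _ 1]) auto
    ultimately show False
      using x(2) by simp
  qed
  have "prime_in Q"
    unfolding prime_in_def
  proof (intro conjI ballI impI)
    show "1 \<notin> Q"
      using M(2) Q(4) by blast
    fix x y assume xy: "x \<in> B" "y \<in> B" "x * y \<in> Q"
    show "x \<in> Q \<or> y \<in> Q"
    proof (rule ccontr)
      assume "\<not> (x \<in> Q \<or> y \<in> Q)"
      then obtain b w c v where *: "b \<in> B" "w \<in> Q" "w + b * x \<in> M" "c \<in> B" "v \<in> Q" "v + c * y \<in> M"
        using enlarge xy by metis
      have "(w + b * x) * (v + c * y) = (v + c * y) * w + (b * x) * v + (b * c) * (x * y)"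
        by (simp add: algebra_simps)
      also have "\<dots> \<in> Q"
        using * xy Q(2) submodD(3)[OF Q(1), of "v + c * y" w] submodD(3)[OF Q(1), of "b * x" v]
          submodD(3)[OF Q(1), of "b * c" "x * y"]
        by (intro submodD(2)[OF Q(1)]) auto
      finally show False
        using M(3)[OF *(3,6)] Q(4) by blast
    qed
  qed (use Q in auto)
  then show ?thesis
    using Q by blast
qed

text \<open>Let \<open>J\<close> be generated by all but the last member of the sequence. The last member is not a zero
  divisor modulo \<open>J\<close>, so the products of its powers with elements outside \<open>P\<close> avoid \<open>J\<close>. A prime over
  \<open>J\<close> that avoids these products is strictly below \<open>P\<close>, and it contains the shorter sequence.\<close>

lemma prime_chain_of_regular:
  assumes "almost_regular B 1 y n" "\<And>i. i < n \<Longrightarrow> y i \<in> P" "prime_in P"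
  shows "\<exists>Q :: nat \<Rightarrow> 'a set. (\<forall>i\<le>n. prime_in (Q i)) \<and> (\<forall>i<n. Q i \<subset> Q (Suc i)) \<and> Q n = P"
  using assms
proof (induction n arbitrary: P)
  case 0
  then show ?case
    by (intro exI[of _ "\<lambda>_. P"]) auto
next
  case (Suc n)
  note P = prime_inD[OF Suc.prems(3)]
  let ?J = "lincombs B y n"
  have yB: "y i \<in> B" if "i < Suc n" for i
    using Suc.prems(2)[OF that] P(2) by blast
  have J_P: "?J \<subseteq> P"
    unfolding aspan_eq_lc[symmetric] using Suc.prems(2) by (intro aspan_least[OF P(1)]) auto
  have reg: "a \<in> ?J" if "a \<in> B" "y n * a \<in> ?J" for a
    using Suc.prems(1) that unfolding almost_regular_def by auto
  have cancel: "s \<in> ?J" if "s \<in> B" "s * y n ^ k \<in> ?J" for s k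
    using that(2)
  proof (induction k)
    case (Suc k)
    then have "y n * (s * y n ^ k) \<in> ?J"
      by (simp add: mult_ac)
    then show ?case
      using Suc.IH reg[of "s * y n ^ k"] that(1) yB[of n] by simp
  qed simp
  define M where "M = {s * y n ^ k | s k. s \<in> B - P}"
  have "\<exists>Q. prime_in Q \<and> ?J \<subseteq> Q \<and> Q \<inter> M = {}"
  proof (rule prime_disjoint[OF submod_lc])
    show "?J \<subseteq> B"
      using J_P P(2) by blast
    show "M \<subseteq> B"
      using yB[of n] by (auto simp: M_def)
    show "1 \<in> M"
      unfolding M_def using P(3) by (intro CollectI exI[of _ 1] exI[of _ 0]) auto
    show "x * z \<in> M" if x: "x \<in> M" and z: "z \<in> M" for x z
    proof -
      obtain s k s' k' where "x = s * y n ^ k" "z = s' * y n ^ k'" "s \<in> B - P" "s' \<in> B - P"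
        using x z by (auto simp: M_def)
      then have "x * z = (s * s') * y n ^ (k + k')" "s * s' \<in> B - P"
        using P(4) by (auto simp: power_add mult_ac)
      then show ?thesis
        unfolding M_def by blast
    qed
    show "?J \<inter> M = {}"
      using cancel J_P by (auto simp: M_def)
  qed
  then obtain Q where Q: "prime_in Q" "?J \<subseteq> Q" "Q \<inter> M = {}"
    by blast
  have "B - P \<subseteq> M"
  proof
    fix s assume "s \<in> B - P"
    then show "s \<in> M"
      unfolding M_def by (intro CollectI exI[of _ s] exI[of _ 0]) auto
  qed
  then have "Q \<subseteq> P"
    using Q prime_inD(2)[OF Q(1)] by blast
  moreover have "y n \<in> M"
    unfolding M_def using P(3) by (intro CollectI exI[of _ 1]) (auto intro!: exI[of _ 1])
  then have "y n \<notin> Q"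
    using Q(3) by blast
  ultimately have QP: "Q \<subset> P"
    using Suc.prems(2)[of n] by blast
  have "\<And>i. i < n \<Longrightarrow> y i \<in> Q"
    using lincombs_mem[of _ n y] Q(2) by blast
  moreover have "almost_regular B 1 y n"
    using Suc.prems(1) by (simp add: almost_regular_def)
  ultimately obtain R :: "nat \<Rightarrow> 'a set" where R: "\<forall>i\<le>n. prime_in (R i)" "\<forall>i<n. R i \<subset> R (Suc i)" "R n = Q"
    using Suc.IH[of Q] Q(1) by blast
  define R' where "R' = R(Suc n := P)"
  have "prime_in (R' i)" if "i \<le> Suc n" for i
    using R(1) Suc.prems(3) that by (auto simp: R'_def le_Suc_eq)
  moreover have "R' i \<subset> R' (Suc i)" if "i < Suc n" for i
    using R(2,3) QP that by (auto simp: R'_def less_Suc_eq)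
  moreover have "R' (Suc n) = P"
    by (simp add: R'_def)
  ultimately show ?case
    by blast
qed

end

subsection \<open>Growth bounds the length of prime chains\<close>

context graded_subring
begin

text \<open>A lower bound \<open>m\<close> for the number of residue classes modulo \<open>Q\<close> that are represented in degrees at
  most \<open>t\<close>.\<close>

definition packing :: "'a set \<Rightarrow> nat \<Rightarrow> nat \<Rightarrow> bool" where
  "packing Q t m \<longleftrightarrow>
     (\<exists>T. T \<subseteq> {f \<in> B. degree (gr f) \<le> t} \<and> finite T \<and> card T = m \<and>
          (\<forall>f\<in>T. \<forall>g\<in>T. f - g \<in> Q \<longrightarrow> f = g))"

lemma packing_mono:
  assumes "packing Q t m" "m' \<le> m" "t \<le> t'"
  shows "packing Q t' m'"
proof -
  obtain T where T: "T \<subseteq> {f \<in> B. degree (gr f) \<le> t}" "finite T" "card T = m"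
     "\<forall>f\<in>T. \<forall>g\<in>T. f - g \<in> Q \<longrightarrow> f = g"
    using assms(1) by (auto simp: packing_def)
  obtain S where "S \<subseteq> T" "card S = m'"
    using obtain_subset_with_card_n[of m' T] assms(2) T(3) by auto
  then show ?thesis
    unfolding packing_def using T assms(3) finite_subset[of S T] by (intro exI[of _ S]) fastforce
qed

text \<open>Multiplication by \<open>u\<close> embeds \<open>B / Q\<close> into the kernel of \<open>B / Q \<rightarrow> B / Q'\<close>, raising degrees by at
  most \<open>e\<close>. Hence elements \<open>f + u g\<close> with \<open>f\<close> from a packing modulo \<open>Q'\<close> and \<open>g\<close> from one modulo \<open>Q\<close>
  remain distinct modulo \<open>Q\<close>.\<close>

lemma packing_mult:
  assumes Q: "prime_in Q" and Q': "prime_in Q'" and sub: "Q \<subseteq> Q'"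
    and u: "u \<in> Q'" "u \<notin> Q" "degree (gr u) \<le> e"
    and "packing Q s a" "packing Q' t b" "s + e \<le> t"
  shows "packing Q t (a * b)"
proof -
  obtain T where T: "T \<subseteq> {f \<in> B. degree (gr f) \<le> s}" "finite T" "card T = a"
     "\<forall>f\<in>T. \<forall>g\<in>T. f - g \<in> Q \<longrightarrow> f = g"
    using assms(7) by (auto simp: packing_def)
  obtain T' where T': "T' \<subseteq> {f \<in> B. degree (gr f) \<le> t}" "finite T'" "card T' = b"
     "\<forall>f\<in>T'. \<forall>g\<in>T'. f - g \<in> Q' \<longrightarrow> f = g"
    using assms(8) by (auto simp: packing_def)
  define h where "h = (\<lambda>(g, f). f + u * g)"
  have uB: "u \<in> B"
    using u(1) prime_inD(2)[OF Q'] by blast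
  have sep: "x = x'" if x: "x \<in> T \<times> T'" and x': "x' \<in> T \<times> T'" and d: "h x - h x' \<in> Q" for x x'
  proof -
    obtain g f g' f' where eq: "x = (g, f)" "x' = (g', f')"
      by fastforce
    have mem: "g \<in> T" "f \<in> T'" "g' \<in> T" "f' \<in> T'" "g \<in> B" "g' \<in> B" "f \<in> B" "f' \<in> B"
      using x x' T(1) T'(1) by (auto simp: eq)
    have d': "(f - f') + u * (g - g') \<in> Q"
      using d by (simp add: eq h_def algebra_simps)
    have "(g - g') * u \<in> Q'"
      using mem u(1) by (intro submodD(3)[OF prime_inD(1)[OF Q']]) auto
    then have "((f - f') + u * (g - g')) - (g - g') * u \<in> Q'"
      using d' sub by (intro submod_diff[OF prime_inD(1)[OF Q']]) auto
    then have "f = f'"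
      using T'(4) mem by (auto simp: mult.commute)
    then have "u * (g - g') \<in> Q"
      using d' by simp
    then have "g = g'"
      using prime_inD(4)[OF Q uB, of "g - g'"] u(2) mem T(4) by auto
    then show ?thesis
      using \<open>f = f'\<close> by (simp add: eq)
  qed
  have "inj_on h (T \<times> T')"
    using sep submodD(1)[OF prime_inD(1)[OF Q]] by (intro inj_onI) auto
  then have "card (h ` (T \<times> T')) = a * b"
    by (simp add: card_image card_cartesian_product T(3) T'(3))
  moreover have "h ` (T \<times> T') \<subseteq> {f \<in> B. degree (gr f) \<le> t}"
  proof
    fix v assume "v \<in> h ` (T \<times> T')"
    then obtain g f where v: "v = f + u * g" "g \<in> T" "f \<in> T'"
      by (auto simp: h_def)
    have "degree (gr u * gr g) \<le> t"
      using degree_mult_le[of "gr u" "gr g"] u(3) T(1) v(2) assms(9) by force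
    then show "v \<in> {f \<in> B. degree (gr f) \<le> t}"
      using v(1) subsetD[OF T(1) v(2)] subsetD[OF T'(1) v(3)] uB
      by (simp add: gr_add gr_mult degree_add_le)
  qed
  moreover have "finite (h ` (T \<times> T'))"
    using T(2) T'(2) by simp
  ultimately show ?thesis
    unfolding packing_def using sep by (intro exI[of _ "h ` (T \<times> T')"]) blast
qed

text \<open>Going down \<open>j\<close> steps from the top of the chain, the number of residue classes in degrees up to
  \<open>E t\<close> is at least \<open>2 ^ (t choose j)\<close>, where \<open>E\<close> bounds the degrees of elements that separate
  consecutive primes. The exponent is a polynomial in \<open>t\<close> of degree \<open>j\<close>, which cannot exceed \<open>d\<close>.\<close>

theorem prime_chain_length_le:
  assumes fin: "\<And>t. finite {f \<in> B. degree (gr f) \<le> t}"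
    and growth: "\<And>t. card {f \<in> B. degree (gr f) \<le> t} \<le> q ^ ((t + 1) ^ d)"
    and Q: "\<And>i. i \<le> n \<Longrightarrow> prime_in (Q i)" "\<And>i. i < n \<Longrightarrow> Q i \<subset> Q (Suc i)"
  shows "n \<le> d"
proof (rule ccontr)
  assume "\<not> n \<le> d"
  have "\<forall>i<n. \<exists>u. u \<in> Q (Suc i) - Q i"
    using Q(2) by blast
  then obtain u where u: "\<And>i. i < n \<Longrightarrow> u i \<in> Q (Suc i)" "\<And>i. i < n \<Longrightarrow> u i \<notin> Q i"
    by (metis DiffD1 DiffD2)
  define E where "E = (\<Sum>i<n. degree (gr (u i)))"
  have E: "degree (gr (u i)) \<le> E" if "i < n" for i
    unfolding E_def using that by (intro member_le_sum) auto
  have pack: "packing (Q (n - j)) (E * t) (2 ^ (t choose j))" if "j \<le> n" for j t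
    using that
  proof (induction j arbitrary: t)
    case 0
    have "packing (Q n) 0 2"
      unfolding packing_def using prime_inD(3)[OF Q(1)[of n]] submod_uminus[OF prime_inD(1)[OF Q(1)[of n]], of "- 1"]
      by (intro exI[of _ "{0, 1}"]) (auto simp: gr_0 gr_1)
    then show ?case
      by (auto intro: packing_mono)
  next
    case (Suc j)
    have IHj: "packing (Q (n - j)) (E * t) (2 ^ (t choose j))" for t
      using Suc.IH Suc.prems by simp
    have sj: "n - j = Suc (n - Suc j)" "n - Suc j < n"
      using Suc.prems by auto
    show ?case
    proof (induction t)
      case 0
      have "packing (Q (n - Suc j)) 0 1"
        unfolding packing_def by (intro exI[of _ "{0}"]) (auto simp: gr_0)
      then show ?case by simp
    next
      case (Suc t)
      have "packing (Q (n - Suc j)) (E * Suc t) (2 ^ (t choose Suc j) * 2 ^ (Suc t choose j))"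
      proof (rule packing_mult[OF Q(1) Q(1) _ _ _ _ Suc.IH])
        show "packing (Q (n - j)) (E * Suc t) (2 ^ (Suc t choose j))"
          by (rule IHj)
        show "Q (n - Suc j) \<subseteq> Q (n - j)"
          using Q(2)[OF sj(2)] sj(1) by auto
        show "u (n - Suc j) \<in> Q (n - j)" "u (n - Suc j) \<notin> Q (n - Suc j)"
          using u[OF sj(2)] sj(1) by auto
        show "degree (gr (u (n - Suc j))) \<le> E"
          using E[OF sj(2)] .
      qed auto
      moreover have "(2::nat) ^ (Suc t choose Suc j) \<le> 2 ^ (t choose Suc j) * 2 ^ (Suc t choose j)"
        unfolding power_add[symmetric] by (intro power_increasing) (cases j, auto)
      ultimately show ?case
        by (rule packing_mono) simp
    qed
  qed
  have bound: "t choose (Suc d) \<le> q * (E * t + 1) ^ d" for t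
  proof -
    have "packing (Q (n - Suc d)) (E * t) (2 ^ (t choose Suc d))"
      using pack \<open>\<not> n \<le> d\<close> by simp
    then obtain T where "T \<subseteq> {f \<in> B. degree (gr f) \<le> E * t}" "card T = 2 ^ (t choose Suc d)"
      unfolding packing_def by blast
    then have "2 ^ (t choose Suc d) \<le> card {f \<in> B. degree (gr f) \<le> E * t}"
      using card_mono[OF fin[of "E * t"], of T] by simp
    also have "\<dots> \<le> q ^ ((E * t + 1) ^ d)"
      by (rule growth)
    also have "\<dots> \<le> (2 ^ q) ^ ((E * t + 1) ^ d)"
      using less_exp[of q] by (intro power_mono) auto
    finally show ?thesis
      by (simp add: power_mult[symmetric])
  qed
  define C where "C = q * (E * Suc d + 1) ^ d"
  \<comment> \<open>At \<open>t = m * Suc d\<close> the bound would give \<open>m ^ Suc d \<le> C * m ^ d\<close>.\<close>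
  define m where "m = Suc C"
  have "(real (m * Suc d) / real (Suc d)) ^ Suc d \<le> real ((m * Suc d) choose Suc d)"
    by (rule binomial_ge_n_over_k_pow_k) (simp add: m_def)
  moreover have "real (m * Suc d) / real (Suc d) = real m"
    unfolding of_nat_mult by (rule nonzero_mult_div_cancel_right) simp
  ultimately have "real (m ^ Suc d) \<le> real ((m * Suc d) choose Suc d)"
    by (simp only: of_nat_power)
  then have "m ^ Suc d \<le> (m * Suc d) choose Suc d"
    by (simp only: of_nat_le_iff)
  also have "\<dots> \<le> q * (E * (m * Suc d) + 1) ^ d"
    by (rule bound)
  also have "\<dots> \<le> q * ((E * Suc d + 1) * m) ^ d"
    by (intro mult_left_mono power_mono) (auto simp: m_def algebra_simps)
  also have "\<dots> = C * m ^ d"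
    by (simp only: C_def power_mult_distrib mult.assoc)
  finally have "m \<le> C"
    by (simp add: m_def)
  then show False
    by (simp add: m_def)
qed

end

section \<open>Evaluation of polynomials\<close>

locale rhom =
  fixes h :: "'a::comm_ring_1 \<Rightarrow> 'b::comm_ring_1"
  assumes hom_one [simp]: "h 1 = 1"
    and hom_add: "h (x + y) = h x + h y"
    and hom_mult: "h (x * y) = h x * h y"
begin

lemma hom_zero [simp]: "h 0 = 0"
  using hom_add[of 0 0] by (metis add.right_neutral add_left_cancel)

lemma hom_uminus: "h (- x) = - h x"
  using hom_add[of x "- x"] by (simp add: eq_neg_iff_add_eq_0 add.commute)

lemma hom_diff: "h (x - y) = h x - h y"
  using hom_add[of x "- y"] by (simp add: hom_uminus)

lemma hom_sum: "h (sum f I) = (\<Sum>i\<in>I. h (f i))"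
  by (induction I rule: infinite_finite_induct) (auto simp: hom_add)

lemma hom_prod: "h (prod f I) = (\<Prod>i\<in>I. h (f i))"
  by (induction I rule: infinite_finite_induct) (auto simp: hom_mult)

lemma hom_power: "h (x ^ n) = h x ^ n"
  by (induction n) (auto simp: hom_mult)

lemma hom_poly: "h (poly p x) = poly (map_poly h p) (h x)"
  by (induction p) (auto simp: hom_add hom_mult map_poly_pCons)

lemma sub_comm_ring_range: "sub_comm_ring (range h)"
proof
  show "1 \<in> range h"
    using hom_one by (metis rangeI)
  fix u v assume "u \<in> range h" "v \<in> range h"
  then show "u - v \<in> range h" "u * v \<in> range h"
    by (auto simp flip: hom_diff hom_mult)
qed

lemma rhom_map_poly: "rhom (map_poly h)"
proof
  show "map_poly h 1 = 1"
    by simp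
  show "map_poly h (p + q) = map_poly h p + map_poly h q" for p q
    by (intro poly_eqI) (simp add: coeff_map_poly hom_add)
  show "map_poly h (p * q) = map_poly h p * map_poly h q" for p q
    by (intro poly_eqI) (simp add: coeff_map_poly coeff_mult hom_sum hom_mult)
qed

end

lemma rhom_comp: "rhom g \<Longrightarrow> rhom h \<Longrightarrow> rhom (\<lambda>x. g (h x))"
  by (simp add: rhom_def)

lemma rhom_id: "rhom (\<lambda>x. x)"
  by (simp add: rhom_def)

abbreviation const :: "'k::comm_ring_1 \<Rightarrow> 'k mpolynomial" where
  "const a \<equiv> Poly_Mapping.single 0 a"

definition var :: "nat \<Rightarrow> 'k::comm_ring_1 mpolynomial" where
  "var i = Poly_Mapping.single (Poly_Mapping.single i 1) 1"

lemma rhom_const: "rhom (const :: 'k::comm_ring_1 \<Rightarrow> _)"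
  by standard (simp_all add: single_add mult_single)

definition mval :: "(nat \<Rightarrow> 'a::comm_ring_1) \<Rightarrow> (nat \<Rightarrow>\<^sub>0 nat) \<Rightarrow> 'a" where
  "mval s m = (\<Prod>i\<in>Poly_Mapping.keys m. s i ^ Poly_Mapping.lookup m i)"

definition peval :: "('k::comm_ring_1 \<Rightarrow> 'a::comm_ring_1) \<Rightarrow> (nat \<Rightarrow> 'a) \<Rightarrow> 'k mpolynomial \<Rightarrow> 'a" where
  "peval \<phi> s f = (\<Sum>m\<in>Poly_Mapping.keys f. \<phi> (Poly_Mapping.lookup f m) * mval s m)"

lemma mval_superset:
  assumes "finite A" "Poly_Mapping.keys m \<subseteq> A"
  shows "mval s m = (\<Prod>i\<in>A. s i ^ Poly_Mapping.lookup m i)"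
  unfolding mval_def using assms by (intro prod.mono_neutral_left) (auto simp: in_keys_iff)

lemma mval_0 [simp]: "mval s 0 = 1"
  by (simp add: mval_def)

lemma mval_add: "mval s (m + m') = mval s m * mval s m'"
proof -
  let ?A = "Poly_Mapping.keys m \<union> Poly_Mapping.keys m'"
  have "mval s (m + m') = (\<Prod>i\<in>?A. s i ^ Poly_Mapping.lookup (m + m') i)"
    by (rule mval_superset) (auto simp: keys_add)
  then show ?thesis
    by (simp add: mval_superset[of ?A m] mval_superset[of ?A m'] lookup_add power_add prod.distrib)
qed

lemma mval_single [simp]: "mval s (Poly_Mapping.single i n) = s i ^ n"
  by (cases "n = 0") (simp_all add: mval_def)

lemma mpoly_sum_single: "(\<Sum>m\<in>Poly_Mapping.keys f. Poly_Mapping.single m (Poly_Mapping.lookup f m)) = f"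
  by (intro poly_mapping_eqI) (auto simp: lookup_sum lookup_single when_def in_keys_iff)

lemma mval_var: "mval var m = (Poly_Mapping.single m 1 :: 'k::comm_ring_1 mpolynomial)"
proof -
  have pow: "var i ^ n = (Poly_Mapping.single (Poly_Mapping.single i n) 1 :: 'k mpolynomial)" for i n
    by (induction n) (simp_all add: var_def mult_single single_add[symmetric])
  have "(\<Prod>i\<in>A. Poly_Mapping.single (g i) (1::'k)) = Poly_Mapping.single (\<Sum>i\<in>A. g i) 1"
    for A :: "nat set" and g :: "nat \<Rightarrow> nat \<Rightarrow>\<^sub>0 nat"
    by (induction A rule: infinite_finite_induct) (simp_all add: mult_single)
  moreover have "(\<Sum>i\<in>Poly_Mapping.keys m. Poly_Mapping.single i (Poly_Mapping.lookup m i)) = m"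
    by (intro poly_mapping_eqI) (auto simp: lookup_sum lookup_single when_def in_keys_iff)
  ultimately show ?thesis
    by (simp add: mval_def pow)
qed

lemma single_eq_mval: "Poly_Mapping.single m a = const a * mval var m"
  by (simp add: mval_var mult_single)

lemma peval_zero [simp]: "peval \<phi> s 0 = 0"
  by (simp add: peval_def)

context
  fixes \<phi> :: "'k::comm_ring_1 \<Rightarrow> 'a::comm_ring_1"
  assumes \<phi>: "rhom \<phi>"
begin

interpretation \<phi>: rhom \<phi> by (fact \<phi>)

lemma peval_superset:
  assumes "finite A" "Poly_Mapping.keys f \<subseteq> A"
  shows "peval \<phi> s f = (\<Sum>m\<in>A. \<phi> (Poly_Mapping.lookup f m) * mval s m)"
  unfolding peval_def using assms by (intro sum.mono_neutral_left) (auto simp: in_keys_iff)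

lemma peval_add: "peval \<phi> s (f + g) = peval \<phi> s f + peval \<phi> s g"
proof -
  let ?A = "Poly_Mapping.keys f \<union> Poly_Mapping.keys g"
  have "peval \<phi> s (f + g) = (\<Sum>m\<in>?A. \<phi> (Poly_Mapping.lookup (f + g) m) * mval s m)"
    by (rule peval_superset) (auto simp: Poly_Mapping.keys_add)
  then show ?thesis
    by (simp add: peval_superset[of ?A f] peval_superset[of ?A g] lookup_add \<phi>.hom_add distrib_right sum.distrib)
qed

lemma peval_single: "peval \<phi> s (Poly_Mapping.single m a) = \<phi> a * mval s m"
  by (cases "a = 0") (simp_all add: peval_def)

lemma peval_sum: "peval \<phi> s (sum f I) = (\<Sum>i\<in>I. peval \<phi> s (f i))"
  by (induction I rule: infinite_finite_induct) (auto simp: peval_add)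

lemma peval_mult: "peval \<phi> s (f * g) = peval \<phi> s f * peval \<phi> s g"
proof -
  have "f * g = (\<Sum>m\<in>Poly_Mapping.keys f. Poly_Mapping.single m (Poly_Mapping.lookup f m)) *
                (\<Sum>m\<in>Poly_Mapping.keys g. Poly_Mapping.single m (Poly_Mapping.lookup g m))"
    by (simp only: mpoly_sum_single)
  also have "\<dots> = (\<Sum>m\<in>Poly_Mapping.keys f. \<Sum>m'\<in>Poly_Mapping.keys g.
      Poly_Mapping.single (m + m') (Poly_Mapping.lookup f m * Poly_Mapping.lookup g m'))"
    by (simp add: sum_product mult_single)
  finally show ?thesis
    by (simp add: peval_sum peval_single)
       (simp add: peval_def sum_product mval_add \<phi>.hom_mult mult_ac)
qed

lemma rhom_peval: "rhom (peval \<phi> s)"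
  by standard (auto simp: peval_add peval_mult peval_single simp flip: single_one)

lemma peval_const [simp]: "peval \<phi> s (const a) = \<phi> a"
  by (simp add: peval_single)

lemma peval_var [simp]: "peval \<phi> s (var i) = s i"
  by (simp add: var_def peval_single)

end

lemma mem_poly_ring: "f \<in> carrier (poly_ring d) \<longleftrightarrow> (\<forall>m\<in>Poly_Mapping.keys f. Poly_Mapping.keys m \<subseteq> {..<d})"
  by (simp add: poly_ring_def)

lemma const_mem_poly_ring: "const a \<in> carrier (poly_ring d)"
  by (cases "a = 0") (auto simp: mem_poly_ring)

lemma var_mem_poly_ring: "i < d \<Longrightarrow> var i \<in> carrier (poly_ring d)"
  by (auto simp: mem_poly_ring var_def)

lemma sub_comm_ring_poly_ring: "sub_comm_ring (carrier (poly_ring d) :: 'k::comm_ring_1 mpolynomial set)"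
proof
  show "1 \<in> carrier (poly_ring d)"
    using const_mem_poly_ring[of 1] by simp
  fix f g :: "'k mpolynomial"
  assume f: "f \<in> carrier (poly_ring d)" and g: "g \<in> carrier (poly_ring d)"
  show "f - g \<in> carrier (poly_ring d)"
    unfolding mem_poly_ring
  proof
    fix m assume "m \<in> Poly_Mapping.keys (f - g)"
    then have "m \<in> Poly_Mapping.keys f \<or> m \<in> Poly_Mapping.keys g"
      by (auto simp: in_keys_iff lookup_minus)
    then show "Poly_Mapping.keys m \<subseteq> {..<d}"
      using f g by (auto simp: mem_poly_ring)
  qed
  show "f * g \<in> carrier (poly_ring d)"
    unfolding mem_poly_ring
  proof
    fix m assume "m \<in> Poly_Mapping.keys (f * g)"
    then obtain a b where "m = a + b" "a \<in> Poly_Mapping.keys f" "b \<in> Poly_Mapping.keys g"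
      using keys_mult[of f g] by blast
    moreover have "Poly_Mapping.keys (a + b) \<subseteq> Poly_Mapping.keys a \<union> Poly_Mapping.keys b"
      by (auto simp: in_keys_iff lookup_add)
    ultimately show "Poly_Mapping.keys m \<subseteq> {..<d}"
      using f g unfolding mem_poly_ring by blast
  qed
qed

lemma adjs_eq_peval:
  assumes "rhom \<phi>"
  shows "adjoins (range \<phi>) y m \<subseteq> peval \<phi> y ` carrier (poly_ring m)"
proof -
  interpret P: rhom "peval \<phi> y" by (rule rhom_peval[OF assms])
  have sub: "sub_comm_ring (peval \<phi> y ` carrier (poly_ring m))" for m
  proof -
    interpret R: sub_comm_ring "carrier (poly_ring m) :: 'a mpolynomial set"
      by (rule sub_comm_ring_poly_ring)
    show ?thesis
    proof
      show "1 \<in> peval \<phi> y ` carrier (poly_ring m)"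
        using P.hom_one R.one_mem by (metis image_eqI)
      fix u v assume "u \<in> peval \<phi> y ` carrier (poly_ring m)" "v \<in> peval \<phi> y ` carrier (poly_ring m)"
      then obtain f g where *: "f \<in> carrier (poly_ring m)" "g \<in> carrier (poly_ring m)"
          "u = peval \<phi> y f" "v = peval \<phi> y g"
        by blast
      show "u - v \<in> peval \<phi> y ` carrier (poly_ring m)"
        unfolding * P.hom_diff[symmetric] using * by (intro imageI R.diff_mem)
      show "u * v \<in> peval \<phi> y ` carrier (poly_ring m)"
        unfolding * P.hom_mult[symmetric] using * by (intro imageI R.mult_mem)
    qed
  qed
  show ?thesis
  proof (rule sub_comm_ring.adjs_least[OF sub])
    show "range \<phi> \<subseteq> peval \<phi> y ` carrier (poly_ring m)"
      using peval_const[OF assms, of y] const_mem_poly_ring by (metis image_eqI image_subsetI)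
    show "y i \<in> peval \<phi> y ` carrier (poly_ring m)" if "i < m" for i
      using peval_var[OF assms, of y] var_mem_poly_ring[OF that] by (metis image_eqI)
  qed
qed

text \<open>It suffices to look at constants and variables when two homomorphisms are compared or closure of
  the polynomial ring under a homomorphism is proved.\<close>

lemma poly_ring_subset:
  assumes "sub_comm_ring C" "range const \<subseteq> C" "\<And>i. i < d \<Longrightarrow> var i \<in> C"
  shows "carrier (poly_ring d) \<subseteq> C"
proof
  interpret C: sub_comm_ring C by fact
  fix f :: "'a mpolynomial" assume f: "f \<in> carrier (poly_ring d)"
  have "(\<Sum>m\<in>Poly_Mapping.keys f. Poly_Mapping.single m (Poly_Mapping.lookup f m)) \<in> C"
  proof (rule C.sum_mem)
    fix m assume "m \<in> Poly_Mapping.keys f"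
    then have "mval var m \<in> C"
      unfolding mval_def using f by (intro C.prod_mem C.power_mem assms(3)) (auto simp: mem_poly_ring)
    moreover have "const (Poly_Mapping.lookup f m) \<in> C"
      using assms(2) by blast
    ultimately show "Poly_Mapping.single m (Poly_Mapping.lookup f m) \<in> C"
      unfolding single_eq_mval[of m] by (rule C.mult_mem[rotated])
  qed
  then show "f \<in> C"
    by (simp only: mpoly_sum_single)
qed

lemma rhom_mpoly_eq:
  assumes "rhom g" "rhom h" "\<And>a. g (const a) = h (const a)" "\<And>i. i < d \<Longrightarrow> g (var i) = h (var i)"
    and "f \<in> carrier (poly_ring d)"
  shows "g f = h f"
proof -
  interpret g: rhom g by fact
  interpret h: rhom h by fact
  have "sub_comm_ring {f. g f = h f}"
    by standard (auto simp: g.hom_diff h.hom_diff g.hom_mult h.hom_mult)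
  then show ?thesis
    using poly_ring_subset[of "{f. g f = h f}" d] assms(3-5) by auto
qed

lemma mem_some_poly_ring: "\<exists>d. f \<in> carrier (poly_ring d)"
proof -
  have "finite (\<Union>m\<in>Poly_Mapping.keys f. Poly_Mapping.keys m)"
    by simp
  then obtain d where "(\<Union>m\<in>Poly_Mapping.keys f. Poly_Mapping.keys m) \<subseteq> {..<d}"
    using finite_nat_iff_bounded by blast
  then show ?thesis
    by (auto simp: mem_poly_ring)
qed

subsection \<open>The standard grading\<close>

definition mgr :: "'k::field mpolynomial \<Rightarrow> 'k mpolynomial poly" where
  "mgr = peval (\<lambda>a. [:const a:]) (\<lambda>i. monom (var i) 1)"

lemma rhom_mgr: "rhom (mgr :: 'k::field mpolynomial \<Rightarrow> _)"
proof -
  have "rhom (\<lambda>a. [:const a:] :: 'k mpolynomial poly)"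
    by standard (auto simp: single_add mult_single one_pCons mult.commute)
  then show ?thesis
    unfolding mgr_def by (rule rhom_peval)
qed

lemma mgr_const: "mgr (const a) = [:const a:]"
  by (simp add: mgr_def peval_def)

lemma mgr_var: "mgr (var i) = monom (var i) 1"
  by (simp add: mgr_def peval_def one_pCons var_def)

definition mdeg :: "(nat \<Rightarrow>\<^sub>0 nat) \<Rightarrow> nat" where
  "mdeg m = (\<Sum>i\<in>Poly_Mapping.keys m. Poly_Mapping.lookup m i)"

lemma mgr_single:
  fixes a :: "'k::field"
  shows "mgr (Poly_Mapping.single m a) = monom (Poly_Mapping.single m a) (mdeg m)"
proof -
  interpret rhom "mgr :: 'k mpolynomial \<Rightarrow> _" by (rule rhom_mgr)
  have prod_monom: "(\<Prod>i\<in>A. monom (g i) (n i)) = monom (\<Prod>i\<in>A. g i) (\<Sum>i\<in>A. n i)"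
    for A :: "nat set" and g :: "nat \<Rightarrow> 'k mpolynomial" and n
    by (induction A rule: infinite_finite_induct) (simp_all add: mult_monom one_pCons monom_0)
  have "mgr (mval var m) = monom (mval var m :: 'k mpolynomial) (mdeg m)"
    by (simp add: mval_def hom_prod hom_power mgr_var monom_power prod_monom mdeg_def)
  then show ?thesis
    by (simp only: single_eq_mval[of m a] hom_mult mgr_const) (simp add: smult_monom)
qed

lemma coeff_mgr:
  fixes f :: "'k::field mpolynomial"
  shows "coeff (mgr f) n = (\<Sum>m\<in>Poly_Mapping.keys f. if mdeg m = n then Poly_Mapping.single m (Poly_Mapping.lookup f m) else 0)"
proof -
  interpret rhom "mgr :: 'k mpolynomial \<Rightarrow> _" by (rule rhom_mgr)
  have "mgr f = (\<Sum>m\<in>Poly_Mapping.keys f. mgr (Poly_Mapping.single m (Poly_Mapping.lookup f m)))"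
    by (simp only: hom_sum[symmetric] mpoly_sum_single)
  then show ?thesis
    by (simp add: mgr_single coeff_sum cong: if_cong)
qed

lemma grading_mgr: "grading (mgr :: 'k::field mpolynomial \<Rightarrow> _)"
proof -
  interpret rhom "mgr :: 'k mpolynomial \<Rightarrow> _" by (rule rhom_mgr)
  show ?thesis
  proof
    fix f g :: "'k mpolynomial"
    show "mgr (f + g) = mgr f + mgr g" "mgr (f * g) = mgr f * mgr g"
      by (rule hom_add, rule hom_mult)
    show "mgr (1 :: 'k mpolynomial) = 1"
      by (rule hom_one)
    have "rhom (\<lambda>f. poly (mgr f) (1 :: 'k mpolynomial))"
      by standard (simp_all add: hom_add hom_mult)
    moreover obtain d where "f \<in> carrier (poly_ring d)"
      using mem_some_poly_ring by blast
    ultimately show "poly (mgr f) 1 = f"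
      using rhom_mpoly_eq[of "\<lambda>f. poly (mgr f) 1" "\<lambda>f. f" d f] rhom_id
      by (simp add: mgr_const mgr_var poly_monom)
    fix n
    show "mgr (coeff (mgr f) n) = monom (coeff (mgr f) n) n"
    proof -
      have "mgr (coeff (mgr f) n) =
        (\<Sum>m\<in>Poly_Mapping.keys f. monom (if mdeg m = n then Poly_Mapping.single m (Poly_Mapping.lookup f m) else 0) n)"
        unfolding coeff_mgr hom_sum by (intro sum.cong) (auto simp: mgr_single)
      also have "\<dots> = monom (coeff (mgr f) n) n"
        unfolding coeff_mgr by (intro poly_eqI) (simp add: coeff_sum)
      finally show ?thesis .
    qed
  qed
qed

section \<open>Residue fields of finitely generated algebras over a finite field\<close>

lemma digits_unique:
  fixes a b :: "nat \<Rightarrow> nat"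
  assumes "\<And>i. i < n \<Longrightarrow> a i < E" "\<And>i. i < n \<Longrightarrow> b i < E" "(\<Sum>i<n. a i * E ^ i) = (\<Sum>i<n. b i * E ^ i)"
    and "i < n"
  shows "a i = b i"
  using assms
proof (induction n arbitrary: a b i)
  case (Suc n)
  have split: "(\<Sum>i<Suc n. c i * E ^ i) = c 0 + E * (\<Sum>i<n. c (Suc i) * E ^ i)" for c
    by (simp add: sum.lessThan_Suc_shift sum_distrib_left mult_ac del: sum.lessThan_Suc)
  have eq: "a 0 + E * (\<Sum>i<n. a (Suc i) * E ^ i) = b 0 + E * (\<Sum>i<n. b (Suc i) * E ^ i)"
    using Suc.prems(3) unfolding split .
  have E: "a 0 < E" "b 0 < E"
    using Suc.prems(1,2) by auto
  have "a 0 = b 0"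
    using arg_cong[OF eq, of "\<lambda>t. t mod E"] E by simp
  then have "(\<Sum>i<n. a (Suc i) * E ^ i) = (\<Sum>i<n. b (Suc i) * E ^ i)"
    using eq E by simp
  then have "a (Suc j) = b (Suc j)" if "j < n" for j
    using Suc.IH[of "\<lambda>i. a (Suc i)" "\<lambda>i. b (Suc i)" j] Suc.prems(1,2) that by auto
  then show ?case
    using \<open>a 0 = b 0\<close> Suc.prems(4) by (cases i) auto
qed simp

context sub_comm_ring
begin

lemma lincombs_powers_mult:
  assumes "u \<in> lincombs B (\<lambda>j. y ^ j) a" "v \<in> lincombs B (\<lambda>j. y ^ j) b"
  shows "u * v \<in> lincombs B (\<lambda>j. y ^ j) (a + b)"
proof -
  obtain c where c: "\<forall>i<a. c i \<in> B" "u = (\<Sum>i<a. c i * y ^ i)"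
    using assms(1) by (auto simp: lincombs_def)
  obtain e where e: "\<forall>i<b. e i \<in> B" "v = (\<Sum>i<b. e i * y ^ i)"
    using assms(2) by (auto simp: lincombs_def)
  have "u * v = (\<Sum>i<a. \<Sum>j<b. (c i * e j) * y ^ (i + j))"
    by (simp add: c(2) e(2) sum_product power_add mult_ac)
  also have "\<dots> \<in> lincombs B (\<lambda>j. y ^ j) (a + b)"
    using c(1) e(1) by (intro submod_sum[OF submod_lc] submodD(3)[OF submod_lc] lincombs_mem) auto
  finally show ?thesis .
qed

end

text \<open>The values at \<open>y\<close> of monic polynomials of degree \<open>n\<close> over \<open>A\<close>. As \<open>y\<close> may be algebraic, an element can
  have this form for several \<open>n\<close>.\<close>

definition monic_in :: "'a::comm_ring_1 set \<Rightarrow> 'a \<Rightarrow> nat \<Rightarrow> 'a set" where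
  "monic_in A y n = {y ^ n + l | l. l \<in> lincombs A (\<lambda>j. y ^ j) n}"

context sub_comm_ring
begin

lemma monic_in_mult:
  assumes "u \<in> monic_in B y a" "v \<in> monic_in B y b"
  shows "u * v \<in> monic_in B y (a + b)"
proof -
  obtain l l' where l: "u = y ^ a + l" "l \<in> lincombs B (\<lambda>j. y ^ j) a" "v = y ^ b + l'" "l' \<in> lincombs B (\<lambda>j. y ^ j) b"
    using assms by (auto simp: monic_in_def)
  have shift: "y ^ i * r \<in> lincombs B (\<lambda>j. y ^ j) (i + j)" if "r \<in> lincombs B (\<lambda>j. y ^ j) j" for i j r
  proof -
    obtain e where e: "\<forall>i<j. e i \<in> B" "r = (\<Sum>i<j. e i * y ^ i)"
      using \<open>r \<in> _\<close> by (auto simp: lincombs_def)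
    have "y ^ i * r = (\<Sum>k<j. e k * y ^ (i + k))"
      by (simp add: e(2) sum_distrib_left power_add mult_ac)
    also have "\<dots> \<in> lincombs B (\<lambda>j. y ^ j) (i + j)"
      using e(1) by (intro submod_sum[OF submod_lc] submodD(3)[OF submod_lc] lincombs_mem) auto
    finally show ?thesis .
  qed
  have "u * v = y ^ (a + b) + (y ^ a * l' + y ^ b * l + l * l')"
    by (simp add: l algebra_simps power_add)
  moreover have "y ^ a * l' + y ^ b * l + l * l' \<in> lincombs B (\<lambda>j. y ^ j) (a + b)"
    using shift[OF l(4), of a] shift[OF l(2), of b] lincombs_powers_mult[OF l(2,4)]
    by (intro submodD(2)[OF submod_lc]) (simp_all add: add.commute)
  ultimately show ?thesis
    unfolding monic_in_def by blast
qed

lemma one_monic_in: "1 \<in> monic_in B y 0"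
  by (auto simp: monic_in_def)

lemma monic_in_power: "u \<in> monic_in B y a \<Longrightarrow> u ^ n \<in> monic_in B y (n * a)"
  by (induction n) (auto simp: one_monic_in intro: monic_in_mult)

lemma monic_in_prod:
  assumes "finite I" "\<And>i. i \<in> I \<Longrightarrow> u i \<in> monic_in B y (a i)"
  shows "prod u I \<in> monic_in B y (sum a I)"
  using assms by (induction I rule: finite_induct) (auto simp: one_monic_in intro: monic_in_mult)

end

text \<open>Nagata's change of variables. A nontrivial relation \<open>F\<close> among \<open>y 0, \<dots>, y m\<close> modulo \<open>P\<close> becomes
  monic in \<open>y m\<close> after subtracting suitable powers of \<open>y m\<close> from the others. The exponents are
  powers of a number \<open>E\<close> that exceeds all exponents in \<open>F\<close>, so that distinct monomials get
  distinct degrees in \<open>y m\<close>.\<close>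

lemma nagata:
  fixes \<phi> :: "'k::field \<Rightarrow> 'a::comm_ring_1"
  assumes \<phi>: "rhom \<phi>" and P: "submod (adjoins (range \<phi>) y (Suc m)) P"
    and F: "F \<in> carrier (poly_ring (Suc m))" "F \<noteq> 0" "peval \<phi> y F \<in> P"
  shows "\<exists>z n. (\<forall>i<m. z i \<in> adjoins (range \<phi>) y (Suc m)) \<and>
           adjoins (range \<phi>) y (Suc m) \<subseteq> adjoin (adjoins (range \<phi>) z m) (y m) \<and>
           y m ^ n \<in> {u + w | u w. u \<in> lincombs (adjoins (range \<phi>) z m) (\<lambda>j. y m ^ j) n \<and> w \<in> P}"
proof -
  interpret \<phi>: rhom \<phi> by fact
  interpret K: sub_comm_ring "range \<phi>" by (rule \<phi>.sub_comm_ring_range)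
  let ?A = "adjoins (range \<phi>) y (Suc m)"
  interpret A: sub_comm_ring ?A by (rule K.sub_comm_ring_adjs)
  have yA: "y i \<in> ?A" if "i \<le> m" for i
    using K.mem_adjs[of i "Suc m" y] that by simp
  have KA: "range \<phi> \<subseteq> ?A"
    using K.adjs_mono[of 0 "Suc m" y] by simp
  let ?keys = Poly_Mapping.keys and ?lookup = Poly_Mapping.lookup
  \<comment> \<open>A crude bound; the exponents of a monomial in \<open>F\<close> are then the digits to base \<open>E\<close> of the degree of
    its image in \<open>y m\<close>.\<close>
  define E where "E = Suc (\<Sum>\<mu>\<in>?keys F. \<Sum>i<Suc m. ?lookup \<mu> i)"
  have E: "?lookup \<mu> i < E" if "\<mu> \<in> ?keys F" "i < Suc m" for \<mu> i
  proof -
    have "?lookup \<mu> i \<le> (\<Sum>i<Suc m. ?lookup \<mu> i)"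
      using that by (intro member_le_sum) auto
    also have "\<dots> \<le> (\<Sum>\<mu>\<in>?keys F. \<Sum>i<Suc m. ?lookup \<mu> i)"
      using that by (intro member_le_sum) auto
    finally show ?thesis by (simp add: E_def)
  qed
  define z where "z i = y i - y m ^ (E ^ Suc i)" for i
  define A' where "A' = adjoins (range \<phi>) z m"
  interpret A': sub_comm_ring A' unfolding A'_def by (rule K.sub_comm_ring_adjs)
  interpret A'y: sub_comm_ring "adjoin A' (y m)" by (rule A'.sub_comm_ring_adj)
  have zA': "z i \<in> A'" if "i < m" for i
    unfolding A'_def using that by (rule K.mem_adjs)
  have KA': "\<phi> a \<in> A'" for a
    using K.adjs_mono[of 0 m z] by (auto simp: A'_def)
  have zA: "\<forall>i<m. z i \<in> ?A"
    using yA by (simp add: z_def del: adjoins.simps)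
  have sub: "?A \<subseteq> adjoin A' (y m)"
  proof (rule A'y.adjs_least)
    show "range \<phi> \<subseteq> adjoin A' (y m)"
      using KA' A'.subset_adj by blast
    fix i assume "i < Suc m"
    show "y i \<in> adjoin A' (y m)"
    proof (cases "i = m")
      case False
      then have "z i + y m ^ (E ^ Suc i) \<in> adjoin A' (y m)"
        using zA'[of i] A'.subset_adj[of "y m"] A'.mem_adj \<open>i < Suc m\<close>
        by (intro A'y.add_mem A'y.power_mem) auto
      then show ?thesis by (simp add: z_def)
    qed (simp add: A'.mem_adj)
  qed
  define wt where "wt i = (if i = m then 1 else E ^ Suc i)" for i
  define w where "w \<mu> = (\<Sum>i<Suc m. ?lookup \<mu> i * wt i)" for \<mu>
  have y_monic: "y i \<in> monic_in A' (y m) (wt i)" if "i < Suc m" for i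
  proof (cases "i = m")
    case True
    then show ?thesis
      using submodD(1)[OF A'.submod_lc] by (force simp: monic_in_def wt_def)
  next
    case False
    have "z i * y m ^ 0 \<in> lincombs A' (\<lambda>j. y m ^ j) (wt i)"
      using False that zA' by (intro submodD(3)[OF A'.submod_lc] A'.lincombs_mem) (auto simp: wt_def E_def)
    moreover have "y i = y m ^ wt i + z i"
      using False by (simp add: wt_def z_def)
    ultimately show ?thesis
      unfolding monic_in_def by auto
  qed
  have mval_monic: "mval y \<mu> \<in> monic_in A' (y m) (w \<mu>)" if "\<mu> \<in> ?keys F" for \<mu>
  proof -
    have "?keys \<mu> \<subseteq> {..<Suc m}"
      using F(1) that by (auto simp: mem_poly_ring)
    then have "mval y \<mu> = (\<Prod>i<Suc m. y i ^ ?lookup \<mu> i)"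
      by (intro mval_superset) auto
    also have "\<dots> \<in> monic_in A' (y m) (w \<mu>)"
      unfolding w_def using y_monic by (intro A'.monic_in_prod A'.monic_in_power) auto
    finally show ?thesis .
  qed
  have w_inj: "\<mu> = \<nu>" if \<mu>: "\<mu> \<in> ?keys F" and \<nu>: "\<nu> \<in> ?keys F" and eq: "w \<mu> = w \<nu>" for \<mu> \<nu>
  proof -
    define dig where "dig \<mu> i = (case i of 0 \<Rightarrow> ?lookup \<mu> m | Suc i \<Rightarrow> ?lookup \<mu> i)" for \<mu> :: "nat \<Rightarrow>\<^sub>0 nat" and i
    have w_dig: "w \<mu> = (\<Sum>i<Suc m. dig \<mu> i * E ^ i)" for \<mu>
      by (subst sum.lessThan_Suc_shift) (simp add: w_def wt_def dig_def)
    have dig_E: "dig \<mu> i < E" if "\<mu> \<in> ?keys F" "i < Suc m" for \<mu> i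
      using E[OF that(1)] that(2) by (auto simp: dig_def split: nat.splits)
    have dig_eq: "dig \<mu> i = dig \<nu> i" if "i < Suc m" for i
      using digits_unique[of "Suc m" "dig \<mu>" E "dig \<nu>" i] dig_E \<mu> \<nu> eq that unfolding w_dig by blast
    have "?lookup \<mu> i = ?lookup \<nu> i" for i
    proof (cases "i < Suc m")
      case True
      then show ?thesis
        using dig_eq[of 0] dig_eq[of "Suc i"] by (cases "i = m") (auto simp: dig_def)
    next
      case False
      then have "i \<notin> ?keys \<mu>" "i \<notin> ?keys \<nu>"
        using F(1) \<mu> \<nu> by (auto simp: mem_poly_ring)
      then show ?thesis
        by (simp add: in_keys_iff)
    qed
    then show ?thesis
      by (rule poly_mapping_eqI)
  qed
  have "?keys F \<noteq> {}"
    using F(2) by simp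
  then have "Max (w ` ?keys F) \<in> w ` ?keys F"
    by (intro Max_in) auto
  then obtain \<mu> where \<mu>_mem: "\<mu> \<in> ?keys F" and w\<mu>: "w \<mu> = Max (w ` ?keys F)"
    by auto
  have \<mu>: "\<mu> \<in> ?keys F" "\<And>\<nu>. \<nu> \<in> ?keys F \<Longrightarrow> w \<nu> \<le> w \<mu>"
    using \<mu>_mem unfolding w\<mu> by (auto intro: Max_ge)
  let ?L = "lincombs A' (\<lambda>j. y m ^ j) (w \<mu>)"
  have lower: "mval y \<nu> \<in> ?L" if \<nu>: "\<nu> \<in> ?keys F - {\<mu>}" for \<nu>
  proof -
    have "w \<nu> < w \<mu>"
      using \<mu> \<nu> w_inj[of \<nu> \<mu>] by (metis DiffE insertI1 le_neq_implies_less)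
    moreover obtain l where "mval y \<nu> = y m ^ w \<nu> + l" "l \<in> lincombs A' (\<lambda>j. y m ^ j) (w \<nu>)"
      using mval_monic[of \<nu>] \<nu> by (auto simp: monic_in_def)
    ultimately show ?thesis
      using A'.lincombs_mem[of "w \<nu>" "w \<mu>" "\<lambda>j. y m ^ j"] A'.lincombs_mono[of "w \<nu>" "w \<mu>" "\<lambda>j. y m ^ j"]
        submodD(2)[OF A'.submod_lc] by (metis less_imp_le subsetD)
  qed
  obtain l where l: "mval y \<mu> = y m ^ w \<mu> + l" "l \<in> ?L"
    using mval_monic[OF \<mu>(1)] by (auto simp: monic_in_def)
  define a where "a = ?lookup F \<mu>"
  have "a \<noteq> 0"
    using \<mu>(1) by (simp add: a_def in_keys_iff)
  define r where "r = \<phi> a * l + (\<Sum>\<nu>\<in>?keys F - {\<mu>}. \<phi> (?lookup F \<nu>) * mval y \<nu>)"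
  have r: "r \<in> ?L"
    unfolding r_def using lower l(2) KA'
    by (intro submodD(2,3)[OF A'.submod_lc] submod_sum[OF A'.submod_lc]) auto
  have "peval \<phi> y F = \<phi> a * y m ^ w \<mu> + r"
    unfolding peval_def using \<mu>(1)
    by (subst sum.remove[of _ \<mu>]) (auto simp: l(1) a_def r_def distrib_left)
  then have "\<phi> (1 / a) * peval \<phi> y F = y m ^ w \<mu> + \<phi> (1 / a) * r"
    using \<open>a \<noteq> 0\<close> by (simp add: distrib_left mult.assoc[symmetric] \<phi>.hom_mult[symmetric])
  then have "y m ^ w \<mu> = - \<phi> (1 / a) * r + \<phi> (1 / a) * peval \<phi> y F"
    by simp
  moreover have "- \<phi> (1 / a) * r \<in> ?L"
    using KA' r by (intro submodD(3)[OF A'.submod_lc]) auto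
  moreover have "\<phi> (1 / a) * peval \<phi> y F \<in> P"
    using KA F(3) by (intro submodD(3)[OF P]) auto
  ultimately have "y m ^ w \<mu> \<in> {u + w | u w. u \<in> ?L \<and> w \<in> P}"
    by blast
  then show ?thesis
    using zA sub unfolding A'_def by blast
qed

lemma (in sub_comm_ring) finite_aspan:
  assumes "finite B" "finite X"
  shows "finite (aspan B X)"
proof -
  obtain y :: "nat \<Rightarrow> 'a" and n where X: "X = y ` {..<n}"
    using assms(2) by (metis finite_imp_nat_seg_image_inj_on lessThan_def)
  have "lincombs B y n \<subseteq> (\<lambda>b. \<Sum>i<n. b i * y i) ` (PiE {..<n} (\<lambda>_. B))"
  proof
    fix u assume "u \<in> lincombs B y n"
    then obtain b where "\<forall>i<n. b i \<in> B" "u = (\<Sum>i<n. b i * y i)"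
      by (auto simp: lincombs_def)
    then show "u \<in> (\<lambda>b. \<Sum>i<n. b i * y i) ` (PiE {..<n} (\<lambda>_. B))"
      by (intro image_eqI[of _ _ "restrict b {..<n}"]) auto
  qed
  then show ?thesis
    unfolding X aspan_eq_lc using assms(1) by (elim finite_subset) (intro finite_imageI finite_PiE, auto)
qed

text \<open>The \<open>A\<close>-modules generated by \<open>1, w, \<dots>, w ^ (n - 1)\<close> become stationary, because \<open>B / P\<close> is a
  Noetherian \<open>A\<close>-module. So \<open>w ^ n\<close> is modulo \<open>P\<close> a combination of lower powers for some \<open>n\<close>, and
  multiplication by \<open>y ^ n\<close> turns this into the claim.\<close>

lemma (in sub_comm_ring) inverse_in_subring:
  assumes A: "sub_comm_ring A" "A \<subseteq> B" "noeth A A"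
    and P: "submod B P" and X: "finite X" "X \<subseteq> B" "B \<subseteq> {u + p | u p. u \<in> aspan A X \<and> p \<in> P}"
    and y: "y \<in> A" and w: "w \<in> B" "y * w - 1 \<in> P"
  shows "\<exists>v\<in>A. 1 - y * v \<in> P"
proof -
  interpret A: sub_comm_ring A by fact
  have PA: "submod A P"
    using P A(2) by (auto simp: submod_def)
  obtain x :: "nat \<Rightarrow> 'a" and k where "X = x ` {..<k}"
    using X(1) by (metis finite_imp_nat_seg_image_inj_on lessThan_def)
  then have "noeth A (aspan A X)"
    using A.noeth_lc[OF A(1) order_refl A(3), of x k] by (simp add: A.aspan_eq_lc)
  define Nn where "Nn n = {u \<in> aspan A X. \<exists>v\<in>lincombs A (\<lambda>j. w ^ j) n. u - v \<in> P}" for n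
  have Nn_submod: "submod A (Nn n)" for n
    unfolding submod_def
  proof (intro conjI ballI)
    show "0 \<in> Nn n"
      using submodD(1)[OF A.submod_aspan] submodD(1)[OF A.submod_lc] submodD(1)[OF P]
      by (auto simp: Nn_def intro!: bexI[of _ 0])
    fix u u' assume "u \<in> Nn n" "u' \<in> Nn n"
    then obtain v v' where *: "u \<in> aspan A X" "u' \<in> aspan A X" "v \<in> lincombs A (\<lambda>j. w ^ j) n"
      "v' \<in> lincombs A (\<lambda>j. w ^ j) n" "u - v \<in> P" "u' - v' \<in> P"
      by (auto simp: Nn_def)
    have "(u + u') - (v + v') \<in> P"
      using submodD(2)[OF P *(5,6)] by (simp add: algebra_simps)
    then show "u + u' \<in> Nn n"
      unfolding Nn_def using submodD(2)[OF A.submod_aspan *(1,2)] submodD(2)[OF A.submod_lc *(3,4)] by blast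
  next
    fix a u assume a: "a \<in> A" and "u \<in> Nn n"
    then obtain v where *: "u \<in> aspan A X" "v \<in> lincombs A (\<lambda>j. w ^ j) n" "u - v \<in> P"
      by (auto simp: Nn_def)
    have "a * u - a * v \<in> P"
      using submodD(3)[OF PA a *(3)] by (simp add: algebra_simps)
    then show "a * u \<in> Nn n"
      unfolding Nn_def using submodD(3)[OF A.submod_aspan a *(1)] submodD(3)[OF A.submod_lc a *(2)] by blast
  qed
  have Nn_mono: "Nn i \<subseteq> Nn j" if "i \<le> j" for i j
    using A.lincombs_mono[OF that, of "\<lambda>j. w ^ j"] by (auto simp: Nn_def)
  define N where "N = (\<Union>n. Nn n)"
  have "submod A N"
    unfolding N_def using Nn_submod Nn_mono by (rule submod_increasing_union)
  moreover have "N \<subseteq> aspan A X"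
    by (auto simp: N_def Nn_def)
  ultimately obtain Z where Z: "finite Z" "Z \<subseteq> N" "N \<subseteq> aspan A Z"
    using noethD[OF \<open>noeth A (aspan A X)\<close>] by metis
  have "\<exists>n. Z \<subseteq> Nn n"
    using Nn_mono Z(1) Z(2)[unfolded N_def] by (rule increasing_union_absorbs)
  then obtain n where "Z \<subseteq> Nn n"
    by blast
  then have "N \<subseteq> Nn n"
    using Z(3) aspan_least[OF Nn_submod] by blast
  obtain u p where u: "u \<in> aspan A X" "p \<in> P" "w ^ n = u + p"
    using X(3) power_mem[OF w(1), of n] by blast
  have wn: "u - w ^ n \<in> P"
    using submod_uminus[OF P u(2)] by (simp add: u(3))
  moreover have "w ^ n \<in> lincombs A (\<lambda>j. w ^ j) (Suc n)"
    by (rule A.lincombs_mem) simp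
  ultimately have "u \<in> N"
    using u(1) unfolding N_def Nn_def by blast
  then obtain v where v: "v \<in> lincombs A (\<lambda>j. w ^ j) n" "u - v \<in> P"
    using \<open>N \<subseteq> Nn n\<close> by (auto simp: Nn_def)
  have "w ^ n - v \<in> P"
    using submod_diff[OF P v(2) wn] by simp
  obtain a where a: "\<forall>j<n. a j \<in> A" "v = (\<Sum>j<n. a j * w ^ j)"
    using v(1) by (auto simp: lincombs_def)
  have yB: "y \<in> B"
    using y A(2) by blast
  have inv_pow: "y ^ j * w ^ j - 1 \<in> P" for j
  proof (induction j)
    case (Suc j)
    have "y ^ Suc j * w ^ Suc j - 1 = (y * w) * (y ^ j * w ^ j - 1) + (y * w - 1)"
      by (simp add: algebra_simps)
    also have "\<dots> \<in> P"
      using Suc w yB by (intro submodD(2)[OF P] submodD(3)[OF P _ Suc]) auto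
    finally show ?case .
  qed (use submodD(1)[OF P] in simp)
  define v' where "v' = (\<Sum>j<n. a j * y ^ (n - Suc j))"
  have "v' \<in> A"
    using a(1) y unfolding v'_def by (intro A.sum_mem A.mult_mem A.power_mem) auto
  have "y ^ n * v - y * v' = (\<Sum>j<n. (a j * y ^ (n - j)) * (y ^ j * w ^ j - 1))"
  proof -
    have "y ^ n * (a j * w ^ j) - y * (a j * y ^ (n - Suc j)) = (a j * y ^ (n - j)) * (y ^ j * w ^ j - 1)"
      if "j < n" for j
    proof -
      have "y ^ n = y ^ (n - j) * y ^ j" "y ^ (n - j) = y * y ^ (n - Suc j)"
        using that by (simp_all flip: power_add power_Suc add: Suc_diff_Suc)
      then show ?thesis
        by (simp add: algebra_simps)
    qed
    then show ?thesis
      by (simp add: a(2) v'_def sum_distrib_left sum_subtractf[symmetric])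
  qed
  also have "\<dots> \<in> P"
    using a(1) A(2) yB inv_pow by (intro submod_sum[OF P] submodD(3)[OF P]) auto
  finally have "y ^ n * v - y * v' \<in> P" .
  moreover have "y ^ n * (w ^ n - v) \<in> P"
    using \<open>w ^ n - v \<in> P\<close> yB by (intro submodD(3)[OF P]) auto
  ultimately have "(y ^ n * v - y * v') + y ^ n * (w ^ n - v) \<in> P"
    by (rule submodD(2)[OF P])
  then have "((y ^ n * v - y * v') + y ^ n * (w ^ n - v)) - (y ^ n * w ^ n - 1) \<in> P"
    using inv_pow by (rule submod_diff[OF P])
  then have "1 - y * v' \<in> P"
    by (simp add: algebra_simps)
  then show ?thesis
    using \<open>v' \<in> A\<close> by blast
qed

text \<open>Zariski's lemma for a finite ground field. The residue field is finite over the algebra generated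
  by \<open>y 0, \<dots>, y m\<close>. Unless \<open>y m\<close> is zero there, that algebra contains an inverse \<open>v\<close> of
  it, so \<open>1 - y m * v = 0\<close> is a nontrivial relation of these generators, and by Nagata's change of
  variables the residue field is finite over an algebra with one generator less. In the end it is finite over the ground field.\<close>

theorem (in sub_comm_ring) finite_residue_field:
  fixes \<phi> :: "'k::{field,finite} \<Rightarrow> 'a" and y :: "nat \<Rightarrow> 'a"
  assumes \<phi>: "rhom \<phi>" "range \<phi> \<subseteq> B"
    and P: "submod B P" "P \<subseteq> B" and field: "\<And>u. u \<in> B \<Longrightarrow> u \<notin> P \<Longrightarrow> \<exists>w\<in>B. u * w - 1 \<in> P"
    and y: "\<And>i. i < m \<Longrightarrow> y i \<in> B"
    and X: "finite X" "X \<subseteq> B" "B \<subseteq> {u + p | u p. u \<in> aspan (adjoins (range \<phi>) y m) X \<and> p \<in> P}"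
  shows "\<exists>T. finite T \<and> (\<forall>b\<in>B. \<exists>t\<in>T. b - t \<in> P)"
  using y X
proof (induction m arbitrary: y X)
  case 0
  interpret \<phi>: rhom \<phi> by fact
  have "finite (aspan (range \<phi>) X)"
    using \<phi>.sub_comm_ring_range 0(2) by (intro sub_comm_ring.finite_aspan) auto
  moreover have "\<exists>t\<in>aspan (range \<phi>) X. b - t \<in> P" if b: "b \<in> B" for b
  proof -
    obtain u p where "b = u + p" "u \<in> aspan (range \<phi>) X" "p \<in> P"
      using 0(4) b by auto
    then show ?thesis by (intro bexI[of _ u]) auto
  qed
  ultimately show ?case by blast
next
  case (Suc m)
  interpret \<phi>: rhom \<phi> by fact
  interpret K: sub_comm_ring "range \<phi>" by (rule \<phi>.sub_comm_ring_range)
  let ?A = "adjoins (range \<phi>) y (Suc m)"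
  have AB: "?A \<subseteq> B"
    using Suc.prems(1) by (rule adjs_least[OF \<phi>(2)])
  have A: "sub_comm_ring ?A"
    by (rule K.sub_comm_ring_adjs)
  have PA: "submod ?A P"
    using P(1) AB by (auto simp: submod_def)
  have K_noeth: "noeth (range \<phi>) (range \<phi>)"
  proof (rule K.noeth_field)
    fix x assume "x \<in> range \<phi>" "x \<noteq> 0"
    then obtain a where "x = \<phi> a" "a \<noteq> 0"
      using \<phi>.hom_zero by (metis imageE)
    then show "\<exists>y\<in>range \<phi>. y * x = 1"
      by (auto simp flip: \<phi>.hom_mult intro!: exI[of _ "1 / a"])
  qed
  have "\<exists>z n. (\<forall>i<m. z i \<in> ?A) \<and> ?A \<subseteq> adjoin (adjoins (range \<phi>) z m) (y m) \<and>
           y m ^ n \<in> {u + w | u w. u \<in> lincombs (adjoins (range \<phi>) z m) (\<lambda>j. y m ^ j) n \<and> w \<in> P}"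
  proof (cases "y m \<in> P")
    case True
    have "y m ^ 1 \<in> {u + w | u w. u \<in> lincombs (adjoins (range \<phi>) y m) (\<lambda>j. y m ^ j) 1 \<and> w \<in> P}"
      using True submodD(1)[OF sub_comm_ring.submod_lc[OF K.sub_comm_ring_adjs]]
      by (intro CollectI exI[of _ 0] exI[of _ "y m"]) auto
    moreover have "\<forall>i<m. y i \<in> ?A"
      using K.mem_adjs[of _ "Suc m" y] by auto
    ultimately show ?thesis
      by (intro exI[of _ y] exI[of _ 1]) auto
  next
    case False
    then obtain w where w: "w \<in> B" "y m * w - 1 \<in> P"
      using field Suc.prems(1) by blast
    have ym: "y m \<in> ?A"
      by (rule K.mem_adjs) simp
    obtain v where v: "v \<in> ?A" "1 - y m * v \<in> P"
      using inverse_in_subring[OF A AB K.noeth_adjs[OF K_noeth] P(1) Suc.prems(2-4) ym w] by blast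
    then obtain f where f: "f \<in> carrier (poly_ring (Suc m))" "v = peval \<phi> y f"
      using adjs_eq_peval[OF \<phi>(1)] by blast
    interpret R: sub_comm_ring "carrier (poly_ring (Suc m)) :: 'k mpolynomial set"
      by (rule sub_comm_ring_poly_ring)
    define F where "F = 1 - var m * f"
    have "F \<in> carrier (poly_ring (Suc m))"
      unfolding F_def using f(1) by (intro R.diff_mem R.mult_mem R.one_mem var_mem_poly_ring) auto
    moreover have "F \<noteq> 0"
    proof
      interpret ev: rhom "peval (\<lambda>a::'k. a) (\<lambda>_. 0)"
        by (rule rhom_peval[OF rhom_id])
      assume "F = 0"
      moreover have "peval (\<lambda>a::'k. a) (\<lambda>_. 0) F = 1"
        by (simp add: F_def ev.hom_diff ev.hom_mult peval_var[OF rhom_id])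
      ultimately show False by simp
    qed
    moreover have "peval \<phi> y F \<in> P"
    proof -
      interpret ev: rhom "peval \<phi> y"
        by (rule rhom_peval[OF \<phi>(1)])
      show ?thesis
        using v(2) by (simp add: F_def ev.hom_diff ev.hom_mult peval_var[OF \<phi>(1)] f(2))
    qed
    ultimately show ?thesis
      by (rule nagata[OF \<phi>(1) PA])
  qed
  then obtain z n where z: "\<And>i. i < m \<Longrightarrow> z i \<in> ?A" "?A \<subseteq> adjoin (adjoins (range \<phi>) z m) (y m)"
    and mon: "y m ^ n \<in> {u + w | u w. u \<in> lincombs (adjoins (range \<phi>) z m) (\<lambda>j. y m ^ j) n \<and> w \<in> P}"
    by blast
  let ?A' = "adjoins (range \<phi>) z m"
  interpret A': sub_comm_ring ?A' by (rule K.sub_comm_ring_adjs)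
  have zB: "\<And>i. i < m \<Longrightarrow> z i \<in> B"
    using z(1) AB by blast
  have A'B: "?A' \<subseteq> B"
    using zB by (rule adjs_least[OF \<phi>(2)])
  have ymB: "y m \<in> B"
    using Suc.prems(1) by simp
  have "adjoin ?A' (y m) \<subseteq> B"
    using A'B ymB by (rule adj_least)
  then have "submod (adjoin ?A' (y m)) P"
    using P(1) by (auto simp: submod_def)
  then have A_sub: "?A \<subseteq> {u + w | u w. u \<in> lincombs ?A' (\<lambda>j. y m ^ j) n \<and> w \<in> P}"
    using A'.adj_subset_monic[OF _ mon] z(2) by blast
  have PA': "submod ?A' P"
    using P(1) A'B by (auto simp: submod_def)
  define X' where "X' = (\<lambda>(x, j). x * y m ^ j) ` (X \<times> {..<n})"
  define M where "M = {u + p | u p. u \<in> aspan ?A' X' \<and> p \<in> P}"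
  have M_add: "u + v \<in> M" if "u \<in> M" "v \<in> M" for u v
  proof -
    obtain a p b q where *: "u = a + p" "v = b + q" "a \<in> aspan ?A' X'" "b \<in> aspan ?A' X'" "p \<in> P" "q \<in> P"
      using \<open>u \<in> M\<close> \<open>v \<in> M\<close> by (auto simp: M_def)
    have "u + v = (a + b) + (p + q)"
      by (simp add: *)
    then show ?thesis
      unfolding M_def using submodD(2)[OF A'.submod_aspan *(3,4)] submodD(2)[OF P(1) *(5,6)] by blast
  qed
  have gen: "a * x \<in> M" if a: "a \<in> ?A" and x: "x \<in> X" for a x
  proof -
    obtain l p where l: "a = l + p" "l \<in> lincombs ?A' (\<lambda>j. y m ^ j) n" "p \<in> P"
      using A_sub a by blast
    then obtain b where b: "\<forall>j<n. b j \<in> ?A'" "l = (\<Sum>j<n. b j * y m ^ j)"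
      by (auto simp: lincombs_def)
    have "a * x = (\<Sum>j<n. b j * (x * y m ^ j)) + x * p"
      by (simp add: l(1) b(2) distrib_right sum_distrib_right mult.assoc mult.commute[of x])
    moreover have "(\<Sum>j<n. b j * (x * y m ^ j)) \<in> aspan ?A' X'"
    proof (rule submod_sum[OF A'.submod_aspan])
      fix j assume "j \<in> {..<n}"
      then have "x * y m ^ j \<in> aspan ?A' X'"
        using A'.aspan_superset[of X'] x by (force simp: X'_def)
      then show "b j * (x * y m ^ j) \<in> aspan ?A' X'"
        using b(1) \<open>j \<in> {..<n}\<close> submodD(3)[OF A'.submod_aspan, of "b j" "x * y m ^ j"] by auto
    qed
    moreover have "x * p \<in> P"
      using x Suc.prems(3) l(3) by (intro submodD(3)[OF P(1)]) auto
    ultimately show ?thesis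
      unfolding M_def by blast
  qed
  have "u \<in> M" if "u \<in> aspan ?A X" for u
    using that
  proof induction
    case aspan_zero
    then show ?case
      unfolding M_def using submodD(1)[OF A'.submod_aspan] submodD(1)[OF P(1)]
      by (intro CollectI exI[of _ 0]) auto
  next
    case (aspan_step a x r)
    then show ?case
      by (intro M_add gen)
  qed
  moreover have "p \<in> M" if "p \<in> P" for p
    unfolding M_def using submodD(1)[OF A'.submod_aspan] that
    by (intro CollectI exI[of _ 0] exI[of _ p]) auto
  ultimately have "B \<subseteq> M"
    using Suc.prems(4) M_add by blast
  moreover have "finite X'"
    using Suc.prems(2) by (simp add: X'_def)
  moreover have "X' \<subseteq> B"
    using Suc.prems(3) ymB by (auto simp: X'_def)
  ultimately show ?case
    using Suc.IH[of z X', OF zB] unfolding M_def by blast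
qed

section \<open>Cohen--Macaulayness and a fixed system of parameters\<close>

lemma coeff_mgr_eq_lookup:
  fixes f :: "'k::field mpolynomial"
  shows "Poly_Mapping.lookup (coeff (mgr f) (mdeg m)) m = Poly_Mapping.lookup f m"
proof -
  have "Poly_Mapping.lookup (coeff (mgr f) (mdeg m)) m =
     (\<Sum>m'\<in>Poly_Mapping.keys f. if m' = m then Poly_Mapping.lookup f m else 0)"
    unfolding coeff_mgr lookup_sum by (intro sum.cong) (auto simp: lookup_single when_def)
  then show ?thesis
    by (simp add: in_keys_iff)
qed

text \<open>A polynomial of degree at most \<open>t\<close> is given by its coefficients at the exponent vectors with all
  entries at most \<open>t\<close>. This rough bound on the number of monomials has the right order of growth.\<close>

lemma poly_ring_growth:
  fixes t d :: nat
  defines "S \<equiv> {f :: 'k::{field,finite} mpolynomial. f \<in> carrier (poly_ring d) \<and> degree (mgr f) \<le> t}"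
  shows "finite S" "card S \<le> card (UNIV :: 'k set) ^ ((t + 1) ^ d)"
proof -
  define M where "M = {m :: nat \<Rightarrow>\<^sub>0 nat. Poly_Mapping.keys m \<subseteq> {..<d} \<and> (\<forall>i<d. Poly_Mapping.lookup m i \<le> t)}"
  have injM: "inj_on (\<lambda>m. restrict (Poly_Mapping.lookup m) {..<d}) M"
  proof (rule inj_onI)
    fix m m' assume "m \<in> M" "m' \<in> M"
      and eq: "restrict (Poly_Mapping.lookup m) {..<d} = restrict (Poly_Mapping.lookup m') {..<d}"
    show "m = m'"
    proof (rule poly_mapping_eqI)
      fix i
      show "Poly_Mapping.lookup m i = Poly_Mapping.lookup m' i"
      proof (cases "i < d")
        case True
        then show ?thesis
          using fun_cong[OF eq, of i] by simp
      next
        case False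
        then have "i \<notin> Poly_Mapping.keys m" "i \<notin> Poly_Mapping.keys m'"
          using \<open>m \<in> M\<close> \<open>m' \<in> M\<close> by (auto simp: M_def)
        then show ?thesis by (simp add: in_keys_iff)
      qed
    qed
  qed
  have imM: "(\<lambda>m. restrict (Poly_Mapping.lookup m) {..<d}) ` M \<subseteq> PiE {..<d} (\<lambda>_. {..t})"
    by (intro image_subsetI) (simp only: restrict_PiE_iff, auto simp: M_def)
  have fin_box: "finite (PiE {..<d} (\<lambda>_. {..t}))"
    by (intro finite_PiE) auto
  have finM: "finite M"
    using finite_subset[OF imM fin_box] injM by (rule finite_imageD)
  have "card M \<le> card (PiE {..<d} (\<lambda>_. {..t}))"
    using card_inj_on_le[OF injM imM fin_box] .
  then have cardM: "card M \<le> (t + 1) ^ d"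
    by (simp add: card_PiE)
  have keysM: "Poly_Mapping.keys f \<subseteq> M" if f: "f \<in> S" for f
  proof
    fix m assume m: "m \<in> Poly_Mapping.keys f"
    then have keys: "Poly_Mapping.keys m \<subseteq> {..<d}"
      using f by (auto simp: S_def mem_poly_ring)
    have "coeff (mgr f) (mdeg m) \<noteq> 0"
      using coeff_mgr_eq_lookup[of f m] m by (auto simp: in_keys_iff)
    then have "mdeg m \<le> t"
      using f le_degree[of "mgr f" "mdeg m"] by (auto simp: S_def)
    moreover have "Poly_Mapping.lookup m i \<le> mdeg m" for i
    proof (cases "i \<in> Poly_Mapping.keys m")
      case True
      then show ?thesis
        unfolding mdeg_def by (intro member_le_sum) auto
    qed (simp add: in_keys_iff)
    ultimately show "m \<in> M"
      using keys by (auto simp: M_def intro: order_trans)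
  qed
  have inj: "inj_on (\<lambda>f. restrict (Poly_Mapping.lookup f) M) S"
  proof (rule inj_onI)
    fix f g assume "f \<in> S" "g \<in> S" and eq: "restrict (Poly_Mapping.lookup f) M = restrict (Poly_Mapping.lookup g) M"
    show "f = g"
    proof (rule poly_mapping_eqI)
      fix m
      show "Poly_Mapping.lookup f m = Poly_Mapping.lookup g m"
      proof (cases "m \<in> M")
        case True
        then show ?thesis
          using fun_cong[OF eq, of m] by simp
      next
        case False
        then have "m \<notin> Poly_Mapping.keys f" "m \<notin> Poly_Mapping.keys g"
          using keysM \<open>f \<in> S\<close> \<open>g \<in> S\<close> by auto
        then show ?thesis by (simp add: in_keys_iff)
      qed
    qed
  qed
  have im: "(\<lambda>f. restrict (Poly_Mapping.lookup f) M) ` S \<subseteq> PiE M (\<lambda>_. UNIV :: 'k set)"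
    by (intro image_subsetI) (simp only: restrict_PiE_iff, auto)
  have fin: "finite (PiE M (\<lambda>_. UNIV :: 'k set))"
    using finM by (intro finite_PiE) auto
  show "finite S"
    using finite_subset[OF im fin] inj by (rule finite_imageD)
  have "card S \<le> card (PiE M (\<lambda>_. UNIV :: 'k set))"
    using card_inj_on_le[OF inj im fin] .
  also have "\<dots> = card (UNIV :: 'k set) ^ card M"
    using finM by (simp add: card_PiE)
  also have "\<dots> \<le> card (UNIV :: 'k set) ^ ((t + 1) ^ d)"
    using cardM by (intro power_increasing) (auto simp: Suc_le_eq card_gt_0_iff)
  finally show "card S \<le> card (UNIV :: 'k set) ^ ((t + 1) ^ d)" .
qed

locale parameter_algebra = graded_subring mgr B
  for B :: "'k::{field,finite} mpolynomial set" +
  fixes c :: "nat \<Rightarrow> 'k mpolynomial" and e :: "nat \<Rightarrow> nat" and d :: nat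
  assumes const_mem: "range const \<subseteq> B" and polys: "B \<subseteq> carrier (poly_ring d)"
    and param_mem: "\<And>j. j < d \<Longrightarrow> c j \<in> B"
    and param_homogeneous: "\<And>j. j < d \<Longrightarrow> mgr (c j) = monom (c j) (e j)"
    and param_degree: "\<And>j. j < d \<Longrightarrow> e j > 0"
    and noeth_over_params: "noeth (adjoins (range const) c d) B"
begin

lemma params_subset: "adjoins (range const) c d \<subseteq> B"
  using const_mem param_mem by (rule adjs_least)

lemma finite_over_params:
  obtains X where "finite X" "X \<subseteq> B" "B \<subseteq> aspan (adjoins (range const) c d) X"
proof -
  have sub: "submod (adjoins (range const) c d) B"
    using params_subset by (auto simp: submod_def)
  have sc: "sub_comm_ring (adjoins (range const) c d)"
    by (intro sub_comm_ring.sub_comm_ring_adjs rhom.sub_comm_ring_range rhom_const)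
  show ?thesis
    by (rule sub_comm_ring.noeth_finite_generation[OF sc noeth_over_params sub]) (rule that)
qed

definition origin :: "'k mpolynomial set" where
  "origin = {f \<in> B. coeff (mgr f) 0 = 0}"

text \<open>The ring \<open>B\<close> is finite over the parameters \<open>c\<close>, so powers of all elements of \<open>origin\<close> lie in their
  ideal. The condition on \<open>\<delta>\<close> says that it is a unit at the origin.\<close>

theorem params_regular_of_local:
  assumes "\<And>j. j < d \<Longrightarrow> y j \<in> origin" "\<delta> \<in> B" "coeff (mgr \<delta>) 0 = 1" "almost_regular B \<delta> y d"
  shows "almost_regular B 1 c d"
proof -
  obtain X where X: "finite X" "X \<subseteq> B" "B \<subseteq> aspan (adjoins (range const) c d) X"
    by (rule finite_over_params)
  have y: "y j \<in> B" "coeff (mgr (y j)) 0 = 0" if "j < d" for j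
    using assms(1)[OF that] by (auto simp: origin_def)
  have "\<exists>a. y j ^ a \<in> lincombs B c d" if "j < d" for j
  proof (rule power_mem_lc[OF _ const_mem _ _ _ X])
    show "sub_comm_ring (range const :: 'k mpolynomial set)"
      by (intro rhom.sub_comm_ring_range rhom_const)
    show "mgr x = [:x:]" if "x \<in> range const" for x :: "'k mpolynomial"
      using that by (auto simp: mgr_const)
  qed (use y param_mem param_homogeneous that in auto)
  then show ?thesis
    using param_mem param_homogeneous param_degree y assms
    by (intro regular_of_top_forms[of d c e y \<delta> c]) (auto simp: degree_monom_le)
qed

lemma maximal_inverse:
  assumes P: "maximalideal P (ring_on B)" and u: "u \<in> B" "u \<notin> P"
  shows "\<exists>w\<in>B. u * w - 1 \<in> P"
proof -
  interpret P: maximalideal P "ring_on B" by fact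
  have PB: "P \<subseteq> B" "submod B P"
    using P.is_ideal by (auto simp: ideal_ring_on_iff)
  define J where "J = {p + b * u | p b. p \<in> P \<and> b \<in> B}"
  have "submod B J"
    unfolding J_def by (rule submod_adjoin[OF PB(2)])
  moreover have "J \<subseteq> B"
    using PB(1) u(1) by (auto simp: J_def)
  moreover have "P \<subseteq> J"
  proof
    fix p assume "p \<in> P"
    then show "p \<in> J"
      unfolding J_def by (intro CollectI exI[of _ p] exI[of _ 0]) auto
  qed
  moreover have "u \<in> J"
    unfolding J_def using submodD(1)[OF PB(2)] by (intro CollectI exI[of _ 0] exI[of _ 1]) auto
  ultimately have "J = B"
    using P.I_maximal[of J] u(2) by (auto simp: ideal_ring_on_iff)
  then have "1 \<in> J"
    by simp
  then obtain p b where pb: "1 = p + b * u" "p \<in> P" "b \<in> B"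
    by (auto simp: J_def)
  then have "u * b - 1 = - p"
    by (simp add: algebra_simps)
  then show ?thesis
    using pb submod_uminus[OF PB(2)] by metis
qed

text \<open>The residue field is finite, so two powers of \<open>c j\<close> agree modulo \<open>P\<close>, and \<open>P\<close> contains
  \<open>c j ^ Suc N - c j\<close> for some \<open>N > 0\<close>. These elements have powers of the \<open>c j\<close> as top forms.\<close>

lemma regular_sequence_in_maximal:
  assumes reg: "almost_regular B 1 c d" and P: "maximalideal P (ring_on B)"
  shows "\<exists>xs. regular_sequence (ring_on B) xs \<and> set xs \<subseteq> P \<and> length xs = d"
proof -
  interpret R: cring "ring_on B" by (rule cring_ring_on)
  have prime: "prime_in P"
    using R.maximalideal_prime[OF P] by (simp add: primeideal_ring_on_iff)
  note P' = prime_inD[OF prime]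
  obtain X where X: "finite X" "X \<subseteq> B" "B \<subseteq> aspan (adjoins (range const) c d) X"
    by (rule finite_over_params)
  have "B \<subseteq> {u + p | u p. u \<in> aspan (adjoins (range const) c d) X \<and> p \<in> P}"
  proof
    fix b assume "b \<in> B"
    then show "b \<in> {u + p | u p. u \<in> aspan (adjoins (range const) c d) X \<and> p \<in> P}"
      using X(3) submodD(1)[OF P'(1)] by (intro CollectI exI[of _ b] exI[of _ 0]) auto
  qed
  from finite_residue_field[OF rhom_const const_mem P'(1,2) maximal_inverse[OF P] param_mem X(1,2) this]
  obtain T where T: "finite T" "\<And>b. b \<in> B \<Longrightarrow> \<exists>t\<in>T. b - t \<in> P"
    by metis
  have "\<exists>N>0. c j ^ Suc N - c j \<in> P" if j: "j < d" for j
  proof -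
    have cB: "c j \<in> B"
      by (rule param_mem[OF j])
    have "\<forall>n. \<exists>t\<in>T. c j ^ n - t \<in> P"
      using T(2) cB by auto
    then obtain t where t: "\<And>n. t n \<in> T" "\<And>n. c j ^ n - t n \<in> P"
      by metis
    have "\<not> inj t"
      using T(1) t(1) by (meson finite_imageD finite_subset image_subsetI infinite_UNIV_nat)
    then obtain a b where "t a = t b" "a < b"
      unfolding inj_def by (metis linorder_neqE_nat)
    then have "(c j ^ b - t b) - (c j ^ a - t a) \<in> P"
      using t(2) submod_diff[OF P'(1)] by blast
    then have "c j ^ a * (c j ^ (b - a) - 1) \<in> P"
      using \<open>t a = t b\<close> \<open>a < b\<close> by (simp add: algebra_simps flip: power_add)
    then have "c j ^ a \<in> P \<or> c j ^ (b - a) - 1 \<in> P"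
      using P'(4) cB by auto
    moreover have "c j ^ n \<in> P \<Longrightarrow> c j \<in> P" for n
    proof (induction n)
      case (Suc n)
      then show ?case
        using P'(4)[of "c j" "c j ^ n"] cB by auto
    qed (use P'(3) in simp)
    moreover have "c j ^ Suc (b - a) - c j = (c j ^ (b - a) - 1) * c j"
      by (simp add: algebra_simps)
    ultimately have "c j ^ Suc (b - a) - c j \<in> P"
      using submodD(3)[OF P'(1), of "c j ^ (b - a) - 1" "c j"]
        submodD(3)[OF P'(1), of "c j" "c j ^ (b - a) - 1"] cB
      by (auto simp: mult.commute)
    then show ?thesis
      using \<open>a < b\<close> by (intro exI[of _ "b - a"]) auto
  qed
  then obtain N where N: "\<And>j. j < d \<Longrightarrow> N j > 0" "\<And>j. j < d \<Longrightarrow> c j ^ Suc (N j) - c j \<in> P"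
    by metis
  define f where "f j = c j ^ Suc (N j) - c j" for j
  define E where "E j = e j * Suc (N j)" for j
  have mgr_pow: "mgr (c j ^ Suc (N j)) = monom (c j ^ Suc (N j)) (E j)" if "j < d" for j
    unfolding gr_power param_homogeneous[OF that] monom_power E_def ..
  have eE: "e j < E j" if "j < d" for j
    using N(1)[OF that] param_degree[OF that] by (simp add: E_def)
  have f_gr: "mgr (f j) = monom (c j ^ Suc (N j)) (E j) - monom (c j) (e j)" if "j < d" for j
    unfolding f_def gr_diff mgr_pow[OF that] param_homogeneous[OF that] ..
  have "almost_regular B 1 f d"
  proof (rule regular_of_top_forms[of d "\<lambda>j. c j ^ Suc (N j)" E c 1 f])
    show "\<exists>a. c j ^ a \<in> lincombs B (\<lambda>j. c j ^ Suc (N j)) d" if "j < d" for j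
      using lincombs_mem[OF that, of "\<lambda>j. c j ^ Suc (N j)"] by blast
    show "degree (mgr (f j)) \<le> E j" if "j < d" for j
      unfolding f_gr[OF that] using eE[OF that]
      by (intro degree_diff_le degree_monom_le order_trans[OF degree_monom_le]) auto
    show "coeff (mgr (f j)) (E j) = c j ^ Suc (N j)" if "j < d" for j
      unfolding f_gr[OF that] using eE[OF that] by simp
    show "0 < E j" if "j < d" for j
      using eE[OF that] by simp
    show "mgr (c j ^ Suc (N j)) = monom (c j ^ Suc (N j)) (E j)" if "j < d" for j
      by (rule mgr_pow[OF that])
  qed (use param_mem reg in \<open>auto simp: f_def gr_1 simp del: power_Suc\<close>)
  moreover have "lincombs B f d \<subseteq> P"
    unfolding aspan_eq_lc[symmetric] using N(2) by (intro aspan_least[OF P'(1)]) (auto simp: f_def)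
  moreover have "lincombs B f d = lincombs B (\<lambda>i. map f [0..<d] ! i) d"
    by (intro lincombs_cong) simp
  moreover have "almost_regular B 1 f d \<Longrightarrow> almost_regular B 1 (\<lambda>i. map f [0..<d] ! i) d"
  proof -
    have "lincombs B f k = lincombs B (\<lambda>i. map f [0..<d] ! i) k" if "k < d" for k
      using that by (intro lincombs_cong) simp
    then show "almost_regular B 1 f d \<Longrightarrow> almost_regular B 1 (\<lambda>i. map f [0..<d] ! i) d"
      by (simp add: almost_regular_def)
  qed
  ultimately have "regular_sequence (ring_on B) (map f [0..<d])"
    using param_mem P'(3) one_mem by (auto simp: regular_sequence_ring_on_iff f_def)
  moreover have "set (map f [0..<d]) \<subseteq> P"
    using N(2) by (auto simp: f_def)
  ultimately show ?thesis
    by (intro exI[of _ "map f [0..<d]"]) simp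
qed

lemma chain_length_le:
  assumes "\<And>i. i \<le> n \<Longrightarrow> prime_in (Q i)" "\<And>i. i < n \<Longrightarrow> Q i \<subset> Q (Suc i)"
  shows "n \<le> d"
proof (rule prime_chain_length_le[of "card (UNIV :: 'k set)" d n Q])
  fix t
  have sub: "{f \<in> B. degree (mgr f) \<le> t} \<subseteq> {f. f \<in> carrier (poly_ring d) \<and> degree (mgr f) \<le> t}"
    using polys by auto
  show "finite {f \<in> B. degree (mgr f) \<le> t}"
    using finite_subset[OF sub poly_ring_growth(1)] .
  show "card {f \<in> B. degree (mgr f) \<le> t} \<le> card (UNIV :: 'k set) ^ (t + 1) ^ d"
    using card_mono[OF poly_ring_growth(1) sub] poly_ring_growth(2)[of d t] by (rule order_trans)
qed (use assms in auto)

lemma prime_height_ring_on: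
  "prime_height (ring_on B) P =
     (SUP n \<in> {n. \<exists>Q :: nat \<Rightarrow> _. (\<forall>i \<le> n. prime_in (Q i)) \<and> (\<forall>i < n. Q i \<subset> Q (Suc i)) \<and> Q n = P}. enat n)"
  by (simp add: prime_height_def primeideal_ring_on_iff)

text \<open>At each maximal ideal the depth is at least \<open>d\<close>, the height is at most \<open>d\<close>, and depth never
  exceeds height.\<close>

theorem cohen_macaulay_of_regular:
  assumes "almost_regular B 1 c d"
  shows "cohen_macaulay (ring_on B)"
  unfolding cohen_macaulay_def
proof (intro conjI allI impI)
  show "cring (ring_on B)"
    by (rule cring_ring_on)
  then interpret R: cring "ring_on B" .
  show "noetherian_ring (ring_on B)"
    by (rule noetherian_ring_on[OF params_subset noeth_over_params])
  fix P assume P: "maximalideal P (ring_on B)"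
  have prime: "prime_in P"
    using R.maximalideal_prime[OF P] by (simp add: primeideal_ring_on_iff)
  have height_le: "prime_height (ring_on B) P \<le> enat d"
    unfolding prime_height_ring_on
  proof (rule SUP_least)
    fix n assume "n \<in> {n. \<exists>Q :: nat \<Rightarrow> _. (\<forall>i\<le>n. prime_in (Q i)) \<and> (\<forall>i<n. Q i \<subset> Q (Suc i)) \<and> Q n = P}"
    then obtain Q :: "nat \<Rightarrow> 'k mpolynomial set"
      where "\<forall>i\<le>n. prime_in (Q i)" "\<forall>i<n. Q i \<subset> Q (Suc i)"
      by blast
    then have "n \<le> d"
      by (intro chain_length_le[of n Q]) blast+
    then show "enat n \<le> enat d"
      by simp
  qed
  have depth_ge: "enat d \<le> ideal_depth (ring_on B) P"
    using regular_sequence_in_maximal[OF assms P] unfolding ideal_depth_def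
    by (auto intro!: SUP_upper2)
  have depth_le: "ideal_depth (ring_on B) P \<le> prime_height (ring_on B) P"
    unfolding ideal_depth_def
  proof (rule SUP_least)
    fix xs assume "xs \<in> {xs. regular_sequence (ring_on B) xs \<and> set xs \<subseteq> P}"
    then have xs: "almost_regular B 1 (\<lambda>i. xs ! i) (length xs)" "set xs \<subseteq> P"
      by (auto simp: regular_sequence_ring_on_iff)
    then have "\<exists>Q :: nat \<Rightarrow> _. (\<forall>i\<le>length xs. prime_in (Q i)) \<and> (\<forall>i<length xs. Q i \<subset> Q (Suc i)) \<and> Q (length xs) = P"
      by (intro prime_chain_of_regular[OF xs(1) _ prime]) auto
    then show "enat (length xs) \<le> prime_height (ring_on B) P"
      unfolding prime_height_ring_on by (intro SUP_upper) auto
  qed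
  show "ideal_depth (ring_on B) P = prime_height (ring_on B) P"
    using height_le depth_ge depth_le by order
qed

lemma maximal_origin: "maximalideal origin (ring_on B)"
proof -
  have const_coeff: "coeff (mgr (f * g)) 0 = coeff (mgr f) 0 * coeff (mgr g) 0" for f g :: "'k mpolynomial"
    by (simp add: gr_mult coeff_mult_0)
  have origin: "submod B origin" "origin \<subseteq> B" "1 \<notin> origin"
    by (auto simp: submod_def origin_def gr_0 gr_add gr_1 const_coeff)
  have const_term: "\<exists>a. coeff (mgr f) 0 = const a" for f :: "'k mpolynomial"
  proof -
    have "m = 0" if "mdeg m = 0" for m
      using that by (intro poly_mapping_eqI) (auto simp: mdeg_def in_keys_iff)
    moreover have "mdeg 0 = 0"
      by (simp add: mdeg_def)
    ultimately have "coeff (mgr f) 0 = (\<Sum>m\<in>Poly_Mapping.keys f. if m = 0 then const (Poly_Mapping.lookup f 0) else 0)"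
      unfolding coeff_mgr by (intro sum.cong) auto
    then show ?thesis
      by (auto simp: in_keys_iff intro: exI[of _ 0])
  qed
  show ?thesis
  proof (rule maximalidealI)
    show "ideal origin (ring_on B)"
      using origin by (simp add: ideal_ring_on_iff)
    show "carrier (ring_on B) \<noteq> origin"
      using origin(3) one_mem by auto
    fix J assume "ideal J (ring_on B)" and OJ: "origin \<subseteq> J" and "J \<subseteq> carrier (ring_on B)"
    then have J: "J \<subseteq> B" "submod B J"
      by (auto simp: ideal_ring_on_iff)
    show "J = origin \<or> J = carrier (ring_on B)"
    proof (cases "J \<subseteq> origin")
      case False
      then obtain f where f: "f \<in> J" "f \<in> B" "coeff (mgr f) 0 \<noteq> 0"
        using J(1) by (auto simp: origin_def)
      obtain a where a: "coeff (mgr f) 0 = const a"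
        using const_term by blast
      have "a \<noteq> 0"
        using f(3) a by auto
      have aB: "const a \<in> B" "const (1 / a) \<in> B"
        using const_mem by auto
      have "const a - f \<in> origin"
        using f(2) a aB by (simp add: origin_def gr_diff mgr_const)
      then have "f + (const a - f) \<in> J"
        using f(1) OJ by (intro submodD(2)[OF J(2)]) auto
      then have "const (1 / a) * const a \<in> J"
        using aB by (intro submodD(3)[OF J(2)]) auto
      then have "1 \<in> J"
        using \<open>a \<noteq> 0\<close> by (simp add: mult_single)
      then show ?thesis
        using proper_iff_one[OF J(2,1)] by auto
    qed (use OJ in auto)
  qed
qed

text \<open>The chain \<open>Q\<close> shows that \<open>origin\<close> has height, and so depth, at least \<open>d\<close>.\<close>

theorem regular_of_cohen_macaulay:
  assumes cm: "cohen_macaulay (ring_on B)"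
    and Q: "\<And>i. i \<le> d \<Longrightarrow> prime_in (Q i)" "\<And>i. i < d \<Longrightarrow> Q i \<subset> Q (Suc i)" "Q d = origin"
  shows "almost_regular B 1 c d"
proof (cases d)
  case 0
  then show ?thesis
    by (simp add: almost_regular_def)
next
  case (Suc d')
  have "enat d \<le> prime_height (ring_on B) origin"
    unfolding prime_height_ring_on using Q by (intro SUP_upper) auto
  also have "\<dots> = ideal_depth (ring_on B) origin"
    using cm maximal_origin by (simp add: cohen_macaulay_def)
  finally have "enat d' < ideal_depth (ring_on B) origin"
    using Suc by (metis Suc_ile_eq)
  then obtain xs where xs: "regular_sequence (ring_on B) xs" "set xs \<subseteq> origin" "d' < length xs"
    unfolding ideal_depth_def less_SUP_iff by auto
  have "almost_regular B 1 (\<lambda>i. xs ! i) d"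
    using xs(1,3) Suc by (auto simp: regular_sequence_ring_on_iff almost_regular_def)
  then show ?thesis
    using xs(2,3) Suc by (intro params_regular_of_local[of "\<lambda>i. xs ! i" 1]) (auto simp: gr_1)
qed

end

section \<open>Linear polynomials over finite fields\<close>

lemma power_card_finite_field: "(x :: 'k::{field,finite}) ^ card (UNIV :: 'k set) = x"
proof (cases "x = 0")
  case False
  let ?U = "UNIV - {0 :: 'k}"
  have bij: "bij_betw ((*) x) ?U ?U"
    by (rule bij_betwI[where g = "\<lambda>y. y / x"]) (use False in auto)
  have "(\<Prod>y\<in>?U. y) = (\<Prod>y\<in>?U. x * y)"
    by (rule prod.reindex_bij_betw[OF bij, symmetric])
  also have "\<dots> = x ^ card ?U * (\<Prod>y\<in>?U. y)"
    by (simp add: prod.distrib)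
  finally have "x ^ card ?U = 1"
    by (simp add: prod_zero_iff)
  moreover have "card (UNIV :: 'k set) = Suc (card ?U)"
    by (metis UNIV_I card.remove finite)
  ultimately show ?thesis
    by (simp only: power_Suc mult_1_right)
qed (simp add: card_gt_0_iff power_0_left)

lemma card_finite_field_gt_1: "card (UNIV :: 'k::{field,finite} set) > 1"
proof -
  have "card {0, 1 :: 'k} \<le> card (UNIV :: 'k set)"
    by (intro card_mono) auto
  then show ?thesis by simp
qed

locale field_hom = rhom \<phi>
  for \<phi> :: "'k::{field,finite} \<Rightarrow> 'r::idom" +
  fixes q :: nat
  assumes card_field: "card (UNIV :: 'k set) = q"
begin

lemma q1: "q > 1"
  using card_finite_field_gt_1[where ?'k = 'k] by (simp add: card_field)

lemma power_q: "(a :: 'k) ^ q = a"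
  using power_card_finite_field[of a] by (simp add: card_field)

lemma hom_inj: "inj \<phi>"
proof (rule injI)
  fix a b assume "\<phi> a = \<phi> b"
  then have "\<phi> (a - b) = 0"
    by (simp add: hom_diff)
  then have "\<phi> ((1 / (a - b)) * (a - b)) = 0"
    by (simp only: hom_mult mult_zero_right)
  then show "a = b"
    by (cases "a = b") auto
qed

text \<open>For \<open>z \<noteq> 0\<close> both sides are monic polynomials in \<open>y\<close> of degree \<open>q\<close>, and they share the \<open>q\<close> roots
  \<open>- \<phi> b * z\<close>.\<close>

lemma prod_scalars: "(\<Prod>b\<in>UNIV. y + \<phi> b * z) = y ^ q - z ^ (q - 1) * y"
proof (cases "z = 0")
  case True
  then show ?thesis
    using q1 by (simp add: power_0_left card_field)
next
  case False
  define P where "P = (\<Prod>b\<in>UNIV. [:\<phi> b * z, 1:])"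
  define Q where "Q = monom 1 q - [:0, z ^ (q - 1):]"
  have degP: "degree P = q"
    unfolding P_def by (subst degree_prod_eq_sum_degree) (auto simp: card_field)
  have "lead_coeff P = 1"
    unfolding P_def by (subst lead_coeff_prod) simp
  have small: "degree [:0, z ^ (q - 1):] < q"
    using q1 by (simp add: degree_pCons_eq_if)
  have "coeff (P - Q) n = 0" if "n \<ge> q" for n
  proof (cases "n = q")
    case True
    then show ?thesis
      using \<open>lead_coeff P = 1\<close> small by (simp add: degP Q_def coeff_eq_0)
  next
    case False
    then show ?thesis
      using that degP small by (simp add: Q_def coeff_eq_0)
  qed
  then have deg: "degree (P - Q) < q" if "P \<noteq> Q"
    using that by (metis eq_iff_diff_eq_0 leading_coeff_0_iff not_less)
  have "poly (P - Q) (- \<phi> b * z) = 0" for b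
  proof -
    have "poly P (- \<phi> b * z) = 0"
      unfolding P_def poly_prod by (rule prod_zero) (auto intro: bexI[of _ b])
    moreover have "z ^ q = z ^ (q - 1) * z"
      using q1 by (metis One_nat_def Suc_pred less_trans power_Suc2 zero_less_one)
    then have "(- \<phi> b * z) ^ q = z ^ (q - 1) * (- \<phi> b * z)"
      using hom_power[of "- b" q] by (simp add: power_mult_distrib power_q mult.commute flip: hom_uminus)
    then have "poly Q (- \<phi> b * z) = 0"
      by (simp add: Q_def poly_monom mult.commute)
    ultimately show ?thesis
      by simp
  qed
  then have "range (\<lambda>b. - \<phi> b * z) \<subseteq> {x. poly (P - Q) x = 0}"
    by auto
  moreover have "card (range (\<lambda>b. - \<phi> b * z)) = q"
    unfolding card_field[symmetric] using False hom_inj by (intro card_image injI) (auto dest: injD)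
  ultimately have "P = Q"
  proof (intro ccontr[of "P = Q"])
    assume "P \<noteq> Q"
    then have "q \<le> degree (P - Q)"
      using card_mono[OF poly_roots_finite[of "P - Q"] \<open>range _ \<subseteq> _\<close>] card_poly_roots_bound[of "P - Q"]
        \<open>card _ = q\<close> by simp
    with deg[OF \<open>P \<noteq> Q\<close>] show False
      by simp
  qed
  then have "poly P y = poly Q y"
    by simp
  then show ?thesis
    by (simp add: P_def Q_def poly_prod poly_monom add.commute mult.commute)
qed

text \<open>The difference of the two sides is, as a polynomial in \<open>x\<close>, of degree less than \<open>q\<close>, and it
  vanishes on the ground field, because \<open>y ^ q - y\<close>, a product over the ground field, is unchanged
  when an element of that field is added to \<open>y\<close>.\<close>

lemma frobenius_add:
  fixes x y :: 'r
  shows "(x + y) ^ q = x ^ q + y ^ q"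
proof -
  have shift: "(\<phi> a + y) ^ q = \<phi> a + y ^ q" for a
  proof -
    have "(\<Prod>b\<in>UNIV. (\<phi> a + y) + \<phi> b) = (\<Prod>b\<in>UNIV. y + \<phi> b)"
      by (rule prod.reindex_bij_witness[of _ "\<lambda>b. b - a" "\<lambda>b. b + a"]) (auto simp: hom_add algebra_simps)
    then have "(\<phi> a + y) ^ q - (\<phi> a + y) = y ^ q - y"
      using prod_scalars[of "\<phi> a + y" 1] prod_scalars[of y 1] by simp
    then show ?thesis
      by (simp add: algebra_simps)
  qed
  define P where "P = [:y, 1:] ^ q - monom 1 q - [:y ^ q:]"
  have "coeff P n = 0" if "n \<ge> q" for n
  proof -
    have d: "degree ([:y, 1:] ^ q) = q"
      by (simp add: degree_power_eq)
    have "coeff ([:y, 1:] ^ q) q = 1"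
      using lead_coeff_power[of "[:y, 1:]" q] d by simp
    then show ?thesis
      using that q1 d by (cases "n = q") (auto simp: P_def coeff_pCons coeff_eq_0 split: nat.splits)
  qed
  then have deg: "degree P < q" if "P \<noteq> 0"
    using that by (metis leading_coeff_0_iff not_less)
  have "poly P (\<phi> a) = 0" for a
    using shift[of a] hom_power[of a q]
    by (simp add: P_def poly_monom power_q add.commute)
  then have "range \<phi> \<subseteq> {x. poly P x = 0}"
    by auto
  moreover have "card (range \<phi>) = q"
    unfolding card_field[symmetric] using hom_inj by (rule card_image)
  ultimately have "P = 0"
    using deg card_poly_roots_bound[of P] poly_roots_finite[of P]
    by (metis card_mono leD le_trans)
  then have "poly P x = 0"
    by simp
  then show ?thesis
    by (simp add: P_def poly_monom algebra_simps)
qed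

lemma frobenius_add_iterate:
  fixes x y :: 'r
  shows "(x + y) ^ (q ^ i) = x ^ (q ^ i) + y ^ (q ^ i)"
proof (induction i)
  case (Suc i)
  then show ?case
    by (simp only: power_Suc2[of q] power_mult frobenius_add)
qed simp

lemma frobenius_sum:
  fixes f :: "'b \<Rightarrow> 'r"
  shows "(\<Sum>i\<in>I. f i) ^ q = (\<Sum>i\<in>I. f i ^ q)"
proof -
  have "(0 :: 'r) ^ q = 0"
    using q1 by (simp add: power_0_left)
  then show ?thesis
    by (induction I rule: infinite_finite_induct) (simp_all add: frobenius_add)
qed

lemma hom_frobenius_iterate: "\<phi> a ^ (q ^ i) = \<phi> a"
proof (induction i)
  case (Suc i)
  then show ?case
    by (simp only: power_Suc2[of q] power_mult hom_power[symmetric] power_q)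
qed simp

text \<open>Adjoining one element \<open>u n\<close> to the span of \<open>u 0, \<dots>, u (n - 1)\<close> turns the product \<open>L\<close> into
  \<open>\<Prod>b. L (x + b * u n) = L x ^ q - L (u n) ^ (q - 1) * L x\<close>, because \<open>L\<close> is linear over the
  ground field.\<close>

lemma prod_span_linearized:
  assumes C: "sub_comm_ring C" "range \<phi> \<subseteq> C" "\<And>i. i < n \<Longrightarrow> u i \<in> C"
  shows "\<exists>t. (\<forall>i. t i \<in> C) \<and>
    (\<forall>x. (\<Prod>a\<in>PiE {..<n} (\<lambda>_. UNIV). x + (\<Sum>i<n. \<phi> (a i) * u i)) = (\<Sum>i\<le>n. t i * x ^ (q ^ i)))"
  using C(3)
proof (induction n)
  case 0
  then show ?case
    using sub_comm_ring.one_mem[OF C(1)] by (intro exI[of _ "\<lambda>_. 1"]) simp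
next
  case (Suc n)
  interpret C: sub_comm_ring C by (fact C(1))
  obtain t where tC: "\<And>i. t i \<in> C" and
    t: "\<And>x. (\<Prod>a\<in>PiE {..<n} (\<lambda>_. UNIV). x + (\<Sum>i<n. \<phi> (a i) * u i)) = (\<Sum>i\<le>n. t i * x ^ (q ^ i))"
    using Suc by auto
  define L where "L x = (\<Sum>i\<le>n. t i * x ^ (q ^ i))" for x
  have L_add: "L (x + y) = L x + L y" for x y
    by (simp add: L_def frobenius_add_iterate distrib_left sum.distrib)
  have L_scale: "L (\<phi> b * x) = \<phi> b * L x" for b x
    by (simp add: L_def power_mult_distrib hom_frobenius_iterate sum_distrib_left mult_ac)
  have step: "(\<Prod>a\<in>PiE {..<Suc n} (\<lambda>_. UNIV). x + (\<Sum>i<Suc n. \<phi> (a i) * u i)) =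
      L x ^ q - L (u n) ^ (q - 1) * L x" for x
  proof -
    have "PiE {..<Suc n} (\<lambda>_. UNIV :: 'k set) = (\<lambda>(b, a). a(n := b)) ` (UNIV \<times> PiE {..<n} (\<lambda>_. UNIV))"
      by (simp add: lessThan_Suc PiE_insert_eq)
    moreover have "inj_on (\<lambda>(b, a). a(n := b)) (UNIV \<times> PiE {..<n} (\<lambda>_. UNIV :: 'k set))"
      by (rule inj_combinator[of n "{..<n}" "\<lambda>_. UNIV"]) simp
    ultimately have "(\<Prod>a\<in>PiE {..<Suc n} (\<lambda>_. UNIV). x + (\<Sum>i<Suc n. \<phi> (a i) * u i)) =
      (\<Prod>(b, a)\<in>UNIV \<times> PiE {..<n} (\<lambda>_. UNIV). x + (\<Sum>i<Suc n. \<phi> ((a(n := b)) i) * u i))"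
      by (simp add: prod.reindex case_prod_unfold)
    also have "\<dots> = (\<Prod>b\<in>UNIV. \<Prod>a\<in>PiE {..<n} (\<lambda>_. UNIV). (x + \<phi> b * u n) + (\<Sum>i<n. \<phi> (a i) * u i))"
      unfolding prod.cartesian_product[symmetric]
      by (intro prod.cong refl) (simp add: algebra_simps)
    also have "\<dots> = (\<Prod>b\<in>UNIV. L x + \<phi> b * L (u n))"
      by (simp only: t L_def[symmetric] L_add L_scale)
    finally show ?thesis
      by (simp only: prod_scalars)
  qed
  have LC: "L (u n) \<in> C"
    unfolding L_def using tC Suc.prems by (intro C.sum_mem C.mult_mem C.power_mem) auto
  define t' where "t' i = (case i of 0 \<Rightarrow> 0 | Suc j \<Rightarrow> t j ^ q) - L (u n) ^ (q - 1) * (if i \<le> n then t i else 0)" for i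
  have "t' i \<in> C" for i
    using tC LC by (auto simp: t'_def split: nat.splits)
  moreover have "L x ^ q - L (u n) ^ (q - 1) * L x = (\<Sum>i\<le>Suc n. t' i * x ^ (q ^ i))" for x
  proof -
    have "L x ^ q = (\<Sum>i\<le>n. t i ^ q * x ^ (q ^ Suc i))"
      by (simp add: L_def frobenius_sum power_mult_distrib mult.commute[of q] flip: power_mult)
    also have "\<dots> = (\<Sum>i\<le>Suc n. (case i of 0 \<Rightarrow> 0 | Suc j \<Rightarrow> t j ^ q) * x ^ (q ^ i))"
      by (simp add: sum.atMost_Suc_shift del: sum.atMost_Suc)
    finally have 1: "L x ^ q = (\<Sum>i\<le>Suc n. (case i of 0 \<Rightarrow> 0 | Suc j \<Rightarrow> t j ^ q) * x ^ (q ^ i))" .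
    have 2: "L x = (\<Sum>i\<le>Suc n. (if i \<le> n then t i else 0) * x ^ (q ^ i))"
      by (simp add: L_def)
    show ?thesis
      unfolding t'_def left_diff_distrib sum_subtractf 1[symmetric] mult.assoc sum_distrib_left[symmetric] 2[symmetric] ..
  qed
  ultimately show ?case
    using step by (intro exI[of _ t']) auto
qed

end

section \<open>The Dickson polynomials as parameters\<close>

lemma coeffs_prod_mem:
  assumes "sub_comm_ring C" "\<And>i. i \<in> I \<Longrightarrow> l i \<in> C"
  shows "coeff (\<Prod>i\<in>I. [:l i, 1:]) n \<in> C"
proof -
  interpret sub_comm_ring C by fact
  have "\<forall>n. coeff (\<Prod>i\<in>I. [:l i, 1:]) n \<in> C"
    using assms(2)
  proof (induction I rule: infinite_finite_induct)
    case (insert i I)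
    then show ?case
      by (auto simp: coeff_pCons split: nat.splits)
  qed (auto simp: coeff_pCons one_pCons split: nat.splits)
  then show ?thesis ..
qed

text \<open>The product is homogeneous of degree \<open>card I\<close> if the polynomial variable gets degree \<open>1\<close>.\<close>

lemma (in grading) gr_coeff_prod:
  assumes "finite I" "\<And>i. i \<in> I \<Longrightarrow> gr (l i) = monom (l i) 1" "n \<le> card I"
  shows "gr (coeff (\<Prod>i\<in>I. [:l i, 1:]) n) = monom (coeff (\<Prod>i\<in>I. [:l i, 1:]) n) (card I - n)"
  using assms
proof (induction I arbitrary: n rule: finite_induct)
  case empty
  then show ?case
    by (simp add: gr_1 monom_0 one_pCons)
next
  case (insert i I)
  let ?P = "\<Prod>i\<in>I. [:l i, 1:]"
  have high: "coeff ?P m = 0" if "m > card I" for m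
  proof -
    have "degree ?P \<le> (\<Sum>i\<in>I. degree [:l i, 1:])"
      by (rule degree_prod_sum_le[OF insert.hyps(1), unfolded o_def])
    then show ?thesis
      using that by (intro coeff_eq_0) simp
  qed
  have IH: "gr (coeff ?P m) = monom (coeff ?P m) (card I - m)" for m
    using insert.IH[of m] insert.prems(1) high[of m] by (cases "m \<le> card I") (auto simp: gr_0)
  have eq: "coeff (\<Prod>i\<in>insert i I. [:l i, 1:]) n = l i * coeff ?P n + (case n of 0 \<Rightarrow> 0 | Suc m \<Rightarrow> coeff ?P m)"
    using insert.hyps by (simp add: coeff_pCons split: nat.splits)
  have "gr (l i * coeff ?P n) = monom (l i * coeff ?P n) (card (insert i I) - n)"
  proof (cases "n \<le> card I")
    case True
    then show ?thesis
      using insert.hyps insert.prems by (simp add: gr_mult IH mult_monom Suc_diff_le)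
  qed (simp add: high gr_0)
  moreover have "gr (case n of 0 \<Rightarrow> 0 | Suc m \<Rightarrow> coeff ?P m) =
      monom (case n of 0 \<Rightarrow> 0 | Suc m \<Rightarrow> coeff ?P m) (card (insert i I) - n)"
    using insert.hyps by (cases n) (auto simp: gr_0 IH)
  ultimately show ?case
    unfolding eq by (simp add: gr_add add_monom)
qed

locale finite_space =
  fixes scale :: "'k::{field,finite} \<Rightarrow> 'v::ab_group_add \<Rightarrow> 'v" and d :: nat and e :: "nat \<Rightarrow> 'v"
    and q :: nat
  assumes vs: "vector_space scale" and basis: "ordered_basis scale d e"
    and card_field: "card (UNIV :: 'k set) = q"
begin

lemma q1: "q > 1"
  using card_finite_field_gt_1[where ?'k = 'k] by (simp add: card_field)

sublocale V: vector_space scale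
  by (rule vs)

abbreviation coord :: "nat \<Rightarrow> 'v \<Rightarrow> 'k" where "coord \<equiv> coordinate scale d e"

abbreviation dual :: "('v \<Rightarrow> 'k) set" where "dual \<equiv> dual_space scale"

abbreviation lf :: "('v \<Rightarrow> 'k) \<Rightarrow> 'k mpolynomial" where "lf \<equiv> linear_form d e"

lemma basis_facts:
  "inj_on e {..<d}" "V.independent (e ` {..<d})" "V.span (e ` {..<d}) = UNIV"
  using basis by (auto simp: ordered_basis_def)

lemma mem_dual: "\<phi> \<in> dual \<longleftrightarrow> (\<forall>x y. \<phi> (x + y) = \<phi> x + \<phi> y) \<and> (\<forall>a x. \<phi> (scale a x) = a * \<phi> x)"
proof -
  have "vector_space ((*) :: 'k \<Rightarrow> 'k \<Rightarrow> 'k)"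
    by unfold_locales (auto simp: algebra_simps)
  then show ?thesis
    using vs by (simp add: dual_space_def Vector_Spaces.linear_iff)
qed

lemma dual_zero: "\<phi> \<in> dual \<Longrightarrow> \<phi> 0 = 0"
  using V.scale_zero_left[of 0] by (metis mem_dual mult_zero_left)

lemma dual_sum: "\<phi> \<in> dual \<Longrightarrow> \<phi> (\<Sum>i\<in>I. f i) = (\<Sum>i\<in>I. \<phi> (f i))"
  by (induction I rule: infinite_finite_induct) (auto simp: mem_dual dual_zero)

lemma coord_dual: "coord i \<in> dual"
  unfolding mem_dual coordinate_def
  using basis_facts by (auto simp: V.representation_add V.representation_scale)

lemma coord_basis: "i < d \<Longrightarrow> j < d \<Longrightarrow> coord i (e j) = (if i = j then 1 else 0)"
  using basis_facts(1) by (auto simp: coordinate_def V.representation_basis[OF basis_facts(2)] inj_on_def)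

lemma coord_expansion: "(\<Sum>i<d. scale (coord i v) (e i)) = v"
proof -
  have "(\<Sum>b\<in>e ` {..<d}. scale (V.representation (e ` {..<d}) v b) b) = v"
    using basis_facts by (intro V.sum_representation_eq) auto
  then show ?thesis
    using basis_facts(1) by (simp add: sum.reindex coordinate_def)
qed

lemma dual_expansion:
  assumes "\<phi> \<in> dual"
  shows "\<phi> v = (\<Sum>i<d. \<phi> (e i) * coord i v)"
proof -
  have "\<phi> v = \<phi> (\<Sum>i<d. scale (coord i v) (e i))"
    by (simp add: coord_expansion)
  also have "\<dots> = (\<Sum>i<d. \<phi> (e i) * coord i v)"
    using assms by (simp add: dual_sum) (simp add: mem_dual mult.commute)
  finally show ?thesis .
qed

lemma dual_bij: "bij_betw (\<lambda>\<phi>. restrict (\<lambda>i. \<phi> (e i)) {..<d}) dual (PiE {..<d} (\<lambda>_. UNIV))"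
proof (rule bij_betwI[where g = "\<lambda>a v. \<Sum>i<d. a i * coord i v"])
  show "(\<lambda>\<phi>. restrict (\<lambda>i. \<phi> (e i)) {..<d}) \<in> dual \<rightarrow> PiE {..<d} (\<lambda>_. UNIV)"
    by (intro funcsetI) (simp only: restrict_PiE_iff, simp)
  show "(\<lambda>a v. \<Sum>i<d. a i * coord i v) \<in> PiE {..<d} (\<lambda>_. UNIV) \<rightarrow> dual"
  proof (intro funcsetI)
    fix a :: "nat \<Rightarrow> 'k"
    have "coord i (x + y) = coord i x + coord i y" "coord i (scale b x) = b * coord i x" for i x y b
      using coord_dual[of i] by (simp_all add: mem_dual)
    then show "(\<lambda>v. \<Sum>i<d. a i * coord i v) \<in> dual"
      by (simp add: mem_dual distrib_left sum.distrib sum_distrib_left mult.left_commute)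
  qed
  show "(\<lambda>v. \<Sum>i<d. restrict (\<lambda>i. \<phi> (e i)) {..<d} i * coord i v) = \<phi>" if "\<phi> \<in> dual" for \<phi>
    by (intro ext) (simp flip: dual_expansion[OF that])
  show "restrict (\<lambda>j. \<Sum>i<d. a i * coord i (e j)) {..<d} = a" if "a \<in> PiE {..<d} (\<lambda>_. UNIV)" for a
  proof
    fix j
    show "restrict (\<lambda>j. \<Sum>i<d. a i * coord i (e j)) {..<d} j = a j"
    proof (cases "j < d")
      case True
      then have "(\<Sum>i<d. a i * coord i (e j)) = (\<Sum>i<d. if i = j then a i else 0)"
        by (intro sum.cong) (auto simp: coord_basis)
      then show ?thesis
        using True by simp
    next
      case False
      then show ?thesis
        using that by (auto simp: PiE_def extensional_def)
    qed
  qed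
qed

lemma finite_dual: "finite dual" and card_dual: "card dual = q ^ d"
proof -
  have fin: "finite (PiE {..<d} (\<lambda>_. UNIV :: 'k set))"
    by (intro finite_PiE) auto
  show "finite dual"
    using bij_betw_finite[OF dual_bij] fin by simp
  show "card dual = q ^ d"
    using bij_betw_same_card[OF dual_bij] by (simp add: card_PiE card_field)
qed

lemma vector_bij: "bij_betw (\<lambda>v. restrict (\<lambda>i. coord i v) {..<d}) UNIV (PiE {..<d} (\<lambda>_. UNIV))"
proof (rule bij_betwI[where g = "\<lambda>a. \<Sum>i<d. scale (a i) (e i)"])
  show "(\<lambda>v. restrict (\<lambda>i. coord i v) {..<d}) \<in> UNIV \<rightarrow> PiE {..<d} (\<lambda>_. UNIV)"
    by (intro funcsetI) (simp only: restrict_PiE_iff, simp)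
  show "(\<Sum>i<d. scale (restrict (\<lambda>i. coord i v) {..<d} i) (e i)) = v" for v
    using coord_expansion[of v] by simp
  show "restrict (\<lambda>j. coord j (\<Sum>i<d. scale (a i) (e i))) {..<d} = a" if "a \<in> PiE {..<d} (\<lambda>_. UNIV)" for a
  proof
    fix j
    show "restrict (\<lambda>j. coord j (\<Sum>i<d. scale (a i) (e i))) {..<d} j = a j"
    proof (cases "j < d")
      case True
      have "coord j (\<Sum>i<d. scale (a i) (e i)) = (\<Sum>i<d. a i * coord j (e i))"
        using coord_dual[of j] by (simp add: dual_sum) (simp add: mem_dual)
      also have "\<dots> = (\<Sum>i<d. if i = j then a i else 0)"
        using True by (intro sum.cong) (auto simp: coord_basis)
      finally show ?thesis
        using True by simp
    next
      case False
      then show ?thesis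
        using that by (auto simp: PiE_def extensional_def)
    qed
  qed
qed auto

lemma finite_V: "finite (UNIV :: 'v set)" and card_V: "card (UNIV :: 'v set) = q ^ d"
proof -
  have fin: "finite (PiE {..<d} (\<lambda>_. UNIV :: 'k set))"
    by (intro finite_PiE) auto
  show "finite (UNIV :: 'v set)"
    using bij_betw_finite[OF vector_bij] fin by simp
  show "card (UNIV :: 'v set) = q ^ d"
    using bij_betw_same_card[OF vector_bij] by (simp add: card_PiE card_field)
qed

lemma coord_inject:
  assumes "\<And>i. i < d \<Longrightarrow> coord i v = coord i w"
  shows "v = w"
proof -
  have "(\<Sum>i<d. scale (coord i v) (e i)) = (\<Sum>i<d. scale (coord i w) (e i))"
    by (intro sum.cong) (simp_all add: assms)
  then show ?thesis
    by (simp only: coord_expansion)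
qed

lemma lf_eq: "lf \<phi> = (\<Sum>j<d. const (\<phi> (e j)) * var j)"
  by (simp add: linear_form_def var_def mult_single)

lemma lf_coord: "i < d \<Longrightarrow> lf (coord i) = var i"
proof -
  assume "i < d"
  then have "lf (coord i) = (\<Sum>j<d. if j = i then var j else 0)"
    unfolding lf_eq by (intro sum.cong) (auto simp: coord_basis)
  then show ?thesis
    using \<open>i < d\<close> by simp
qed

lemma lf_mem: "lf \<phi> \<in> carrier (poly_ring d)"
proof -
  interpret R: sub_comm_ring "carrier (poly_ring d) :: 'k mpolynomial set"
    by (rule sub_comm_ring_poly_ring)
  show ?thesis
    unfolding lf_eq by (intro R.sum_mem R.mult_mem const_mem_poly_ring var_mem_poly_ring) auto
qed

lemma mgr_lf: "mgr (lf \<phi>) = monom (lf \<phi>) 1"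
proof -
  interpret rhom "mgr :: 'k mpolynomial \<Rightarrow> _" by (rule rhom_mgr)
  have "mgr (lf \<phi>) = (\<Sum>j<d. monom (const (\<phi> (e j)) * var j) 1)"
    unfolding lf_eq hom_sum hom_mult mgr_const mgr_var by (simp add: smult_monom)
  then show ?thesis
    unfolding lf_eq by (intro poly_eqI) (simp add: coeff_sum)
qed

definition orbit_poly :: "'k mpolynomial poly" where
  "orbit_poly = (\<Prod>\<phi>\<in>dual. [:lf \<phi>, 1:])"

lemma orbit_poly_monic: "coeff orbit_poly (q ^ d) = 1" "degree orbit_poly = q ^ d"
proof -
  show deg: "degree orbit_poly = q ^ d"
    unfolding orbit_poly_def by (subst degree_prod_eq_sum_degree) (auto simp: card_dual)
  have "lead_coeff orbit_poly = 1"
    unfolding orbit_poly_def by (subst lead_coeff_prod) simp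
  then show "coeff orbit_poly (q ^ d) = 1"
    by (simp add: deg)
qed

text \<open>The span computation is carried out in the ring of polynomials in \<open>X\<close>, with \<open>x = X\<close> and
  coefficients among the constants of that ring.\<close>

lemma orbit_poly_linearized:
  assumes "coeff orbit_poly n \<noteq> 0"
  shows "\<exists>i\<le>d. n = q ^ i"
proof -
  let ?\<phi> = "\<lambda>a :: 'k. [:const a:] :: 'k mpolynomial poly"
  interpret h: field_hom ?\<phi> q
    by unfold_locales (auto simp: single_add mult_single one_pCons mult.commute card_field)
  define C where "C = range (\<lambda>s :: 'k mpolynomial. [:s:])"
  have C: "sub_comm_ring C"
  proof
    show "1 \<in> C"
      by (auto simp: C_def one_pCons)
    fix x y assume "x \<in> C" "y \<in> C"
    then obtain s t where "x = [:s:]" "y = [:t:]"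
      by (auto simp: C_def)
    then have "x - y = [:s - t:]" "x * y = [:s * t:]"
      by auto
    then show "x - y \<in> C" "x * y \<in> C"
      by (simp_all add: C_def)
  qed
  obtain t where tC: "\<And>i. t i \<in> C" and
    t: "\<And>x. (\<Prod>a\<in>PiE {..<d} (\<lambda>_. UNIV). x + (\<Sum>i<d. ?\<phi> (a i) * [:var i:])) = (\<Sum>i\<le>d. t i * x ^ (q ^ i))"
    using h.prod_span_linearized[OF C, of d "\<lambda>i. [:var i:]"] by (auto simp: C_def)
  have "\<exists>s. t i = [:s:]" for i
    using tC[of i] unfolding C_def by auto
  then obtain s where s: "\<And>i. t i = [:s i:]"
    by metis
  have sum_const: "(\<Sum>i\<in>I. [:f i:]) = [:\<Sum>i\<in>I. f i:]" for I :: "nat set" and f :: "nat \<Rightarrow> 'k mpolynomial"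
    by (induction I rule: infinite_finite_induct) auto
  have "orbit_poly = (\<Prod>\<phi>\<in>dual. [:0, 1:] + (\<Sum>i<d. ?\<phi> (restrict (\<lambda>i. \<phi> (e i)) {..<d} i) * [:var i:]))"
    unfolding orbit_poly_def by (intro prod.cong refl) (simp add: sum_const lf_eq mult.commute)
  also have "\<dots> = (\<Prod>a\<in>PiE {..<d} (\<lambda>_. UNIV). [:0, 1:] + (\<Sum>i<d. ?\<phi> (a i) * [:var i:]))"
    by (rule prod.reindex_bij_betw[OF dual_bij])
  also have "\<dots> = (\<Sum>i\<le>d. [:s i:] * [:0, 1:] ^ (q ^ i))"
    by (simp only: t s)
  also have "\<dots> = (\<Sum>i\<le>d. monom (s i) (q ^ i))"
    by (simp add: monom_altdef)
  finally have eq: "coeff orbit_poly n = (\<Sum>i\<le>d. if q ^ i = n then s i else 0)"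
    by (simp add: coeff_sum)
  show ?thesis
  proof (rule ccontr)
    assume "\<not> ?thesis"
    then have "(\<Sum>i\<le>d. if q ^ i = n then s i else 0) = 0"
      by (intro sum.neutral) auto
    with assms eq show False
      by simp
  qed
qed

lemma orbit_poly_root:
  assumes "i < d"
  shows "poly orbit_poly (- var i) = 0"
  unfolding orbit_poly_def poly_prod using coord_dual[of i] finite_dual lf_coord[OF assms]
  by (intro prod_zero) (auto intro!: bexI[of _ "coord i"])

lemma dickson_eq: "dickson scale d e i = (-1) ^ (d - i) * coeff orbit_poly (q ^ i)"
  by (simp add: dickson_def orbit_poly_def card_field)

lemma coeff_orbit_poly: "coeff orbit_poly (q ^ i) = (-1) ^ (d - i) * dickson scale d e i"
  by (simp add: dickson_eq mult.assoc[symmetric] power_add[symmetric] flip: mult_2)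

abbreviation dk :: "nat \<Rightarrow> 'k mpolynomial" where "dk \<equiv> dickson scale d e"

lemma dickson_mem_of_coeff:
  assumes "sub_comm_ring C" "coeff orbit_poly (q ^ i) \<in> C"
  shows "dk i \<in> C"
proof -
  interpret sub_comm_ring C by fact
  show ?thesis
    unfolding dickson_eq using assms(2) by (intro mult_mem power_mem uminus_mem one_mem)
qed

lemma mgr_dickson:
  assumes "i < d"
  shows "mgr (dk i) = monom (dk i) (q ^ d - q ^ i)"
proof -
  interpret grading "mgr :: 'k mpolynomial \<Rightarrow> _" by (rule grading_mgr)
  have "q ^ i \<le> card dual"
    unfolding card_dual using assms q1 by (intro power_increasing) auto
  then have "mgr (coeff orbit_poly (q ^ i)) = monom (coeff orbit_poly (q ^ i)) (q ^ d - q ^ i)"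
    using gr_coeff_prod[of dual lf "q ^ i"] finite_dual by (simp add: mgr_lf orbit_poly_def card_dual)
  then show ?thesis
    unfolding dickson_eq by (simp add: gr_mult gr_power gr_uminus gr_1 minus_one_power_iff minus_monom)
qed

lemma dickson_degree: "i < d \<Longrightarrow> q ^ d - q ^ i > 0"
  using q1 by (simp add: power_strict_increasing)

text \<open>The equation says that \<open>- var i\<close> is a root of \<open>orbit_poly\<close>, all of whose coefficients below the leading
  one are zero or Dickson polynomials up to sign.\<close>

lemma var_integral:
  assumes C: "sub_comm_ring C" "\<And>j. j < d \<Longrightarrow> dk j \<in> C" and i: "i < d"
  shows "var i ^ (q ^ d) \<in> lincombs C (\<lambda>j. var i ^ j) (q ^ d)"
proof -
  interpret C: sub_comm_ring C by fact
  let ?N = "q ^ d"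
  have coeff: "coeff orbit_poly n \<in> C" if "n < ?N" for n
  proof (cases "coeff orbit_poly n = 0")
    case False
    then obtain j where "j \<le> d" "n = q ^ j"
      using orbit_poly_linearized by blast
    then show ?thesis
      using C(2)[of j] that coeff_orbit_poly[of j] by (cases "j = d") auto
  qed simp
  have "0 = (\<Sum>n\<le>?N. coeff orbit_poly n * (- var i) ^ n)"
    using orbit_poly_root[OF i] by (simp add: poly_altdef orbit_poly_monic)
  also have "\<dots> = (- var i) ^ ?N + (\<Sum>n<?N. coeff orbit_poly n * (- var i) ^ n)"
    by (simp add: orbit_poly_monic(1) lessThan_Suc_atMost[symmetric] del: lessThan_Suc_atMost)
  finally have "(- var i) ^ ?N = - (\<Sum>n<?N. coeff orbit_poly n * (- var i) ^ n)"
    by (simp add: eq_neg_iff_add_eq_0)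
  then have "(-1) ^ ?N * ((-1) ^ ?N * var i ^ ?N) = (-1) ^ ?N * - (\<Sum>n<?N. coeff orbit_poly n * (- var i) ^ n)"
    by (simp add: power_minus[of "var i"])
  then have "var i ^ ?N = (-1) ^ ?N * - (\<Sum>n<?N. coeff orbit_poly n * (- var i) ^ n)"
    by (simp add: mult.assoc[symmetric] power_add[symmetric] flip: mult_2)
  also have "\<dots> = (\<Sum>n<?N. (- ((-1) ^ ?N * (-1) ^ n * coeff orbit_poly n)) * var i ^ n)"
    unfolding sum_negf[symmetric] sum_distrib_left
    by (intro sum.cong refl) (simp add: power_minus[of "var i"] mult_ac)
  also have "\<dots> \<in> lincombs C (\<lambda>j. var i ^ j) ?N"
    using coeff by (intro lincombsI C.uminus_mem C.mult_mem C.power_mem C.one_mem)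
  finally show ?thesis .
qed

lemma noeth_poly_ring: "noeth (adjoins (range const) dk d) (carrier (poly_ring d))"
proof -
  interpret K: sub_comm_ring "range const :: 'k mpolynomial set"
    by (intro rhom.sub_comm_ring_range rhom_const)
  let ?D = "adjoins (range const) dk d"
  interpret D: sub_comm_ring ?D
    by (rule K.sub_comm_ring_adjs)
  have "noeth (range const) (range const :: 'k mpolynomial set)"
  proof (rule K.noeth_field)
    fix x :: "'k mpolynomial" assume "x \<in> range const" "x \<noteq> 0"
    then obtain a where "x = const a" "a \<noteq> 0"
      by (metis imageE single_zero)
    then show "\<exists>y\<in>range const. y * x = 1"
      by (auto simp: mult_single intro!: exI[of _ "1 / a"])
  qed
  then have "noeth ?D ?D"
    by (rule K.noeth_adjs)
  have *: "noeth ?D (adjoins ?D var m)" if "m \<le> d" for m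
    using that
  proof (induction m)
    case 0
    then show ?case
      using \<open>noeth ?D ?D\<close> by simp
  next
    case (Suc m)
    let ?C = "adjoins ?D var m"
    have sub: "?D \<subseteq> ?C"
      using D.adjs_mono[of 0 m var] by simp
    then have "var m ^ (q ^ d) \<in> lincombs ?C (\<lambda>j. var m ^ j) (q ^ d)"
      using Suc.prems K.mem_adjs[of _ d dk] by (intro var_integral D.sub_comm_ring_adjs) auto
    then show ?case
      using D.noeth_adj_integral[OF D.sub_comm_ring_adjs sub] Suc by simp
  qed
  moreover have "carrier (poly_ring d) \<subseteq> adjoins ?D var d"
  proof (rule poly_ring_subset[OF D.sub_comm_ring_adjs])
    have "range const \<subseteq> ?D"
      using K.adjs_mono[of 0 d dk] by simp
    then show "range const \<subseteq> adjoins ?D var d"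
      using D.adjs_mono[of 0 d var] by simp
    show "var i \<in> adjoins ?D var d" if "i < d" for i
      using D.mem_adjs[OF that] .
  qed
  ultimately show ?thesis
    using noeth_subset by blast
qed

end

section \<open>The action on polynomials and its invariants\<close>

context finite_space
begin

abbreviation Rd :: "'k mpolynomial set" where "Rd \<equiv> carrier (poly_ring d)"

abbreviation GLs :: "('v \<Rightarrow> 'v) set" where "GLs \<equiv> carrier (GL scale)"

abbreviation A :: "('v \<Rightarrow> 'v) \<Rightarrow> 'k mpolynomial \<Rightarrow> 'k mpolynomial" where "A \<equiv> act scale d e"

definition ev :: "'v \<Rightarrow> 'k mpolynomial \<Rightarrow> 'k" where
  "ev v = peval (\<lambda>a. a) (\<lambda>i. coord i v)"

definition invs :: "('v \<Rightarrow> 'v) set \<Rightarrow> 'k mpolynomial set" where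
  "invs H = {f \<in> Rd. \<forall>g\<in>H. A g f = f}"

lemma invariant_ring_eq: "invariant_ring scale d e H = ring_on (invs H)"
  by (simp add: invariant_ring_def poly_ring_def ring_on_def invs_def)

lemma mem_GL:
  "g \<in> GLs \<longleftrightarrow> (\<forall>x y. g (x + y) = g x + g y) \<and> (\<forall>a x. g (scale a x) = scale a (g x)) \<and> bij g"
  using vs by (auto simp: GL_def Vector_Spaces.linear_iff)

lemma GL_zero: "g \<in> GLs \<Longrightarrow> g 0 = 0"
  using V.scale_zero_left by (metis mem_GL)

lemma GL_inv_apply:
  assumes "g \<in> GLs"
  shows "inv_into UNIV g (g x) = x" "g (inv_into UNIV g x) = x"
  using assms by (auto simp: mem_GL bij_is_inj bij_is_surj surj_f_inv_f)

lemma GL_inv: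
  assumes g: "g \<in> GLs"
  shows "inv_into UNIV g \<in> GLs"
proof -
  have inj: "x = y" if "g x = g y" for x y
    using that GL_inv_apply(1)[OF g] by metis
  have "inv_into UNIV g (x + y) = inv_into UNIV g x + inv_into UNIV g y" for x y
    by (rule inj) (use g in \<open>simp add: mem_GL GL_inv_apply(2)[OF g]\<close>)
  moreover have "inv_into UNIV g (scale a x) = scale a (inv_into UNIV g x)" for a x
    by (rule inj) (use g in \<open>simp add: mem_GL GL_inv_apply(2)[OF g]\<close>)
  moreover have "bij (inv_into UNIV g)"
    using g by (simp add: mem_GL bij_imp_bij_inv)
  ultimately show ?thesis
    by (simp add: mem_GL)
qed

lemma dual_comp: "\<phi> \<in> dual \<Longrightarrow> g \<in> GLs \<Longrightarrow> \<phi> \<circ> g \<in> dual"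
  by (simp add: mem_dual mem_GL)

lemma act_eq: "A g = peval const (\<lambda>i. lf (coord i \<circ> inv_into UNIV g))"
  by (intro ext) (simp add: act_def peval_def mval_def)

lemma rhom_act: "rhom (A g)"
  unfolding act_eq by (rule rhom_peval[OF rhom_const])

lemma act_const: "A g (const a) = const a"
  unfolding act_eq by (rule peval_const[OF rhom_const])

lemma act_var: "A g (var i) = lf (coord i \<circ> inv_into UNIV g)"
  unfolding act_eq by (rule peval_var[OF rhom_const])

lemma rhom_ev: "rhom (ev v)"
  unfolding ev_def by (rule rhom_peval[OF rhom_id])

lemma ev_const: "ev v (const a) = a"
  unfolding ev_def by (rule peval_const[OF rhom_id])

lemma ev_var: "ev v (var i) = coord i v"
  unfolding ev_def by (rule peval_var[OF rhom_id])

lemma lf_sum: "(\<Sum>j\<in>J. const (a j) * lf (\<psi> j)) = lf (\<lambda>v. \<Sum>j\<in>J. a j * \<psi> j v)"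
proof -
  interpret C: rhom "const :: 'k \<Rightarrow> _" by (rule rhom_const)
  have "(\<Sum>j\<in>J. const (a j) * lf (\<psi> j)) = (\<Sum>j\<in>J. \<Sum>i<d. const (a j * \<psi> j (e i)) * var i)"
    by (simp add: lf_eq sum_distrib_left mult.assoc C.hom_mult)
  also have "\<dots> = (\<Sum>i<d. \<Sum>j\<in>J. const (a j * \<psi> j (e i)) * var i)"
    by (rule sum.swap)
  also have "\<dots> = lf (\<lambda>v. \<Sum>j\<in>J. a j * \<psi> j v)"
    by (simp add: lf_eq C.hom_sum sum_distrib_right)
  finally show ?thesis .
qed

lemma act_lf:
  assumes "\<phi> \<in> dual"
  shows "A g (lf \<phi>) = lf (\<phi> \<circ> inv_into UNIV g)"
proof -
  interpret rhom "A g" by (rule rhom_act)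
  have "A g (lf \<phi>) = (\<Sum>j<d. const (\<phi> (e j)) * lf (coord j \<circ> inv_into UNIV g))"
    unfolding lf_eq[of \<phi>] hom_sum hom_mult act_const act_var ..
  also have "\<dots> = lf (\<lambda>v. \<Sum>j<d. \<phi> (e j) * (coord j \<circ> inv_into UNIV g) v)"
    by (rule lf_sum)
  also have "(\<lambda>v. \<Sum>j<d. \<phi> (e j) * (coord j \<circ> inv_into UNIV g) v) = \<phi> \<circ> inv_into UNIV g"
    by (intro ext) (simp flip: dual_expansion[OF assms])
  finally show ?thesis .
qed

lemma ev_lf:
  assumes "\<phi> \<in> dual"
  shows "ev v (lf \<phi>) = \<phi> v"
proof -
  interpret rhom "ev v" by (rule rhom_ev)
  show ?thesis
    unfolding lf_eq hom_sum hom_mult ev_const ev_var by (rule dual_expansion[OF assms, symmetric])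
qed

lemma act_comp:
  assumes "g \<in> GLs" "h \<in> GLs" "f \<in> Rd"
  shows "A g (A h f) = A (g \<circ> h) f"
proof (rule rhom_mpoly_eq[of "\<lambda>f. A g (A h f)" "A (g \<circ> h)" d f])
  show "rhom (\<lambda>f. A g (A h f))"
    by (rule rhom_comp[OF rhom_act rhom_act])
  show "rhom (A (g \<circ> h))"
    by (rule rhom_act)
  show "A g (A h (const a)) = A (g \<circ> h) (const a)" for a
    by (simp only: act_const)
  show "A g (A h (var i)) = A (g \<circ> h) (var i)" for i
  proof -
    have "inv_into UNIV (g \<circ> h) = inv_into UNIV h \<circ> inv_into UNIV g"
      using assms by (intro o_inv_distrib) (auto simp: mem_GL)
    then show ?thesis
      unfolding act_var using act_lf[OF dual_comp[OF coord_dual GL_inv[OF assms(2)]]]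
      by (simp add: comp_assoc)
  qed
qed (rule assms)

lemma act_id: "f \<in> Rd \<Longrightarrow> A id f = f"
  by (rule rhom_mpoly_eq[OF rhom_act rhom_id]) (simp_all add: act_const act_var lf_coord)

lemma act_mem:
  assumes "f \<in> Rd"
  shows "A g f \<in> Rd"
proof -
  interpret rhom "A g" by (rule rhom_act)
  interpret R: sub_comm_ring Rd by (rule sub_comm_ring_poly_ring)
  have "sub_comm_ring {f. A g f \<in> Rd}"
    by standard (auto simp: hom_diff hom_mult)
  then have "Rd \<subseteq> {f. A g f \<in> Rd}"
    by (rule poly_ring_subset) (auto simp: act_const const_mem_poly_ring act_var lf_mem)
  then show ?thesis
    using assms by blast
qed

lemma ev_act:
  assumes "g \<in> GLs" "f \<in> Rd"
  shows "ev v (A g f) = ev (inv_into UNIV g v) f"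
proof (rule rhom_mpoly_eq[of "\<lambda>f. ev v (A g f)" "ev (inv_into UNIV g v)" d f])
  show "rhom (\<lambda>f. ev v (A g f))"
    by (rule rhom_comp[OF rhom_ev rhom_act])
  show "ev v (A g (var i)) = ev (inv_into UNIV g v) (var i)" for i
    using ev_lf[OF dual_comp[OF coord_dual GL_inv[OF assms(1)]]] by (simp add: act_var ev_var)
qed (use assms in \<open>auto simp: rhom_ev act_const ev_const\<close>)

lemma mgr_act:
  assumes "f \<in> Rd"
  shows "mgr (A g f) = map_poly (A g) (mgr f)"
proof (rule rhom_mpoly_eq[of "\<lambda>f. mgr (A g f)" "\<lambda>f. map_poly (A g) (mgr f)" d f])
  interpret rhom "A g" by (rule rhom_act)
  show "rhom (\<lambda>f. mgr (A g f))" "rhom (\<lambda>f. map_poly (A g) (mgr f))"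
    by (intro rhom_comp[OF rhom_mgr rhom_act], intro rhom_comp[OF rhom_map_poly rhom_mgr])
  show "mgr (A g (const a)) = map_poly (A g) (mgr (const a))" for a
    by (simp add: act_const mgr_const map_poly_pCons)
  show "mgr (A g (var i)) = map_poly (A g) (mgr (var i))" for i
    by (simp add: act_var mgr_lf mgr_var map_poly_monom)
qed (rule assms)

lemma component_mem_Rd:
  assumes "f \<in> Rd"
  shows "coeff (mgr f) n \<in> Rd"
proof -
  interpret R: sub_comm_ring Rd by (rule sub_comm_ring_poly_ring)
  show ?thesis
    unfolding coeff_mgr
  proof (rule R.sum_mem)
    fix m assume "m \<in> Poly_Mapping.keys f"
    then show "(if mdeg m = n then Poly_Mapping.single m (Poly_Mapping.lookup f m) else 0) \<in> Rd"
      using assms by (auto simp: mem_poly_ring)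
  qed
qed

lemma sub_comm_ring_invs: "sub_comm_ring (invs H)"
proof -
  interpret R: sub_comm_ring Rd by (rule sub_comm_ring_poly_ring)
  show ?thesis
    by standard (auto simp: invs_def rhom.hom_one[OF rhom_act] rhom.hom_diff[OF rhom_act] rhom.hom_mult[OF rhom_act])
qed

lemma graded_subring_invs: "graded_subring mgr (invs H)"
proof -
  interpret grading "mgr :: 'k mpolynomial \<Rightarrow> _" by (rule grading_mgr)
  interpret sub_comm_ring "invs H" by (rule sub_comm_ring_invs)
  show ?thesis
  proof
    fix f n assume f: "f \<in> invs H"
    have "A g (coeff (mgr f) n) = coeff (mgr f) n" if "g \<in> H" for g
    proof -
      interpret a: rhom "A g" by (rule rhom_act)
      have "coeff (mgr (A g f)) n = A g (coeff (mgr f) n)"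
        using f by (simp add: mgr_act invs_def coeff_map_poly)
      then show ?thesis
        using f that by (simp add: invs_def)
    qed
    then show "coeff (mgr f) n \<in> invs H"
      using f by (simp add: invs_def component_mem_Rd)
  qed
qed

lemma map_poly_prod:
  assumes "rhom h"
  shows "map_poly h (\<Prod>i\<in>I. [:l i, 1:]) = (\<Prod>i\<in>I. [:h (l i), 1:])"
proof -
  interpret h: rhom h by fact
  interpret m: rhom "map_poly h" by (rule h.rhom_map_poly)
  show ?thesis
    by (simp add: m.hom_prod map_poly_pCons)
qed

lemma act_orbit_poly:
  assumes "g \<in> GLs"
  shows "map_poly (A g) orbit_poly = orbit_poly"
proof -
  have "map_poly (A g) orbit_poly = (\<Prod>\<phi>\<in>dual. [:lf (\<phi> \<circ> inv_into UNIV g), 1:])"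
    unfolding orbit_poly_def map_poly_prod[OF rhom_act] by (intro prod.cong) (simp_all add: act_lf)
  also have "\<dots> = orbit_poly"
    unfolding orbit_poly_def
  proof (rule prod.reindex_bij_witness[of _ "\<lambda>\<phi>. \<phi> \<circ> g" "\<lambda>\<phi>. \<phi> \<circ> inv_into UNIV g"])
    fix \<phi> assume "\<phi> \<in> dual"
    then show "\<phi> \<circ> g \<in> dual" "\<phi> \<circ> inv_into UNIV g \<in> dual"
      using assms by (auto intro: dual_comp GL_inv)
  qed (auto simp: fun_eq_iff GL_inv_apply[OF assms])
  finally show ?thesis .
qed

lemma orbit_poly_coeff_mem:
  assumes "H \<subseteq> GLs"
  shows "coeff orbit_poly n \<in> invs H"
proof -
  have "A g (coeff orbit_poly n) = coeff orbit_poly n" if "g \<in> H" for g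
  proof -
    interpret a: rhom "A g" by (rule rhom_act)
    have "coeff (map_poly (A g) orbit_poly) n = A g (coeff orbit_poly n)"
      by (simp add: coeff_map_poly)
    then show ?thesis
      using act_orbit_poly[of g] assms that by auto
  qed
  moreover have "coeff orbit_poly n \<in> Rd"
    unfolding orbit_poly_def by (intro coeffs_prod_mem sub_comm_ring_poly_ring lf_mem)
  ultimately show ?thesis
    by (simp add: invs_def)
qed

lemma dickson_mem: "H \<subseteq> GLs \<Longrightarrow> dk i \<in> invs H"
  by (intro dickson_mem_of_coeff sub_comm_ring_invs orbit_poly_coeff_mem)

lemma parameter_algebra_invs:
  assumes "H \<subseteq> GLs"
  shows "parameter_algebra (invs H) dk (\<lambda>i. q ^ d - q ^ i) d"
proof -
  interpret graded_subring mgr "invs H" by (rule graded_subring_invs)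
  show ?thesis
  proof
    show "range const \<subseteq> invs H"
      by (auto simp: invs_def const_mem_poly_ring act_const)
    show "noeth (adjoins (range const) dk d) (invs H)"
      by (rule noeth_subset[OF noeth_poly_ring]) (auto simp: invs_def)
    show "invs H \<subseteq> Rd"
      by (auto simp: invs_def)
  qed (rule dickson_mem[OF assms] mgr_dickson dickson_degree; assumption?)+
qed

text \<open>Contracting the primes \<open>(x 0, \<dots>, x (i - 1))\<close> of the polynomial ring gives a chain of length
  \<open>d\<close>. It is strict because \<open>x i\<close> is integral over the invariants: the lowest coefficient of its
  equation that is nonzero modulo \<open>x 0, \<dots>, x (i - 1)\<close> is divisible by \<open>x i\<close>.\<close>

lemma prime_chain_to_origin:
  assumes "H \<subseteq> GLs"
  shows "\<exists>Q :: nat \<Rightarrow> 'k mpolynomial set.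
     (\<forall>i\<le>d. sub_comm_ring.prime_in (invs H) (Q i)) \<and> (\<forall>i<d. Q i \<subset> Q (Suc i)) \<and>
     Q d = {f \<in> invs H. coeff (mgr f) 0 = 0}"
proof -
  interpret B: sub_comm_ring "invs H" by (rule sub_comm_ring_invs)
  define \<sigma> :: "nat \<Rightarrow> 'k mpolynomial \<Rightarrow> 'k mpolynomial"
    where "\<sigma> i = peval const (\<lambda>j. if j < i then 0 else var j)" for i
  have rh: "rhom (\<sigma> i)" for i
    unfolding \<sigma>_def by (rule rhom_peval[OF rhom_const])
  have \<sigma>_const: "\<sigma> i (const a) = const a" for i a
    unfolding \<sigma>_def by (rule peval_const[OF rhom_const])
  have \<sigma>_var: "\<sigma> i (var j) = (if j < i then 0 else var j)" for i j
    unfolding \<sigma>_def by (rule peval_var[OF rhom_const])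
  have \<sigma>_zero: "\<sigma> i 0 = 0" for i
    by (rule rhom.hom_zero[OF rh])
  have \<sigma>_\<sigma>: "\<sigma> (Suc i) (\<sigma> i f) = \<sigma> (Suc i) f" if "f \<in> Rd" for i f
  proof (rule rhom_mpoly_eq[of "\<lambda>f. \<sigma> (Suc i) (\<sigma> i f)" "\<sigma> (Suc i)" d f])
    show "rhom (\<lambda>f. \<sigma> (Suc i) (\<sigma> i f))"
      by (rule rhom_comp[OF rh rh])
  qed (use rh that in \<open>simp_all add: \<sigma>_const \<sigma>_var \<sigma>_zero\<close>)
  define Q where "Q i = {f \<in> invs H. \<sigma> i f = 0}" for i
  have "B.prime_in (Q i)" for i
    unfolding B.prime_in_def submod_def Q_def
    using rhom.hom_one[OF rh] rhom.hom_add[OF rh] rhom.hom_mult[OF rh] by (auto simp: \<sigma>_zero)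
  moreover have "Q i \<subset> Q (Suc i)" if i: "i < d" for i
  proof
    show "Q i \<subseteq> Q (Suc i)"
    proof
      fix f assume f: "f \<in> Q i"
      then have "\<sigma> i f = 0" "f \<in> Rd"
        by (simp_all add: Q_def invs_def)
      then have "\<sigma> (Suc i) f = 0"
        using \<sigma>_\<sigma>[of f i] by (simp add: \<sigma>_zero)
      then show "f \<in> Q (Suc i)"
        using f by (simp add: Q_def)
    qed
    have ex: "\<exists>n. \<sigma> i (coeff orbit_poly n) \<noteq> 0"
      using rhom.hom_one[OF rh, of i] orbit_poly_monic(1) by (intro exI[of _ "q ^ d"]) simp
    define n where "n = (LEAST n. \<sigma> i (coeff orbit_poly n) \<noteq> 0)"
    have n: "\<sigma> i (coeff orbit_poly n) \<noteq> 0" "\<And>m. m < n \<Longrightarrow> \<sigma> i (coeff orbit_poly m) = 0"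
      using LeastI_ex[OF ex] not_less_Least unfolding n_def by blast+
    define p where "p = map_poly (\<sigma> i) orbit_poly"
    have coeff_p: "coeff p m = \<sigma> i (coeff orbit_poly m)" for m
      by (simp add: p_def coeff_map_poly \<sigma>_zero)
    have "monom 1 n dvd p"
      using n(2) by (simp add: monom_1_dvd_iff' coeff_p)
    then obtain r where r: "p = monom 1 n * r"
      by (elim dvdE)
    have "coeff r 0 = \<sigma> i (coeff orbit_poly n)"
      using coeff_p[of n] by (simp add: r coeff_monom_mult)
    have "poly p (- var i) = 0"
      using rhom.hom_poly[OF rh, of i orbit_poly "- var i"]
      by (simp add: p_def rhom.hom_uminus[OF rh] \<sigma>_var orbit_poly_root[OF i] \<sigma>_zero)
    moreover have "var i \<noteq> (0 :: 'k mpolynomial)"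
      by (simp add: var_def) (metis lookup_single_eq lookup_zero one_neq_zero)
    ultimately have "poly r (- var i) = 0"
      by (simp add: r poly_monom)
    then have "poly (map_poly (\<sigma> (Suc i)) r) 0 = 0"
      using rhom.hom_poly[OF rh, of "Suc i" r "- var i"]
      by (simp add: rhom.hom_uminus[OF rh] \<sigma>_var \<sigma>_zero)
    then have "\<sigma> (Suc i) (coeff r 0) = 0"
      by (simp add: poly_0_coeff_0 coeff_map_poly \<sigma>_zero)
    then have "\<sigma> (Suc i) (\<sigma> i (coeff orbit_poly n)) = 0"
      by (simp add: \<open>coeff r 0 = _\<close>)
    moreover have mem: "coeff orbit_poly n \<in> invs H"
      by (rule orbit_poly_coeff_mem[OF assms])
    ultimately have "\<sigma> (Suc i) (coeff orbit_poly n) = 0"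
      by (simp add: \<sigma>_\<sigma> invs_def)
    then have "coeff orbit_poly n \<in> Q (Suc i) - Q i"
      using n(1) mem by (simp add: Q_def)
    then show "Q i \<noteq> Q (Suc i)"
      by blast
  qed
  moreover have "Q d = {f \<in> invs H. coeff (mgr f) 0 = 0}"
  proof -
    interpret m: rhom "mgr :: 'k mpolynomial \<Rightarrow> _" by (rule rhom_mgr)
    have "rhom (\<lambda>f :: 'k mpolynomial. coeff (mgr f) 0)"
      by standard (auto simp: m.hom_add m.hom_mult coeff_mult_0)
    from rhom_mpoly_eq[OF rh this, of d d] have "\<sigma> d f = coeff (mgr f) 0" if "f \<in> Rd" for f
      using that by (simp add: \<sigma>_const \<sigma>_var mgr_const mgr_var)
    then show ?thesis
      by (auto simp: Q_def invs_def)
  qed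
  ultimately show ?thesis
    by blast
qed

section \<open>Rational points\<close>

text \<open>Evaluated at \<open>v\<close>, the product that defines the Dickson polynomials becomes a polynomial in one variable
  that vanishes at zero to the order \<open>q ^ (d - 1)\<close>, the number of functionals that vanish at \<open>v\<close>.\<close>

lemma dickson_at_point:
  assumes v: "v \<noteq> 0"
  shows "i < d - 1 \<Longrightarrow> ev v (dk i) = 0" "ev v (dk (d - 1)) \<noteq> 0"
proof -
  interpret ev: rhom "ev v" by (rule rhom_ev)
  obtain i where i: "i < d" "coord i v \<noteq> 0"
    using coord_inject[of v 0] v dual_zero[OF coord_dual] by auto
  define \<phi>0 where "\<phi>0 w = coord i w / coord i v" for w
  have \<phi>0: "\<phi>0 \<in> dual" "\<phi>0 v = 1"
    using coord_dual[of i] i by (auto simp: mem_dual \<phi>0_def add_divide_distrib)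
  define Z where "Z = {\<phi> \<in> dual. \<phi> v = 0}"
  have fiber: "card {\<phi> \<in> dual. \<phi> v = a} = card Z" for a
  proof (rule bij_betw_same_card[OF bij_betwI[where f = "\<lambda>\<phi> w. \<phi> w - a * \<phi>0 w" and g = "\<lambda>\<phi> w. \<phi> w + a * \<phi>0 w"]])
    show "(\<lambda>\<phi> w. \<phi> w - a * \<phi>0 w) \<in> {\<phi> \<in> dual. \<phi> v = a} \<rightarrow> Z"
      using \<phi>0 by (auto simp: Z_def mem_dual algebra_simps)
    show "(\<lambda>\<phi> w. \<phi> w + a * \<phi>0 w) \<in> Z \<rightarrow> {\<phi> \<in> dual. \<phi> v = a}"
      using \<phi>0 by (auto simp: Z_def mem_dual algebra_simps)
  qed auto
  have "card dual = (\<Sum>a\<in>UNIV. card {\<phi> \<in> dual. \<phi> v = a})"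
    using sum.group[OF finite_dual, of UNIV "\<lambda>\<phi>. \<phi> v" "\<lambda>_. 1 :: nat"] by simp
  then have "q ^ d = q * card Z"
    by (simp add: fiber card_dual card_field)
  moreover have "q ^ d = q * q ^ (d - 1)"
    using i(1) by (simp flip: power_Suc)
  ultimately have cardZ: "card Z = q ^ (d - 1)"
    using q1 by simp
  define p where "p = map_poly (ev v) orbit_poly"
  have "p = (\<Prod>\<phi>\<in>dual. [:\<phi> v, 1:])"
    unfolding p_def orbit_poly_def map_poly_prod[OF rhom_ev] by (intro prod.cong) (simp_all add: ev_lf)
  also have "\<dots> = (\<Prod>\<phi>\<in>dual - Z. [:\<phi> v, 1:]) * (\<Prod>\<phi>\<in>Z. [:\<phi> v, 1:])"
    by (rule prod.subset_diff) (auto simp: Z_def finite_dual)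
  also have "(\<Prod>\<phi>\<in>Z. [:\<phi> v, 1:]) = (\<Prod>\<phi>\<in>Z. [:0, 1:])"
    by (intro prod.cong) (auto simp: Z_def)
  also have "\<dots> = monom 1 (card Z)"
    by (simp add: monom_altdef)
  finally have p: "p = monom 1 (card Z) * (\<Prod>\<phi>\<in>dual - Z. [:\<phi> v, 1:])"
    by (simp add: mult.commute)
  have coeff_p: "coeff p n = ev v (coeff orbit_poly n)" for n
    by (simp add: p_def coeff_map_poly)
  have low: "coeff p n = 0" if "n < q ^ (d - 1)" for n
    using that by (simp add: p coeff_monom_mult cardZ)
  have "coeff p (q ^ (d - 1)) = poly (\<Prod>\<phi>\<in>dual - Z. [:\<phi> v, 1:]) 0"
    by (simp add: p coeff_monom_mult cardZ poly_0_coeff_0)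
  then have top: "coeff p (q ^ (d - 1)) \<noteq> 0"
    using finite_dual by (simp add: poly_prod prod_zero_iff) (auto simp: Z_def)
  have ev_dickson: "ev v (dk j) = (-1) ^ (d - j) * coeff p (q ^ j)" for j
    unfolding dickson_eq coeff_p by (simp add: ev.hom_mult ev.hom_power ev.hom_uminus)
  show "ev v (dk (d - 1)) \<noteq> 0"
    unfolding ev_dickson using top by simp
  show "ev v (dk j) = 0" if "j < d - 1" for j
    unfolding ev_dickson using low[of "q ^ j"] that q1 by (simp add: power_strict_increasing)
qed

text \<open>For each \<open>w \<noteq> v\<close> some coordinate separates \<open>w\<close> from \<open>v\<close>, which gives a polynomial of degree one with value
  \<open>0\<close> at \<open>w\<close> and \<open>1\<close> at \<open>v\<close>. Their product has the required values.\<close>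

lemma indicator_poly:
  obtains f where "f \<in> Rd" "ev v f = 1" "\<And>w. w \<noteq> v \<Longrightarrow> ev w f = 0"
proof -
  interpret R: sub_comm_ring Rd by (rule sub_comm_ring_poly_ring)
  have "\<exists>u\<in>Rd. ev v u = 1 \<and> ev w u = 0" if vw: "w \<noteq> v" for w
  proof -
    obtain i where i: "i < d" "coord i v \<noteq> coord i w"
      using coord_inject[of v w] vw by auto
    let ?u = "const (1 / (coord i v - coord i w)) * (var i - const (coord i w))"
    have "?u \<in> Rd"
      using i by (intro R.mult_mem R.diff_mem const_mem_poly_ring var_mem_poly_ring)
    moreover have "ev x ?u = (coord i x - coord i w) / (coord i v - coord i w)" for x
      by (simp add: rhom.hom_mult[OF rhom_ev] rhom.hom_diff[OF rhom_ev] ev_const ev_var)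
    ultimately show ?thesis
      using i(2) by (intro bexI[of _ ?u]) auto
  qed
  then obtain u where u: "\<And>w. w \<noteq> v \<Longrightarrow> u w \<in> Rd" "\<And>w. w \<noteq> v \<Longrightarrow> ev v (u w) = 1"
    "\<And>w. w \<noteq> v \<Longrightarrow> ev w (u w) = 0"
    by metis
  have fin: "finite (UNIV - {v})"
    using finite_V by simp
  show ?thesis
  proof (rule that[of "\<Prod>w\<in>UNIV - {v}. u w"])
    show "(\<Prod>w\<in>UNIV - {v}. u w) \<in> Rd"
      using u(1) by (intro R.prod_mem) auto
    show "ev v (\<Prod>w\<in>UNIV - {v}. u w) = 1"
      unfolding rhom.hom_prod[OF rhom_ev] using u(2) by (intro prod.neutral) auto
    show "ev w (\<Prod>w\<in>UNIV - {v}. u w) = 0" if "w \<noteq> v" for w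
      unfolding rhom.hom_prod[OF rhom_ev] using u(3) that fin by (intro prod_zero) auto
  qed
qed

end

section \<open>Invariants of the stabilizer of a rational point\<close>

locale invariants = finite_space scale d e q
  for scale :: "'k::{field,finite} \<Rightarrow> 'v::ab_group_add \<Rightarrow> 'v" and d :: nat and e :: "nat \<Rightarrow> 'v" and q :: nat +
  fixes G :: "('v \<Rightarrow> 'v) set"
  assumes subgroup_G: "subgroup G (GL scale)"
begin

lemma G_GL: "G \<subseteq> GLs"
  using subgroup.subset[OF subgroup_G] .

lemma G_comp: "g \<in> G \<Longrightarrow> h \<in> G \<Longrightarrow> g \<circ> h \<in> G"
  using subgroup.m_closed[OF subgroup_G, of g h] by (simp add: GL_def)

lemma G_id: "id \<in> G"
  using subgroup.one_closed[OF subgroup_G] by (simp add: GL_def)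

lemma G_inv:
  assumes "g \<in> G"
  shows "inv_into UNIV g \<in> G"
proof -
  have g: "g \<in> GLs"
    using assms G_GL by blast
  have "inv\<^bsub>GL scale\<^esub> g = inv_into UNIV g"
    unfolding m_inv_def
  proof (rule the_equality)
    show "inv_into UNIV g \<in> GLs \<and> g \<otimes>\<^bsub>GL scale\<^esub> inv_into UNIV g = \<one>\<^bsub>GL scale\<^esub> \<and>
      inv_into UNIV g \<otimes>\<^bsub>GL scale\<^esub> g = \<one>\<^bsub>GL scale\<^esub>"
      using GL_inv[OF g] GL_inv_apply[OF g] by (simp add: GL_def fun_eq_iff)
    fix h assume "h \<in> GLs \<and> g \<otimes>\<^bsub>GL scale\<^esub> h = \<one>\<^bsub>GL scale\<^esub> \<and> h \<otimes>\<^bsub>GL scale\<^esub> g = \<one>\<^bsub>GL scale\<^esub>"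
    then have "g \<circ> h = id"
      by (simp add: GL_def)
    then have "g (h x) = x" for x
      by (metis comp_apply id_apply)
    then show "h = inv_into UNIV g"
      using GL_inv_apply(1)[OF g] by (metis ext)
  qed
  then show ?thesis
    using subgroup.m_inv_closed[OF subgroup_G assms] by simp
qed

lemma finite_G: "finite G"
proof (rule finite_subset)
  show "G \<subseteq> PiE UNIV (\<lambda>_. UNIV)"
    by auto
  show "finite (PiE (UNIV :: 'v set) (\<lambda>_. UNIV :: 'v set))"
    using finite_V by (intro finite_PiE) auto
qed

text \<open>The number of nonzero vectors is prime to the characteristic, hence so is the length of some
  orbit.\<close>

lemma orbit_prime_to_char:
  assumes "d > 0"
  obtains v where "v \<noteq> 0" "of_nat (card ((\<lambda>g. g v) ` G)) \<noteq> (0 :: 'k)"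
proof -
  let ?X = "UNIV - {0 :: 'v}"
  define r where "r = {(v, w). v \<noteq> 0 \<and> (\<exists>g\<in>G. w = g v)}"
  have nz: "g v \<noteq> 0" if "g \<in> G" "v \<noteq> 0" for g v
    using GL_zero[of "inv_into UNIV g"] GL_inv[of g] GL_inv_apply(1)[of g v] G_GL that by (metis subsetD)
  have "equiv ?X r"
  proof (rule equivI)
    show "r \<subseteq> ?X \<times> ?X"
      using nz by (auto simp: r_def)
    show "refl_on ?X r"
      using G_id nz by (auto simp: refl_on_def r_def intro: bexI[of _ id])
    show "sym r"
    proof (rule symI)
      fix v w assume "(v, w) \<in> r"
      then obtain g where "v \<noteq> 0" "g \<in> G" "w = g v"
        by (auto simp: r_def)
      then show "(w, v) \<in> r"
        using nz G_inv[of g] GL_inv_apply(1)[of g v] G_GL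
        by (auto simp: r_def intro!: bexI[of _ "inv_into UNIV g"])
    qed
    show "trans r"
    proof (rule transI)
      fix u v w assume "(u, v) \<in> r" "(v, w) \<in> r"
      then obtain g h where "u \<noteq> 0" "g \<in> G" "v = g u" "h \<in> G" "w = h v"
        by (auto simp: r_def)
      then show "(u, w) \<in> r"
        using G_comp[of h g] by (auto simp: r_def intro!: bexI[of _ "h \<circ> g"])
    qed
  qed
  have "\<exists>v. v \<noteq> 0 \<and> of_nat (card ((\<lambda>g. g v) ` G)) \<noteq> (0 :: 'k)"
  proof (rule ccontr)
    assume *: "\<not> ?thesis"
    have "CHAR('k) dvd card ?X"
    proof (rule equiv_imp_dvd_card[OF _ \<open>equiv ?X r\<close>])
      fix Y assume "Y \<in> ?X // r"
      then obtain v where "v \<noteq> 0" "Y = r `` {v}"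
        by (auto elim!: quotientE)
      moreover have "r `` {v} = (\<lambda>g. g v) ` G" if "v \<noteq> 0" for v
        using that by (auto simp: r_def)
      ultimately have "of_nat (card Y) = (0 :: 'k)"
        using * by auto
      then show "CHAR('k) dvd card Y"
        by (simp add: of_nat_eq_0_iff_char_dvd)
    qed (use finite_V in simp)
    moreover have "CHAR('k) dvd q ^ d"
      using CHAR_dvd_CARD[where ?'a = 'k] assms by (auto simp: card_field intro: dvd_trans dvd_power)
    moreover have "card ?X = q ^ d - 1" "q ^ d > 0"
      using finite_V q1 by (simp_all add: card_V card_Diff_subset)
    ultimately have "CHAR('k) dvd 1"
      by (metis Suc_diff_1 Suc_eq_plus1 dvd_add_right_iff)
    then show False
      by simp
  qed
  then show ?thesis
    using that by blast
qed

end

locale point_stabilizer = invariants scale d e q G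
  for scale :: "'k::{field,finite} \<Rightarrow> 'v::ab_group_add \<Rightarrow> 'v" and d :: nat and e :: "nat \<Rightarrow> 'v" and q :: nat
    and G :: "('v \<Rightarrow> 'v) set" +
  fixes v :: 'v
  assumes v_nz: "v \<noteq> 0"
begin

definition stab :: "('v \<Rightarrow> 'v) set" where
  "stab = {g \<in> G. g v = v}"

definition orb :: "'v set" where
  "orb = (\<lambda>g. g v) ` G"

text \<open>The orbit indexes the cosets of the stabilizer. On \<open>B\<close> only the coset of a group element
  matters.\<close>

definition rep :: "'v \<Rightarrow> 'v \<Rightarrow> 'v" where
  "rep w = (SOME g. g \<in> G \<and> g v = w)"

abbreviation S where "S \<equiv> invs G"

abbreviation B where "B \<equiv> invs stab"

lemma rep:
  assumes "w \<in> orb"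
  shows "rep w \<in> G" "rep w v = w"
proof -
  have "\<exists>g. g \<in> G \<and> g v = w"
    using assms by (auto simp: orb_def)
  from someI_ex[OF this] show "rep w \<in> G" "rep w v = w"
    by (simp_all add: rep_def)
qed

lemma v_orb: "v \<in> orb"
  unfolding orb_def using G_id by (rule rev_image_eqI) simp

lemma orb_closed:
  assumes "g \<in> G" "w \<in> orb"
  shows "g w \<in> orb"
proof -
  obtain h where "h \<in> G" "w = h v"
    using assms(2) by (auto simp: orb_def)
  then have "g \<circ> h \<in> G" "g w = (g \<circ> h) v"
    using G_comp[OF assms(1)] by auto
  then show ?thesis
    unfolding orb_def by blast
qed

lemma finite_orb: "finite orb"
  using finite_G by (simp add: orb_def)

lemma stab_GL: "stab \<subseteq> GLs"
  using G_GL by (auto simp: stab_def)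

lemma S_B: "S \<subseteq> B"
  by (auto simp: invs_def stab_def)

lemma B_Rd: "B \<subseteq> Rd"
  by (auto simp: invs_def)

sublocale S: graded_subring mgr S
  by (rule graded_subring_invs)

sublocale B: graded_subring mgr B
  by (rule graded_subring_invs)

lemma coset_eq:
  assumes "g \<in> G" "h \<in> G" "g v = h v" "b \<in> B"
  shows "A g b = A h b"
proof -
  have GL: "g \<in> GLs" "h \<in> GLs"
    using assms G_GL by auto
  have k: "inv_into UNIV h \<circ> g \<in> stab"
    using assms GL_inv_apply(1)[OF GL(2), of v] G_comp[OF G_inv] by (simp add: stab_def)
  have "A g b = A (h \<circ> (inv_into UNIV h \<circ> g)) b"
    using GL_inv_apply(2)[OF GL(2)] by (simp add: comp_def)
  also have "\<dots> = A h (A (inv_into UNIV h \<circ> g) b)"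
    using k stab_GL B_Rd assms(4) GL by (intro act_comp[symmetric]) auto
  also have "A (inv_into UNIV h \<circ> g) b = b"
    using k assms(4) by (auto simp: invs_def)
  finally show ?thesis .
qed

lemma act_rep:
  assumes "g \<in> G" "w \<in> orb" "b \<in> B"
  shows "A g (A (rep w) b) = A (rep (g w)) b"
proof -
  have gw: "g w \<in> orb"
    using assms(1,2) by (rule orb_closed)
  have "A g (A (rep w) b) = A (g \<circ> rep w) b"
    using assms rep G_GL B_Rd by (intro act_comp) auto
  also have "\<dots> = A (rep (g w)) b"
    using assms rep gw by (intro coset_eq G_comp) auto
  finally show ?thesis .
qed

lemma act_rep_v: "b \<in> B \<Longrightarrow> A (rep v) b = b"
  using coset_eq[of "rep v" id b] rep[OF v_orb] G_id act_id B_Rd by auto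

lemma orb_bij:
  assumes "g \<in> G"
  shows "bij_betw g orb orb"
proof (rule bij_betwI[where g = "inv_into UNIV g"])
  show "g \<in> orb \<rightarrow> orb" "inv_into UNIV g \<in> orb \<rightarrow> orb"
    using orb_closed[OF assms] orb_closed[OF G_inv[OF assms]] by auto
qed (use GL_inv_apply assms G_GL in auto)

subsection \<open>Descent by transfer\<close>

definition transfer :: "'k mpolynomial \<Rightarrow> 'k mpolynomial" where
  "transfer b = (\<Sum>w\<in>orb. A (rep w) b)"

lemma transfer_mem:
  assumes "b \<in> B"
  shows "transfer b \<in> S"
proof -
  interpret R: sub_comm_ring Rd by (rule sub_comm_ring_poly_ring)
  have "A g (transfer b) = transfer b" if g: "g \<in> G" for g
  proof -
    interpret rhom "A g" by (rule rhom_act)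
    have "A g (transfer b) = (\<Sum>w\<in>orb. A (rep (g w)) b)"
      unfolding transfer_def hom_sum using act_rep[OF g _ assms] by (intro sum.cong) auto
    also have "\<dots> = transfer b"
      unfolding transfer_def by (rule sum.reindex_bij_betw[OF orb_bij[OF g]])
    finally show ?thesis .
  qed
  moreover have "transfer b \<in> Rd"
    unfolding transfer_def using assms B_Rd by (intro R.sum_mem act_mem) auto
  ultimately show ?thesis
    by (simp add: invs_def)
qed

lemma transfer_mult:
  assumes "s \<in> S"
  shows "transfer (b * s) = transfer b * s"
proof -
  have "A (rep w) (b * s) = A (rep w) b * s" if "w \<in> orb" for w
    using rep(1)[OF that] assms by (simp add: rhom.hom_mult[OF rhom_act] invs_def)
  then show ?thesis
    by (simp add: transfer_def sum_distrib_right)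
qed

text \<open>Dividing the transfer by the orbit length gives a retraction of \<open>S\<close>-modules from \<open>B\<close> onto \<open>S\<close>. It maps a
  representation of \<open>a\<close> with coefficients in \<open>B\<close> to one with coefficients in \<open>S\<close>.\<close>

lemma regular_descends:
  assumes unit: "of_nat (card orb) \<noteq> (0 :: 'k)" and y: "\<And>i. i < n \<Longrightarrow> y i \<in> S"
    and reg: "almost_regular B 1 y n"
  shows "almost_regular S 1 y n"
  unfolding almost_regular_def
proof (intro allI impI ballI)
  fix k a assume k: "k < n" and a: "a \<in> S" and rel: "y k * a \<in> lincombs S y k"
  have "lincombs S y k \<subseteq> lincombs B y k"
    using S_B by (force simp: lincombs_def)
  then have "a \<in> lincombs B y k"
    using reg k a rel S_B unfolding almost_regular_def by auto
  then obtain b where b: "\<forall>i<k. b i \<in> B" "a = (\<Sum>i<k. b i * y i)"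
    by (auto simp: lincombs_def)
  define \<rho> :: 'k where "\<rho> = of_nat (card orb)"
  have "const \<rho> * a = transfer (1 * a)"
    unfolding transfer_mult[OF a] by (simp add: transfer_def rhom.hom_one[OF rhom_act] \<rho>_def)
  also have "transfer (1 * a) = (\<Sum>i<k. transfer (b i * y i))"
    unfolding b(2) transfer_def
    by (simp add: rhom.hom_sum[OF rhom_act]) (rule sum.swap)
  also have "\<dots> = (\<Sum>i<k. transfer (b i) * y i)"
    using y k by (intro sum.cong refl transfer_mult) auto
  finally have eq: "const \<rho> * a = (\<Sum>i<k. transfer (b i) * y i)" .
  have "const (1 / \<rho>) * (const \<rho> * a) = a"
    using unit by (simp add: mult.assoc[symmetric] mult_single flip: \<rho>_def)
  moreover have "const (1 / \<rho>) \<in> S"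
    by (simp add: invs_def const_mem_poly_ring act_const)
  then have "const (1 / \<rho>) * (const \<rho> * a) \<in> lincombs S y k"
    unfolding eq using b(1) transfer_mem by (intro submodD(3)[OF S.submod_lc] lincombsI) auto
  ultimately show "1 * a \<in> lincombs S y k"
    by (simp only: mult_1_left)
qed

subsection \<open>The stabilizer invariants near the point\<close>

text \<open>Multiply the conjugates of an indicator polynomial of \<open>v\<close> under the stabilizer, all of which
  have value \<open>1\<close> at \<open>v\<close>.\<close>

lemma separating_invariant:
  obtains f where "f \<in> B" "ev v f = 1" "\<And>w. w \<noteq> v \<Longrightarrow> ev w f = 0"
proof -
  interpret R: sub_comm_ring Rd by (rule sub_comm_ring_poly_ring)
  obtain f0 where f0: "f0 \<in> Rd" "ev v f0 = 1" "\<And>w. w \<noteq> v \<Longrightarrow> ev w f0 = 0"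
    using indicator_poly[of v] by metis
  have fin: "finite stab"
    using finite_G by (simp add: stab_def)
  have idS: "id \<in> stab"
    using G_id by (simp add: stab_def)
  have stab_inv: "inv_into UNIV g v = v" if "g \<in> stab" for g
    using that GL_inv_apply(1)[of g v] stab_GL by (auto simp: stab_def)
  define f where "f = (\<Prod>h\<in>stab. A h f0)"
  have fRd: "f \<in> Rd"
    unfolding f_def using f0(1) by (intro R.prod_mem act_mem)
  have "A g f = f" if g: "g \<in> stab" for g
  proof -
    have gG: "g \<in> G" "g \<in> GLs" "g v = v"
      using g stab_GL by (auto simp: stab_def)
    have "A g f = (\<Prod>h\<in>stab. A (g \<circ> h) f0)"
      unfolding f_def rhom.hom_prod[OF rhom_act]
      using f0(1) gG(2) stab_GL by (intro prod.cong refl act_comp) auto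
    also have "\<dots> = f"
      unfolding f_def
    proof (rule prod.reindex_bij_witness[of _ "\<lambda>h. inv_into UNIV g \<circ> h" "\<lambda>h. g \<circ> h"])
      fix h assume h: "h \<in> stab"
      show "g \<circ> h \<in> stab"
        using h gG G_comp[of g h] by (simp add: stab_def)
      show "inv_into UNIV g \<circ> h \<in> stab"
        using h gG G_comp[OF G_inv[of g], of h] stab_inv[OF g] by (simp add: stab_def)
    qed (auto simp: fun_eq_iff GL_inv_apply[OF gG(2)])
    finally show ?thesis .
  qed
  then have "f \<in> B"
    using fRd by (simp add: invs_def)
  moreover have ev_f: "ev w f = (\<Prod>h\<in>stab. ev (inv_into UNIV h w) f0)" for w
    unfolding f_def rhom.hom_prod[OF rhom_ev] using f0(1) stab_GL
    by (intro prod.cong refl ev_act) auto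
  have "ev v f = 1"
    unfolding ev_f using stab_inv f0(2) by (intro prod.neutral) auto
  moreover have "ev w f = 0" if "w \<noteq> v" for w
    unfolding ev_f
  proof (rule prod_zero[OF fin])
    show "\<exists>h\<in>stab. ev (inv_into UNIV h w) f0 = 0"
      using idS f0(3)[OF that] by (intro bexI[of _ id]) auto
  qed
  ultimately show ?thesis
    using that by blast
qed

text \<open>Let \<open>f\<close> be a separating invariant and \<open>r\<close> the length of the orbit. The conjugates of \<open>f\<close>, one for each
  point of the orbit, are distinct, so \<open>1, f, \<dots>, f ^ (r - 1)\<close> are linearly independent over \<open>S\<close>. The
  product \<open>\<delta>\<close> of the differences of \<open>f\<close> from its other conjugates is the derivative at \<open>f\<close> of the
  minimal polynomial of \<open>f\<close>, with value \<open>1\<close> at \<open>v\<close>. For \<open>b\<close> in \<open>B\<close>, Lagrange interpolation of the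
  conjugates of \<open>b\<close> at those of \<open>f\<close>, with denominators cleared, is a polynomial \<open>N b\<close> over \<open>S\<close> of
  degree less than \<open>r\<close> with value \<open>\<delta> b\<close> at \<open>f\<close>. So \<open>\<delta> B\<close> lies in a free \<open>S\<close>-submodule of \<open>B\<close>.\<close>

lemma regular_near_point:
  "\<exists>\<delta>\<in>B. ev v \<delta> = 1 \<and>
     (\<forall>n y. (\<forall>i<n. y i \<in> S) \<longrightarrow> almost_regular S 1 y n \<longrightarrow> almost_regular B \<delta> y n)"
proof -
  interpret R: sub_comm_ring Rd by (rule sub_comm_ring_poly_ring)
  obtain f where f: "f \<in> B" "ev v f = 1" "\<And>w. w \<noteq> v \<Longrightarrow> ev w f = 0"
    using separating_invariant by metis
  have fRd: "f \<in> Rd"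
    using f(1) B_Rd by blast
  have repGL: "rep w \<in> GLs" if "w \<in> orb" for w
    using rep(1)[OF that] G_GL by blast
  have ev_conj: "ev x (A (rep w) f) = (if x = w then 1 else 0)" if "w \<in> orb" for x w
  proof -
    have "inv_into UNIV (rep w) x = v \<longleftrightarrow> x = w"
      using GL_inv_apply[OF repGL[OF that]] rep(2)[OF that] by metis
    then show ?thesis
      using ev_act[OF repGL[OF that] fRd, of x] f(2,3) by auto
  qed
  define r where "r = card orb"
  define \<delta> where "\<delta> = (\<Prod>w\<in>orb - {v}. f - A (rep w) f)"
  define N where "N b = (\<Sum>w\<in>orb. smult (A (rep w) b) (\<Prod>w'\<in>orb - {w}. [:- A (rep w') f, 1:]))" for b
  have N_eval: "poly (N b) f = \<delta> * b" if b: "b \<in> B" for b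
  proof -
    have "poly (N b) f = (\<Sum>w\<in>orb. A (rep w) b * (\<Prod>w'\<in>orb - {w}. f - A (rep w') f))"
      by (simp add: N_def poly_sum poly_prod)
    also have "\<dots> = (\<Sum>w\<in>{v}. A (rep w) b * (\<Prod>w'\<in>orb - {w}. f - A (rep w') f))"
    proof (rule sum.mono_neutral_right[OF finite_orb])
      show "\<forall>w\<in>orb - {v}. A (rep w) b * (\<Prod>w'\<in>orb - {w}. f - A (rep w') f) = 0"
      proof
        fix w assume "w \<in> orb - {v}"
        then have "v \<in> orb - {w}"
          using v_orb by auto
        then have "(\<Prod>w'\<in>orb - {w}. f - A (rep w') f) = 0"
          using finite_orb act_rep_v[OF f(1)] by (intro prod_zero bexI[of _ v]) auto
        then show "A (rep w) b * (\<Prod>w'\<in>orb - {w}. f - A (rep w') f) = 0"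
          by simp
      qed
    qed (use v_orb in auto)
    finally show ?thesis
      using act_rep_v[OF b] by (simp add: \<delta>_def mult.commute)
  qed
  have N_coeff: "coeff (N b) l \<in> S" if b: "b \<in> B" for b l
  proof -
    have "map_poly (A g) (N b) = N b" if g: "g \<in> G" for g
    proof -
      interpret a: rhom "A g" by (rule rhom_act)
      interpret m: rhom "map_poly (A g)" by (rule a.rhom_map_poly)
      have "map_poly (A g) (N b) =
        (\<Sum>w\<in>orb. smult (A g (A (rep w) b)) (\<Prod>w'\<in>orb - {w}. [:- A g (A (rep w') f), 1:]))"
        unfolding N_def m.hom_sum
        by (intro sum.cong refl) (simp add: map_poly_smult a.hom_mult m.hom_prod map_poly_pCons a.hom_uminus)
      also have "\<dots> = (\<Sum>w\<in>orb. smult (A (rep (g w)) b) (\<Prod>w'\<in>orb - {g w}. [:- A (rep w') f, 1:]))"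
      proof (intro sum.cong refl)
        fix w assume w: "w \<in> orb"
        have "bij_betw g (orb - {w}) (orb - {g w})"
          using orb_bij[OF g] w by (intro bij_betw_DiffI) (auto simp: bij_betw_def)
        then have "(\<Prod>w'\<in>orb - {w}. [:- A (rep (g w')) f, 1:]) = (\<Prod>w'\<in>orb - {g w}. [:- A (rep w') f, 1:])"
          by (rule prod.reindex_bij_betw)
        moreover have "(\<Prod>w'\<in>orb - {w}. [:- A g (A (rep w') f), 1:]) = (\<Prod>w'\<in>orb - {w}. [:- A (rep (g w')) f, 1:])"
          using act_rep[OF g _ f(1)] by (intro prod.cong refl) auto
        ultimately show "smult (A g (A (rep w) b)) (\<Prod>w'\<in>orb - {w}. [:- A g (A (rep w') f), 1:]) =
            smult (A (rep (g w)) b) (\<Prod>w'\<in>orb - {g w}. [:- A (rep w') f, 1:])"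
          using act_rep[OF g w b] by simp
      qed
      also have "\<dots> = N b"
        unfolding N_def by (rule sum.reindex_bij_betw[OF orb_bij[OF g]])
      finally show ?thesis .
    qed
    then have "A g (coeff (N b) l) = coeff (N b) l" if "g \<in> G" for g
      using that coeff_map_poly[of "A g" "N b" l] rhom.hom_zero[OF rhom_act, of g] by simp
    moreover have "coeff (N b) l \<in> Rd"
      unfolding N_def coeff_sum coeff_smult using b B_Rd fRd
      by (intro R.sum_mem R.mult_mem coeffs_prod_mem sub_comm_ring_poly_ring R.uminus_mem act_mem) auto
    ultimately show ?thesis
      by (simp add: invs_def)
  qed
  have N_deg: "coeff (N b) l = 0" if "l \<ge> r" for b l
  proof -
    have "coeff (\<Prod>w'\<in>orb - {w}. [:- A (rep w') f, 1:]) l = 0" if w: "w \<in> orb" for w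
    proof (rule coeff_eq_0)
      have "degree (\<Prod>w'\<in>orb - {w}. [:- A (rep w') f, 1:]) \<le> (\<Sum>w'\<in>orb - {w}. degree [:- A (rep w') f, 1:])"
        using finite_orb by (intro degree_prod_sum_le[unfolded o_def]) auto
      also have "\<dots> = card (orb - {w})"
        by simp
      also have "\<dots> < r"
        unfolding r_def by (rule card_Diff1_less[OF finite_orb w])
      finally show "degree (\<Prod>w'\<in>orb - {w}. [:- A (rep w') f, 1:]) < l"
        using \<open>r \<le> l\<close> by simp
    qed
    then show ?thesis
      by (simp add: N_def coeff_sum)
  qed
  have unique: "p = 0" if pS: "\<And>l. coeff p l \<in> S" and deg: "\<And>l. l \<ge> r \<Longrightarrow> coeff p l = 0" and root: "poly p f = 0" for p
  proof (rule ccontr)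
    assume "p \<noteq> 0"
    have "poly p (A (rep w) f) = 0" if w: "w \<in> orb" for w
    proof -
      have "map_poly (A (rep w)) p = p"
        using pS rep(1)[OF w] rhom.hom_zero[OF rhom_act] by (intro poly_eqI) (simp add: coeff_map_poly invs_def)
      then show ?thesis
        using rhom.hom_poly[OF rhom_act, of "rep w" p f] root rhom.hom_zero[OF rhom_act] by simp
    qed
    then have sub: "(\<lambda>w. A (rep w) f) ` orb \<subseteq> {x. poly p x = 0}"
      by auto
    have "inj_on (\<lambda>w. A (rep w) f) orb"
    proof (rule inj_onI)
      fix w w' assume "w \<in> orb" "w' \<in> orb" "A (rep w) f = A (rep w') f"
      then show "w = w'"
        using ev_conj[of w w] ev_conj[of w' w] by (auto split: if_splits)
    qed
    then have "r \<le> card {x. poly p x = 0}"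
      using card_mono[OF poly_roots_finite[OF \<open>p \<noteq> 0\<close>] sub] by (simp add: card_image r_def)
    also have "\<dots> \<le> degree p"
      by (rule card_poly_roots_bound[OF \<open>p \<noteq> 0\<close>])
    finally show False
      using deg[of "degree p"] \<open>p \<noteq> 0\<close> by simp
  qed
  show ?thesis
  proof (intro bexI[of _ \<delta>] conjI allI impI)
    show "\<delta> \<in> B"
    proof -
      have "\<delta> = poly (N 1) f"
        using N_eval[OF B.one_mem] by simp
      also have "\<dots> \<in> B"
        unfolding poly_altdef using N_coeff[OF B.one_mem] S_B f(1)
        by (intro B.sum_mem B.mult_mem B.power_mem) auto
      finally show ?thesis .
    qed
    show "ev v \<delta> = 1"
      unfolding \<delta>_def rhom.hom_prod[OF rhom_ev] rhom.hom_diff[OF rhom_ev]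
      using ev_conj f(2) by (intro prod.neutral) auto
    fix n and y :: "nat \<Rightarrow> 'k mpolynomial"
    assume y: "\<forall>i<n. y i \<in> S" and reg: "almost_regular S 1 y n"
    show "almost_regular B \<delta> y n"
      unfolding almost_regular_def
    proof (intro allI impI ballI)
      fix k a assume k: "k < n" and a: "a \<in> B" and "y k * a \<in> lincombs B y k"
      then obtain b where b: "\<forall>i<k. b i \<in> B" "y k * a = (\<Sum>i<k. b i * y i)"
        by (auto simp: lincombs_def)
      define p where "p = smult (y k) (N a) - (\<Sum>i<k. smult (y i) (N (b i)))"
      have coeff_p: "coeff p l = y k * coeff (N a) l - (\<Sum>i<k. coeff (N (b i)) l * y i)" for l
        by (simp add: p_def coeff_sum mult.commute)
      have "p = 0"
      proof (rule unique)
        show "coeff p l \<in> S" for l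
          unfolding coeff_p using y k b(1) a N_coeff
          by (intro S.diff_mem S.mult_mem S.sum_mem) auto
        show "coeff p l = 0" if "l \<ge> r" for l
          unfolding coeff_p using N_deg[OF that] by simp
        have "poly p f = \<delta> * (y k * a) - \<delta> * (\<Sum>i<k. b i * y i)"
          using b(1) by (simp add: p_def poly_sum N_eval[OF a] N_eval sum_distrib_left mult_ac)
        then show "poly p f = 0"
          by (simp add: b(2))
      qed
      have "coeff (N a) l \<in> lincombs B y k" for l
      proof -
        have "y k * coeff (N a) l = (\<Sum>i<k. coeff (N (b i)) l * y i)"
          using coeff_p[of l] \<open>p = 0\<close> by simp
        also have "\<dots> \<in> lincombs S y k"
          using b(1) N_coeff by (intro lincombsI) auto
        finally have "1 * coeff (N a) l \<in> lincombs S y k"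
          using reg k N_coeff[OF a] unfolding almost_regular_def by blast
        moreover have "lincombs S y k \<subseteq> lincombs B y k"
          using S_B by (force simp: lincombs_def)
        ultimately show ?thesis
          by auto
      qed
      then have "(\<Sum>l\<le>degree (N a). f ^ l * coeff (N a) l) \<in> lincombs B y k"
        using f(1) by (intro submod_sum[OF B.submod_lc] submodD(3)[OF B.submod_lc]) auto
      also have "(\<Sum>l\<le>degree (N a). f ^ l * coeff (N a) l) = \<delta> * a"
        using N_eval[OF a] by (simp add: poly_altdef mult.commute)
      finally show "\<delta> * a \<in> lincombs B y k" .
    qed
  qed
qed

subsection \<open>Translation to the origin\<close>

definition translate :: "'v \<Rightarrow> 'k mpolynomial \<Rightarrow> 'k mpolynomial" where
  "translate u = peval const (\<lambda>i. var i + const (coord i u))"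

lemma rhom_translate: "rhom (translate u)"
  unfolding translate_def by (rule rhom_peval[OF rhom_const])

lemma translate_const: "translate u (const a) = const a"
  unfolding translate_def by (rule peval_const[OF rhom_const])

lemma translate_var: "translate u (var i) = var i + const (coord i u)"
  unfolding translate_def by (rule peval_var[OF rhom_const])

lemma translate_lf:
  assumes "\<phi> \<in> dual"
  shows "translate u (lf \<phi>) = lf \<phi> + const (\<phi> u)"
proof -
  interpret t: rhom "translate u" by (rule rhom_translate)
  interpret C: rhom "const :: 'k \<Rightarrow> _" by (rule rhom_const)
  have "translate u (lf \<phi>) = lf \<phi> + const (\<Sum>j<d. \<phi> (e j) * coord j u)"
    by (simp add: lf_eq t.hom_sum t.hom_mult translate_const translate_var distrib_left sum.distrib
        C.hom_sum C.hom_mult)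
  then show ?thesis
    by (simp flip: dual_expansion[OF assms])
qed

lemma translate_mem_Rd:
  assumes "f \<in> Rd"
  shows "translate u f \<in> Rd"
proof -
  interpret t: rhom "translate u" by (rule rhom_translate)
  interpret R: sub_comm_ring Rd by (rule sub_comm_ring_poly_ring)
  have "sub_comm_ring {f. translate u f \<in> Rd}"
    by standard (auto simp: t.hom_diff t.hom_mult)
  then have "Rd \<subseteq> {f. translate u f \<in> Rd}"
    by (rule poly_ring_subset) (auto simp: translate_const translate_var const_mem_poly_ring var_mem_poly_ring)
  then show ?thesis
    using assms by blast
qed

text \<open>Translation by a vector that the stabilizer fixes commutes with the stabilizer.\<close>

lemma translate_mem_B:
  assumes u: "\<forall>h\<in>stab. h u = u" and f: "f \<in> B"
  shows "translate u f \<in> B"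
proof -
  have "A h (translate u f) = translate u f" if h: "h \<in> stab" for h
  proof -
    have hGL: "h \<in> GLs"
      using h stab_GL by blast
    have inv: "inv_into UNIV h u = u"
      using GL_inv_apply(1)[OF hGL, of u] bspec[OF u h] by simp
    have "A h (translate u f) = translate u (A h f)"
    proof (rule rhom_mpoly_eq[of "\<lambda>f. A h (translate u f)" "\<lambda>f. translate u (A h f)" d f])
      show "rhom (\<lambda>f. A h (translate u f))" "rhom (\<lambda>f. translate u (A h f))"
        by (rule rhom_comp[OF rhom_act rhom_translate], rule rhom_comp[OF rhom_translate rhom_act])
      show "A h (translate u (const a)) = translate u (A h (const a))" for a
        by (simp add: act_const translate_const)
      show "A h (translate u (var i)) = translate u (A h (var i))" for i
        using translate_lf[OF dual_comp[OF coord_dual GL_inv[OF hGL]], of u i] inv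
        by (simp add: translate_var rhom.hom_add[OF rhom_act] act_const act_var)
      show "f \<in> Rd"
        using f B_Rd by blast
    qed
    then show ?thesis
      using f h by (simp add: invs_def)
  qed
  then show ?thesis
    using f translate_mem_Rd by (simp add: invs_def)
qed

lemma translate_inverse:
  assumes "f \<in> Rd"
  shows "translate u (translate (- u) f) = f"
proof (rule rhom_mpoly_eq[of "\<lambda>f. translate u (translate (- u) f)" "\<lambda>f. f" d f])
  show "rhom (\<lambda>f. translate u (translate (- u) f))"
    by (rule rhom_comp[OF rhom_translate rhom_translate])
  have "coord i (- u) = - coord i u" for i
    using coord_dual[of i] dual_zero[OF coord_dual, of i]
    by (metis add_eq_0_iff mem_dual neg_eq_iff_add_eq_0)
  then show "translate u (translate (- u) (var i)) = var i" for i
    by (simp add: translate_var translate_const rhom.hom_diff[OF rhom_translate] single_uminus)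
qed (use assms in \<open>auto simp: rhom_id translate_const\<close>)

lemma translate_constant_term:
  assumes "f \<in> Rd"
  shows "coeff (mgr (translate u f)) 0 = const (ev u f)"
proof (rule rhom_mpoly_eq[of "\<lambda>f. coeff (mgr (translate u f)) 0" "\<lambda>f. const (ev u f)" d f])
  interpret m: rhom "mgr :: 'k mpolynomial \<Rightarrow> _" by (rule rhom_mgr)
  have "rhom (\<lambda>f :: 'k mpolynomial. coeff (mgr f) 0)"
    by standard (auto simp: m.hom_add m.hom_mult coeff_mult_0)
  then show "rhom (\<lambda>f. coeff (mgr (translate u f)) 0)"
    by (rule rhom_comp[OF _ rhom_translate])
  show "rhom (\<lambda>f. const (ev u f))"
    by (rule rhom_comp[OF rhom_const rhom_ev])
  show "coeff (mgr (translate u (var i))) 0 = const (ev u (var i))" for i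
    by (simp add: translate_var ev_var m.hom_add mgr_var mgr_const)
qed (use assms in \<open>auto simp: translate_const ev_const mgr_const\<close>)

text \<open>Translation by \<open>u\<close> is an automorphism of \<open>B\<close>, with the translation by \<open>- u\<close> as inverse.\<close>

lemma translate_regular:
  assumes u: "\<forall>h\<in>stab. h u = u" and y: "\<And>i. i < n \<Longrightarrow> y i \<in> B"
    and reg: "almost_regular B \<delta> y n" and \<delta>: "\<delta> \<in> B"
  shows "almost_regular B (translate u \<delta>) (\<lambda>i. translate u (y i)) n"
proof -
  have u': "\<forall>h\<in>stab. h (- u) = - u"
  proof
    fix h assume h: "h \<in> stab"
    then have "h (- u) + h u = 0"
      using stab_GL GL_zero[of h] by (metis ab_left_minus mem_GL subsetD)
    then show "h (- u) = - u"
      using bspec[OF u h] by (simp add: add_eq_0_iff2)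
  qed
  have lincombs_translate: "translate w x \<in> lincombs B (\<lambda>i. translate w (z i)) k"
    if w: "\<forall>h\<in>stab. h w = w" and x: "x \<in> lincombs B z k" for w x z k
  proof -
    obtain b where "\<forall>i<k. b i \<in> B" "x = (\<Sum>i<k. b i * z i)"
      using x by (auto simp: lincombs_def)
    then show ?thesis
      using translate_mem_B[OF w] lincombsI[of k "\<lambda>i. translate w (b i)" B "\<lambda>i. translate w (z i)"]
      by (simp add: rhom.hom_sum[OF rhom_translate] rhom.hom_mult[OF rhom_translate])
  qed
  show ?thesis
    unfolding almost_regular_def
  proof (intro allI impI ballI)
    fix k a assume k: "k < n" and a: "a \<in> B" and rel: "translate u (y k) * a \<in> lincombs B (\<lambda>i. translate u (y i)) k"
    define a' where "a' = translate (- u) a"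
    have a': "a' \<in> B"
      unfolding a'_def by (rule translate_mem_B[OF u' a])
    have cancel: "translate (- u) (translate u x) = x" if "x \<in> B" for x
      using translate_inverse[of x "- u"] that B_Rd by auto
    have "translate (- u) (translate u (y k) * a) \<in> lincombs B (\<lambda>i. translate (- u) (translate u (y i))) k"
      by (rule lincombs_translate[OF u' rel])
    moreover have "lincombs B (\<lambda>i. translate (- u) (translate u (y i))) k = lincombs B y k"
      using cancel y k by (intro lincombs_cong) auto
    ultimately have "y k * a' \<in> lincombs B y k"
      using cancel[OF y[OF k]] by (simp add: rhom.hom_mult[OF rhom_translate] a'_def)
    then have "\<delta> * a' \<in> lincombs B y k"
      using reg k a' by (auto simp: almost_regular_def)
    then have "translate u (\<delta> * a') \<in> lincombs B (\<lambda>i. translate u (y i)) k"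
      by (rule lincombs_translate[OF u])
    moreover have "translate u a' = a"
      unfolding a'_def using a B_Rd by (intro translate_inverse) auto
    ultimately show "translate u \<delta> * a \<in> lincombs B (\<lambda>i. translate u (y i)) k"
      by (simp add: rhom.hom_mult[OF rhom_translate])
  qed
qed

text \<open>The sequence \<open>y\<close> in the proof differs from the Dickson polynomials only in its last member, from
  which the value at \<open>v\<close> is subtracted. It vanishes at \<open>v\<close> and is regular on \<open>S\<close>, hence on \<open>B\<close> near \<open>v\<close>.
  Translation moves it to the origin, where it shows that the Dickson polynomials are regular on
  \<open>B\<close>; and their regularity descends to \<open>S\<close>.\<close>

theorem dickson_regular:
  assumes unit: "of_nat (card orb) \<noteq> (0 :: 'k)" and reg: "almost_regular S 1 dk (d - 1)"
  shows "almost_regular S 1 dk d"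
proof -
  interpret P: parameter_algebra B dk "\<lambda>i. q ^ d - q ^ i" d
    by (rule parameter_algebra_invs[OF stab_GL])
  have "d > 0"
  proof (rule ccontr)
    assume "\<not> d > 0"
    then show False
      using coord_inject[of v 0] v_nz by simp
  qed
  define \<gamma> where "\<gamma> = ev v (dk (d - 1))"
  have "\<gamma> \<noteq> 0"
    unfolding \<gamma>_def by (rule dickson_at_point(2)[OF v_nz])
  define y where "y = dk(d - 1 := dk (d - 1) - const \<gamma>)"
  have constS: "const a \<in> S" for a
    by (simp add: invs_def const_mem_poly_ring act_const)
  have yS: "y i \<in> S" for i
    using dickson_mem[OF G_GL] constS by (auto simp: y_def)
  have "almost_regular S 1 y (Suc (d - 1))"
    unfolding y_def
  proof (rule S.almost_regular_shifted[where e = "\<lambda>i. q ^ d - q ^ i" and m = "q ^ d - q ^ (d - 1)" and \<gamma>' = "const (1 / \<gamma>)"])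
    show "const (1 / \<gamma>) * const \<gamma> = 1"
      using \<open>\<gamma> \<noteq> 0\<close> by (simp add: mult_single)
  qed (use \<open>d > 0\<close> reg dickson_degree[of "d - 1"] in \<open>auto simp: mgr_dickson dickson_degree mgr_const constS dickson_mem[OF G_GL]\<close>)
  then have yreg: "almost_regular S 1 y d"
    using \<open>d > 0\<close> by simp
  have ev_y: "ev v (y i) = 0" if "i < d" for i
  proof (cases "i = d - 1")
    case True
    then show ?thesis
      by (simp add: y_def rhom.hom_diff[OF rhom_ev] ev_const \<gamma>_def)
  next
    case False
    then show ?thesis
      using dickson_at_point(1)[OF v_nz, of i] that by (simp add: y_def)
  qed
  obtain \<delta> where \<delta>: "\<delta> \<in> B" "ev v \<delta> = 1"
    "\<And>n y. \<forall>i<n. y i \<in> S \<Longrightarrow> almost_regular S 1 y n \<Longrightarrow> almost_regular B \<delta> y n"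
    using regular_near_point by blast
  have fix_v: "\<forall>h\<in>stab. h v = v"
    by (simp add: stab_def)
  have yB: "y i \<in> B" for i
    using yS S_B by blast
  have "almost_regular B (translate v \<delta>) (\<lambda>i. translate v (y i)) d"
    using \<delta>(3)[of d y] yS yreg \<delta>(1) yB fix_v by (intro translate_regular) auto
  moreover have "translate v (y j) \<in> P.origin" if "j < d" for j
    using translate_mem_B[OF fix_v yB] translate_constant_term[of "y j" v] ev_y[OF that] yB B_Rd
    by (auto simp: P.origin_def)
  moreover have "translate v \<delta> \<in> B"
    by (rule translate_mem_B[OF fix_v \<delta>(1)])
  moreover have "coeff (mgr (translate v \<delta>)) 0 = 1"
    using translate_constant_term[of \<delta> v] \<delta>(1,2) B_Rd by auto
  ultimately have "almost_regular B 1 dk d"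
    by (intro P.params_regular_of_local)
  then show ?thesis
    using dickson_mem[OF G_GL] by (intro regular_descends[OF unit])
qed

end

section \<open>The criterion\<close>

context invariants
begin

text \<open>The ideal of the sequence is proper, since its members have no constant term.\<close>

lemma regular_sequence_dickson_iff:
  "regular_sequence (invariant_ring scale d e G) (map dk [0..<d - 1]) \<longleftrightarrow>
     almost_regular (invs G) 1 dk (d - 1)"
proof -
  interpret P: parameter_algebra "invs G" dk "\<lambda>i. q ^ d - q ^ i" d
    by (rule parameter_algebra_invs[OF G_GL])
  have lincombs_eq: "lincombs (invs G) (\<lambda>i. map dk [0..<d - 1] ! i) k = lincombs (invs G) dk k" if "k \<le> d - 1" for k
    using that by (intro lincombs_cong) auto
  have "lincombs (invs G) dk (d - 1) \<subseteq> P.origin"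
  proof -
    have "dk i \<in> P.origin" if "i < d" for i
      using P.param_mem[OF that] mgr_dickson[OF that] dickson_degree[OF that] by (simp add: P.origin_def)
    moreover have "submod (invs G) P.origin"
      using P.maximal_origin by (simp add: maximalideal_def P.ideal_ring_on_iff)
    ultimately show ?thesis
      unfolding P.aspan_eq_lc[symmetric] by (intro aspan_least) auto
  qed
  then have "1 \<notin> lincombs (invs G) dk (d - 1)"
    by (auto simp: P.origin_def P.gr_1)
  then have "lincombs (invs G) dk (d - 1) \<noteq> invs G"
    using P.one_mem by metis
  moreover have "almost_regular (invs G) 1 (\<lambda>i. map dk [0..<d - 1] ! i) (d - 1) \<longleftrightarrow>
      almost_regular (invs G) 1 dk (d - 1)"
    by (simp add: almost_regular_def lincombs_eq del: One_nat_def)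
  ultimately show ?thesis
    using dickson_mem[OF G_GL]
    by (simp add: invariant_ring_eq P.regular_sequence_ring_on_iff lincombs_eq del: One_nat_def)
qed

lemma cohen_macaulay_iff: "cohen_macaulay (invariant_ring scale d e G) \<longleftrightarrow> almost_regular (invs G) 1 dk (d - 1)"
proof
  interpret P: parameter_algebra "invs G" dk "\<lambda>i. q ^ d - q ^ i" d
    by (rule parameter_algebra_invs[OF G_GL])
  {
    assume cm: "cohen_macaulay (invariant_ring scale d e G)"
    obtain Q :: "nat \<Rightarrow> 'k mpolynomial set" where "\<forall>i\<le>d. P.prime_in (Q i)" "\<forall>i<d. Q i \<subset> Q (Suc i)"
      "Q d = P.origin"
      using prime_chain_to_origin[OF G_GL] unfolding P.origin_def by blast
    then have "almost_regular (invs G) 1 dk d"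
      using cm unfolding invariant_ring_eq by (intro P.regular_of_cohen_macaulay[of Q]) auto
    then show "almost_regular (invs G) 1 dk (d - 1)"
      by (auto simp: almost_regular_def)
  next
    assume reg: "almost_regular (invs G) 1 dk (d - 1)"
    have "almost_regular (invs G) 1 dk d"
    proof (cases "d = 0")
      case True
      then show ?thesis
        by (simp add: almost_regular_def)
    next
      case False
      then obtain v where v: "v \<noteq> 0" "of_nat (card ((\<lambda>g. g v) ` G)) \<noteq> (0 :: 'k)"
        using orbit_prime_to_char by blast
      interpret point_stabilizer scale d e q G v
        by unfold_locales (rule v(1))
      show ?thesis
        using dickson_regular reg v(2) by (simp add: orb_def)
    qed
    then show "cohen_macaulay (invariant_ring scale d e G)"
      unfolding invariant_ring_eq by (rule P.cohen_macaulay_of_regular)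
  }
qed

end

theorem corollary1p7:
  fixes scale :: "'k::{field,finite} \<Rightarrow> 'v::ab_group_add \<Rightarrow> 'v"
    and d :: nat
    and e :: "nat \<Rightarrow> 'v"
    and G :: "('v \<Rightarrow> 'v) set"
  assumes "vector_space scale"
    and "ordered_basis scale d e"
    and "subgroup G (GL scale)"
  shows "cohen_macaulay (invariant_ring scale d e G) \<longleftrightarrow>
         regular_sequence (invariant_ring scale d e G)
           (map (dickson scale d e) [0..<d - 1])"
proof -
  interpret invariants scale d e "card (UNIV :: 'k set)" G
    by (intro invariants.intro finite_space.intro invariants_axioms.intro assms refl)
  show ?thesis
    by (simp only: cohen_macaulay_iff regular_sequence_dickson_iff)
qed

end
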